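(* Let $K$ be a field and let $\mathcal{C}$ be a uniform clutter. If $\mathcal{C}$ satisfies the packing property (respectively, the max-flow min-cut property), then there is a uniform clutter $\mathcal{C}_1$, Cohen-Macaulay over $K$, satisfying the packing property (respectively, the max-flow min-cut property), such that $\mathcal{C}$ is a minor of $\mathcal{C}_1$.
   Context: A clutter $\mathcal{C}$ with finite vertex set $V(\mathcal{C})=X=\{x_1,\ldots,x_n\}$ is a family $E(\mathcal{C})$ of subsets of $X$ (edges), none of which is included in another; it is uniform if all its edges have the same number of vertices. Standing assumption on $\mathcal{C}$: $n\geq 1$ and each vertex lies in at least one edge (so all edges are nonempty). The vertices are identified with indeterminates. The edge ideal $I(\mathcal{C})$ is the ideal of $K[V(\mathcal{C})]$ generated by the square-free monomials $\prod_{x_i\in e}x_i$, $e\in E(\mathcal{C})$ (the zero ideal if there are no edges). This gives a bijection between clutters and square-free monomial ideals. $\mathcal{C}$ is called Cohen-Macaulay (over $K$) if $K[V(\mathcal{C})]/I(\mathcal{C})$ is a Cohen-Macaulay ring. Minors: let $X'=\{x_{i_1},\ldots,x_{i_r},x_{j_1},\ldots,x_{j_s}\}$ be a subset of $X$ (distinct elements; $X'$ may be empty). A minor of $I=I(\mathcal{C})$ is a proper ideal $I'$ of $K[X\setminus X']$ obtained from $I$ by making $x_{i_k}=0$ and $x_{j_\ell}=1$ for all $k,\ell$ (in the generators of $I$). A minor of $\mathcal{C}$ is a clutter (on the vertex set $X\setminus X'$) whose edge ideal is a minor $I'$ of $I$; its edges are the supports of the minimal monomial generators of $I'$. In particular $\mathcal{C}$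 is a minor of itself. König and packing properties: a vertex cover of $\mathcal{C}$ is a set of vertices meeting every edge; $\alpha_0(\mathcal{C})$ is the minimum cardinality of a vertex cover; $\beta_1(\mathcal{C})$ is the maximum number of pairwise disjoint edges. $\mathcal{C}$ has the König property if $\alpha_0(\mathcal{C})=\beta_1(\mathcal{C})$. $\mathcal{C}$ satisfies the packing property if every minor of $\mathcal{C}$ has the König property. Max-flow min-cut property: let $A$ be the incidence matrix of $\mathcal{C}$, i.e. the $n\times q$ matrix whose columns are the characteristic vectors of the edges of $\mathcal{C}$, and let $\mathbf{1}$ be the all-ones vector. $\mathcal{C}$ satisfies the max-flow min-cut property if both sides of the LP-duality equation $$\min\{\langle w,x\rangle \mid x\geq 0;\ xA\geq\mathbf{1}\}=\max\{\langle y,\mathbf{1}\rangle \mid y\geq 0;\ Ay\leq w\}$$ have integral optimum solutions $x$ and $y$ for each non-negative integral vector $w$. *)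

theory Defs
  imports
    "HOL-Algebra.Ring_Divisibility"
    "HOL-Library.Poly_Mapping"
    "HOL-Library.Extended_Nat"
    "HOL-Library.Infinite_Typeclass"
begin

section \<open>Cohen-Macaulay rings\<close>

text \<open>
  For a multiplicative set \<open>S\<close>, the fractions \<open>a/s\<close> and \<open>b/t\<close> are identified iff
  \<open>u (a t - b s) = 0\<close> for some \<open>u \<in> S\<close>.  In the operations of \<open>localization\<close>,
  the sets united over all representatives coincide.
\<close>

definition frac_rel :: "('a, 'b) ring_scheme \<Rightarrow> 'a set \<Rightarrow> (('a \<times> 'a) \<times> ('a \<times> 'a)) set" where
  "frac_rel R S =
     {((a, s), (b, t)). a \<in> carrier R \<and> s \<in> S \<and> b \<in> carrier R \<and> t \<in> S \<and>
        (\<exists>u\<in>S. u \<otimes>\<^bsub>R\<^esub> ((a \<otimes>\<^bsub>R\<^esub> t) \<ominus>\<^bsub>R\<^esub> (b \<otimes>\<^bsub>R\<^esub> s)) = \<zero>\<^bsub>R\<^esub>)}"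

definition frac :: "('a, 'b) ring_scheme \<Rightarrow> 'a set \<Rightarrow> 'a \<Rightarrow> 'a \<Rightarrow> ('a \<times> 'a) set" where
  "frac R S a s = frac_rel R S `` {(a, s)}"

definition localization :: "('a, 'b) ring_scheme \<Rightarrow> 'a set \<Rightarrow> (('a \<times> 'a) set) ring" where
  "localization R S =
     \<lparr>carrier = (carrier R \<times> S) // frac_rel R S,
      mult = (\<lambda>X Y. \<Union>(a, s)\<in>X. \<Union>(b, t)\<in>Y. frac R S (a \<otimes>\<^bsub>R\<^esub> b) (s \<otimes>\<^bsub>R\<^esub> t)),
      one = frac R S \<one>\<^bsub>R\<^esub> \<one>\<^bsub>R\<^esub>,
      zero = frac R S \<zero>\<^bsub>R\<^esub> \<one>\<^bsub>R\<^esub>,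
      add = (\<lambda>X Y. \<Union>(a, s)\<in>X. \<Union>(b, t)\<in>Y.
               frac R S ((a \<otimes>\<^bsub>R\<^esub> t) \<oplus>\<^bsub>R\<^esub> (b \<otimes>\<^bsub>R\<^esub> s)) (s \<otimes>\<^bsub>R\<^esub> t))\<rparr>"

definition krull_dim :: "('a, 'b) ring_scheme \<Rightarrow> enat" where
  "krull_dim R =
     Sup {enat n | n. \<exists>p :: nat \<Rightarrow> 'a set.
            (\<forall>i\<le>n. primeideal (p i) R) \<and> (\<forall>i<n. p i \<subset> p (Suc i))}"

text \<open>Each term is a nonzerodivisor modulo its predecessors, and the quotient is nonzero.\<close>

definition regular_sequence :: "('a, 'b) ring_scheme \<Rightarrow> 'a list \<Rightarrow> bool" where
  "regular_sequence R xs \<longleftrightarrow>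
     set xs \<subseteq> carrier R \<and>
     (\<forall>i<length xs. \<forall>a\<in>carrier R.
        xs ! i \<otimes>\<^bsub>R\<^esub> a \<in> Idl\<^bsub>R\<^esub> (set (take i xs)) \<longrightarrow> a \<in> Idl\<^bsub>R\<^esub> (set (take i xs))) \<and>
     Idl\<^bsub>R\<^esub> (set xs) \<noteq> carrier R"

definition depth :: "('a, 'b) ring_scheme \<Rightarrow> 'a set \<Rightarrow> enat" where
  "depth R m = Sup {enat (length xs) | xs. set xs \<subseteq> m \<and> regular_sequence R xs}"

definition cohen_macaulay_local_ring :: "('a, 'b) ring_scheme \<Rightarrow> bool" where
  "cohen_macaulay_local_ring R \<longleftrightarrow>
     cring R \<and> noetherian_ring R \<and> (\<exists>!m. maximalideal m R) \<and>
     (\<forall>m. maximalideal m R \<longrightarrow> depth R m = krull_dim R)"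

definition cohen_macaulay_ring :: "('a, 'b) ring_scheme \<Rightarrow> bool" where
  "cohen_macaulay_ring R \<longleftrightarrow>
     cring R \<and> noetherian_ring R \<and>
     (\<forall>m. maximalideal m R \<longrightarrow> cohen_macaulay_local_ring (localization R (carrier R - m)))"


section \<open>Polynomial rings\<close>

text \<open>
  Polynomials over \<open>'k\<close> with indeterminates in \<open>'v\<close> are finitely supported maps from
  monomials to coefficients; \<open>poly_ring V\<close> consists of those in which only indeterminates
  from \<open>V\<close> occur.
\<close>

type_synonym ('v, 'k) mpoly = "('v \<Rightarrow>\<^sub>0 nat) \<Rightarrow>\<^sub>0 'k"

definition poly_ring :: "'v set \<Rightarrow> ('v, 'k::field) mpoly ring" where
  "poly_ring V =
     \<lparr>carrier = {p. \<forall>m\<in>Poly_Mapping.keys p. Poly_Mapping.keys m \<subseteq> V},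
      mult = (*), one = 1, zero = 0, add = (+)\<rparr>"

definition pvar :: "'v \<Rightarrow> ('v, 'k::field) mpoly" where
  "pvar v = Poly_Mapping.single (Poly_Mapping.single v 1) 1"

definition substitute :: "('v \<Rightarrow> ('v, 'k) mpoly) \<Rightarrow> ('v, 'k::field) mpoly \<Rightarrow> ('v, 'k) mpoly" where
  "substitute \<sigma> p =
     (\<Sum>m\<in>Poly_Mapping.keys p.
        Poly_Mapping.single 0 (Poly_Mapping.lookup p m) *
        (\<Prod>v\<in>Poly_Mapping.keys m. \<sigma> v ^ Poly_Mapping.lookup m v))"


section \<open>Clutters and their edge ideals\<close>

definition clutter :: "'v set \<Rightarrow> 'v set set \<Rightarrow> bool" where
  "clutter V E \<longleftrightarrow> finite V \<and> E \<subseteq> Pow V \<and> (\<forall>e\<in>E. \<forall>f\<in>E. e \<subseteq> f \<longrightarrow> e = f)"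

text \<open>
  Minors may have no vertices, or vertices lying in no edge; this predicate excludes both.
\<close>

definition covered_clutter :: "'v set \<Rightarrow> 'v set set \<Rightarrow> bool" where
  "covered_clutter V E \<longleftrightarrow> clutter V E \<and> V \<noteq> {} \<and> (\<forall>v\<in>V. \<exists>e\<in>E. v \<in> e)"

definition uniform :: "'v set set \<Rightarrow> bool" where
  "uniform E \<longleftrightarrow> (\<exists>d. \<forall>e\<in>E. card e = d)"

definition edge_generators :: "'v set set \<Rightarrow> ('v, 'k::field) mpoly set" where
  "edge_generators E = (\<lambda>e. \<Prod>v\<in>e. pvar v) ` E"

definition edge_ideal :: "'v set \<Rightarrow> 'v set set \<Rightarrow> ('v, 'k::field) mpoly set" where
  "edge_ideal V E = Idl\<^bsub>poly_ring V\<^esub> (edge_generators E)"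

definition cohen_macaulay_clutter :: "'k::field itself \<Rightarrow> 'v set \<Rightarrow> 'v set set \<Rightarrow> bool" where
  "cohen_macaulay_clutter K V E \<longleftrightarrow>
     cohen_macaulay_ring ((poly_ring V :: ('v, 'k) mpoly ring) Quot edge_ideal V E)"


section \<open>Minors\<close>

text \<open>The ideal obtained by making the variables in \<open>Z\<close> zero and those in \<open>U\<close> one.\<close>

definition minor_ideal ::
  "'v set \<Rightarrow> 'v set set \<Rightarrow> 'v set \<Rightarrow> 'v set \<Rightarrow> ('v, 'k::field) mpoly set" where
  "minor_ideal V E Z U =
     Idl\<^bsub>poly_ring (V - (Z \<union> U))\<^esub>
       (substitute (\<lambda>v. if v \<in> Z then 0 else if v \<in> U then 1 else pvar v) ` edge_generators E)"

text \<open>\<open>is_minor K V' E' V E\<close>: the clutter \<open>(V', E')\<close> is a minor of \<open>(V, E)\<close>.\<close>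

definition is_minor ::
  "'k::field itself \<Rightarrow> 'v set \<Rightarrow> 'v set set \<Rightarrow> 'v set \<Rightarrow> 'v set set \<Rightarrow> bool" where
  "is_minor K V' E' V E \<longleftrightarrow>
     clutter V' E' \<and>
     (\<exists>Z U. Z \<subseteq> V \<and> U \<subseteq> V \<and> Z \<inter> U = {} \<and> V' = V - (Z \<union> U) \<and>
        (minor_ideal V E Z U :: ('v, 'k) mpoly set) \<noteq> carrier (poly_ring V') \<and>
        (edge_ideal V' E' :: ('v, 'k) mpoly set) = minor_ideal V E Z U)"


section \<open>The packing property\<close>

definition vertex_cover :: "'v set \<Rightarrow> 'v set set \<Rightarrow> 'v set \<Rightarrow> bool" where
  "vertex_cover V E S \<longleftrightarrow> S \<subseteq> V \<and> (\<forall>e\<in>E. S \<inter> e \<noteq> {})"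

definition covering_number :: "'v set \<Rightarrow> 'v set set \<Rightarrow> nat" where
  "covering_number V E = Min (card ` {S. vertex_cover V E S})"

definition matching_number :: "'v set set \<Rightarrow> nat" where
  "matching_number E = Max (card ` {M. M \<subseteq> E \<and> pairwise disjnt M})"

definition koenig_property :: "'v set \<Rightarrow> 'v set set \<Rightarrow> bool" where
  "koenig_property V E \<longleftrightarrow> covering_number V E = matching_number E"

definition packing_property :: "'k::field itself \<Rightarrow> 'v set \<Rightarrow> 'v set set \<Rightarrow> bool" where
  "packing_property K V E \<longleftrightarrow> (\<forall>V' E'. is_minor K V' E' V E \<longrightarrow> koenig_property V' E')"


section \<open>The max-flow min-cut property\<close>

text \<open>
  Vectors are real functions, only their values on the index sets \<open>V\<close> and \<open>E\<close> being relevant.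
\<close>

definition incidence :: "'v \<Rightarrow> 'v set \<Rightarrow> real" where
  "incidence v e = (if v \<in> e then 1 else 0)"

definition primal_feasible :: "'v set \<Rightarrow> 'v set set \<Rightarrow> ('v \<Rightarrow> real) \<Rightarrow> bool" where
  "primal_feasible V E x \<longleftrightarrow>
     (\<forall>v\<in>V. x v \<ge> 0) \<and> (\<forall>e\<in>E. (\<Sum>v\<in>V. x v * incidence v e) \<ge> 1)"

definition dual_feasible ::
  "'v set \<Rightarrow> 'v set set \<Rightarrow> ('v \<Rightarrow> nat) \<Rightarrow> ('v set \<Rightarrow> real) \<Rightarrow> bool" where
  "dual_feasible V E w y \<longleftrightarrow>
     (\<forall>e\<in>E. y e \<ge> 0) \<and> (\<forall>v\<in>V. (\<Sum>e\<in>E. incidence v e * y e) \<le> real (w v))"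

definition mfmc_property :: "'v set \<Rightarrow> 'v set set \<Rightarrow> bool" where
  "mfmc_property V E \<longleftrightarrow>
     (\<forall>w :: 'v \<Rightarrow> nat.
        (\<exists>x. is_arg_min (\<lambda>x. \<Sum>v\<in>V. real (w v) * x v) (primal_feasible V E) x \<and>
             (\<forall>v\<in>V. x v \<in> \<int>)) \<and>
        (\<exists>y. is_arg_max (\<lambda>y. \<Sum>e\<in>E. y e) (dual_feasible V E w) y \<and>
             (\<forall>e\<in>E. y e \<in> \<int>)))"

end

theory Submission
  imports Defs "HOL-Computational_Algebra.Polynomial"
begin

text \<open>
  To every vertex \<open>i\<close> attach a new edge consisting of \<open>i\<close> and \<open>d - 1\<close> new vertices, where
  \<open>d\<close> is the cardinality of the edges.  The edge ideal of the resulting clutter is the polarization of the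
  Artinian ideal \<open>I(C) + (x\<^sub>i\<^sup>d)\<close>: the differences \<open>\<theta> = y - x\<^sub>i\<close>, for the new vertices \<open>y\<close>
  of the edge at \<open>i\<close>, form a linear system of parameters over which the quotient is free.  A maximal ideal
  \<open>m\<close> contains, by the Nullstellensatz, a monic polynomial \<open>f(\<theta>)\<close> for each \<open>\<theta>\<close>.  Powers of the \<open>x\<^sub>i\<close>,
  of the generators, of the \<open>\<theta>\<close> and of the \<open>f(\<theta>)\<close> give a vector space basis of the polynomial ring in which
  all the ideals involved are spanned by subsets, so that the \<open>f(\<theta>)\<close> form a regular sequence in \<open>m\<close>.
  Chains of primes are no longer than that: counting the monomials outside the edge ideal shows that any
  larger number of elements is algebraically dependent modulo the edge ideal.

  The original clutter is recovered by setting the new vertices to \<open>0\<close>.  In a minor of the new clutter, the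
  traces of the new edges can be added to a maximum matching of a suitable minor of the original one, at the
  cost of one covering vertex each; the same exchange with weights gives the max-flow min-cut property.
\<close>

section \<open>Noetherian rings by adjunction\<close>

text \<open>The Cohen-Macaulay condition is imposed at every maximal ideal m and over an arbitrary
  field, so the linear forms \<theta> need not lie in m; monic polynomials f(\<theta>), possibly of
  degree above one, take their place. Depth and dimension are squeezed to the number of new
  vertices: a regular sequence produces a chain of primes of the same length, and no chain of primes
  above the edge ideal is longer. The obstacle is that one basis has to serve the new edges, the
  original edges and the f(\<theta>) at once. A new edge becomes a monic polynomial in its old
  vertex, and powers are expanded in base of that polynomial. Such an expansion is not compatible
  with multiplication by an old variable, which is what an original edge does; a second basis for
  the cofactor, differing by exactly that variable, restores compatibility. New edges have d
  vertices in order to keep the clutter uniform. The algebra works for any retraction of a finite X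
  onto V. The degenerate case is d = 1, where the new edges are single vertices and coincide with
  the old edges.\<close>

definition ring_closed :: "'a::comm_ring_1 set \<Rightarrow> bool" where
  "ring_closed R \<longleftrightarrow> 1 \<in> R \<and> (\<forall>x\<in>R. \<forall>y\<in>R. x - y \<in> R \<and> x * y \<in> R)"

text \<open>Negatives come for free, as -1 lies in \<open>R\<close> whenever
  \<open>ring_closed R\<close> holds. Subsets of one type class ring keep ordinary arithmetic
  available; \<open>class_ring\<close> translates to record-based structures.\<close>

definition ideal_in :: "'a::comm_ring_1 set \<Rightarrow> 'a set \<Rightarrow> bool" where
  "ideal_in R I \<longleftrightarrow> I \<subseteq> R \<and> 0 \<in> I \<and> (\<forall>x\<in>I. \<forall>y\<in>I. x + y \<in> I) \<and> (\<forall>r\<in>R. \<forall>x\<in>I. r * x \<in> I)"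

definition prime_in :: "'a::comm_ring_1 set \<Rightarrow> 'a set \<Rightarrow> bool" where
  "prime_in R I \<longleftrightarrow> ideal_in R I \<and> 1 \<notin> I \<and> (\<forall>x\<in>R. \<forall>y\<in>R. x * y \<in> I \<longrightarrow> x \<in> I \<or> y \<in> I)"

definition ascending_chain_condition :: "'a::comm_ring_1 set \<Rightarrow> bool" where
  "ascending_chain_condition R \<longleftrightarrow>
     (\<forall>I :: nat \<Rightarrow> 'a set. (\<forall>n. ideal_in R (I n)) \<longrightarrow> mono I \<longrightarrow> (\<exists>N. \<forall>n\<ge>N. I n = I N))"

definition poly_over :: "'a::comm_ring_1 set \<Rightarrow> 'a poly set" where
  "poly_over R = {p. \<forall>i. poly.coeff p i \<in> R}"

text \<open>\<open>a\<close> is any element of the ambient ring, transcendental over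
  \<open>R\<close> or not. The notion thus covers a new variable over a polynomial ring as well as
  the subring generated by a single polynomial in the Nullstellensatz.\<close>

definition adjoin :: "'a::comm_ring_1 set \<Rightarrow> 'a \<Rightarrow> 'a set" where
  "adjoin R a = (\<lambda>p. poly p a) ` poly_over R"

lemma ring_closed_add: "ring_closed R \<Longrightarrow> x \<in> R \<Longrightarrow> y \<in> R \<Longrightarrow> x + y \<in> R"
  and ring_closed_zero: "ring_closed R \<Longrightarrow> 0 \<in> R"
  and ring_closed_one: "ring_closed R \<Longrightarrow> 1 \<in> R"
  and ring_closed_diff: "ring_closed R \<Longrightarrow> x \<in> R \<Longrightarrow> y \<in> R \<Longrightarrow> x - y \<in> R"
  and ring_closed_mult: "ring_closed R \<Longrightarrow> x \<in> R \<Longrightarrow> y \<in> R \<Longrightarrow> x * y \<in> R"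
  and ring_closed_uminus: "ring_closed R \<Longrightarrow> x \<in> R \<Longrightarrow> - x \<in> R"
proof -
  assume R: "ring_closed R"
  show z: "0 \<in> R" using R unfolding ring_closed_def by (metis diff_self)
  then have neg: "y \<in> R \<Longrightarrow> - y \<in> R" for y
    using R unfolding ring_closed_def by (metis diff_0)
  then show "x \<in> R \<Longrightarrow> - x \<in> R" .
  show "x \<in> R \<Longrightarrow> y \<in> R \<Longrightarrow> x + y \<in> R"
    using R neg unfolding ring_closed_def by (metis diff_minus_eq_add)
qed (auto simp: ring_closed_def)

lemma ring_closed_power: "ring_closed R \<Longrightarrow> x \<in> R \<Longrightarrow> x ^ n \<in> R"
  by (induction n) (auto intro: ring_closed_one ring_closed_mult)

lemma ring_closed_sum: "ring_closed R \<Longrightarrow> (\<And>i. i \<in> A \<Longrightarrow> f i \<in> R) \<Longrightarrow> sum f A \<in> R"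
  by (induction A rule: infinite_finite_induct) (auto intro: ring_closed_zero ring_closed_add)

lemma ring_closed_prod: "ring_closed R \<Longrightarrow> (\<And>i. i \<in> A \<Longrightarrow> f i \<in> R) \<Longrightarrow> prod f A \<in> R"
  by (induction A rule: infinite_finite_induct) (auto intro: ring_closed_one ring_closed_mult)

lemmas ring_closed_intros = ring_closed_zero ring_closed_one ring_closed_add ring_closed_diff
  ring_closed_mult ring_closed_uminus ring_closed_power ring_closed_sum ring_closed_prod

lemma ideal_in_add: "ideal_in R I \<Longrightarrow> x \<in> I \<Longrightarrow> y \<in> I \<Longrightarrow> x + y \<in> I"
  and ideal_in_mult: "ideal_in R I \<Longrightarrow> r \<in> R \<Longrightarrow> x \<in> I \<Longrightarrow> r * x \<in> I"
  and ideal_in_mult_right: "ideal_in R I \<Longrightarrow> r \<in> R \<Longrightarrow> x \<in> I \<Longrightarrow> x * r \<in> I"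
  and ideal_in_zero: "ideal_in R I \<Longrightarrow> 0 \<in> I"
  and ideal_in_subset: "ideal_in R I \<Longrightarrow> x \<in> I \<Longrightarrow> x \<in> R"
  by (auto simp: ideal_in_def mult.commute)

lemma ideal_in_uminus: "ring_closed R \<Longrightarrow> ideal_in R I \<Longrightarrow> x \<in> I \<Longrightarrow> - x \<in> I"
  using ideal_in_mult[of R I "- 1" x] by (auto intro: ring_closed_intros)

lemma ideal_in_diff: "ring_closed R \<Longrightarrow> ideal_in R I \<Longrightarrow> x \<in> I \<Longrightarrow> y \<in> I \<Longrightarrow> x - y \<in> I"
  using ideal_in_add[of R I x "- y"] ideal_in_uminus[of R I y] by auto

lemma ideal_in_sum: "ideal_in R I \<Longrightarrow> (\<And>i. i \<in> A \<Longrightarrow> f i \<in> I) \<Longrightarrow> sum f A \<in> I"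
  by (induction A rule: infinite_finite_induct) (auto intro: ideal_in_zero ideal_in_add)

lemma prime_inD: "prime_in R I \<Longrightarrow> x * y \<in> I \<Longrightarrow> x \<in> R \<Longrightarrow> y \<in> R \<Longrightarrow> x \<in> I \<or> y \<in> I"
  and prime_in_ideal: "prime_in R I \<Longrightarrow> ideal_in R I"
  and prime_in_one: "prime_in R I \<Longrightarrow> 1 \<notin> I"
  by (auto simp: prime_in_def)

lemma prime_in_power: "prime_in R I \<Longrightarrow> ring_closed R \<Longrightarrow> x \<in> R \<Longrightarrow> x ^ n \<in> I \<Longrightarrow> x \<in> I"
  by (induction n) (auto dest: prime_inD prime_in_one intro: ring_closed_intros)

lemma ring_closed_poly_over: "ring_closed R \<Longrightarrow> ring_closed (poly_over R)"
  unfolding ring_closed_def[of "poly_over R"]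
  by (auto simp: poly_over_def coeff_mult intro!: ring_closed_intros)

lemma poly_over_pCons_iff: "pCons c p \<in> poly_over R \<longleftrightarrow> c \<in> R \<and> p \<in> poly_over R"
  unfolding poly_over_def by (auto simp: coeff_pCons split: nat.splits)

lemma poly_over_monom: "ring_closed R \<Longrightarrow> c \<in> R \<Longrightarrow> Polynomial.monom c n \<in> poly_over R"
  by (auto simp: poly_over_def intro: ring_closed_intros)

lemma poly_over_const: "ring_closed R \<Longrightarrow> c \<in> R \<Longrightarrow> [:c:] \<in> poly_over R"
  by (auto simp: poly_over_def coeff_pCons intro: ring_closed_intros split: nat.splits)

lemma poly_over_smult: "ring_closed R \<Longrightarrow> c \<in> R \<Longrightarrow> p \<in> poly_over R \<Longrightarrow> Polynomial.smult c p \<in> poly_over R"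
  by (auto simp: poly_over_def intro: ring_closed_intros)

lemma ring_closed_adjoin: assumes "ring_closed R" shows "ring_closed (adjoin R a)"
proof -
  note R = ring_closed_poly_over[OF assms]
  show ?thesis unfolding ring_closed_def adjoin_def
  proof (intro conjI ballI)
    show "1 \<in> (\<lambda>p. poly p a) ` poly_over R" using ring_closed_one[OF R] by (metis image_eqI poly_1)
  next
    fix x y assume "x \<in> (\<lambda>p. poly p a) ` poly_over R" "y \<in> (\<lambda>p. poly p a) ` poly_over R"
    then obtain p q where p: "p \<in> poly_over R" "x = poly p a" and q: "q \<in> poly_over R" "y = poly q a" by auto
    show "x - y \<in> (\<lambda>p. poly p a) ` poly_over R" using ring_closed_diff[OF R p(1) q(1)] p q by force
    show "x * y \<in> (\<lambda>p. poly p a) ` poly_over R" using ring_closed_mult[OF R p(1) q(1)] p q by force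
  qed
qed

lemma adjoin_base: "ring_closed R \<Longrightarrow> R \<subseteq> adjoin R a"
  unfolding adjoin_def using poly_over_const by (force intro: image_eqI[where x = "[:c:]" for c])

lemma adjoin_gen: "ring_closed R \<Longrightarrow> a \<in> adjoin R a"
  unfolding adjoin_def
  by (rule image_eqI[where x = "[:0, 1:]"]) (auto simp: poly_over_def coeff_pCons intro: ring_closed_intros split: nat.splits)

lemma adjoin_least:
  assumes "ring_closed S" "R \<subseteq> S" "a \<in> S" shows "adjoin R a \<subseteq> S"
  using assms unfolding adjoin_def poly_over_def
  by (auto simp: poly_altdef intro!: ring_closed_intros)

text \<open>\<open>I n\<close> is recovered from the ideals of leading coefficients \<open>L n k\<close> of polynomials of
  degree at most \<open>k\<close> with value in \<open>I n\<close>.\<close>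

theorem hilbert_basis:
  assumes R: "ring_closed R" and acc: "ascending_chain_condition R"
  shows "ascending_chain_condition (adjoin R a)"
  unfolding ascending_chain_condition_def
proof (intro allI impI)
  fix I :: "nat \<Rightarrow> 'a set"
  assume I: "\<forall>n. ideal_in (adjoin R a) (I n)" and "mono I"
  note PR = ring_closed_poly_over[OF R]
  have I_mono: "I m \<subseteq> I n" if "m \<le> n" for m n using \<open>mono I\<close> that by (auto dest: monoD)
  define P where "P n k = {p \<in> poly_over R. degree p \<le> k \<and> poly p a \<in> I n}" for n k
  define L where "L n k = (\<lambda>p. poly.coeff p k) ` P n k" for n k
  have L_ideal: "ideal_in R (L n k)" for n k
    unfolding ideal_in_def
  proof (intro conjI ballI)
    show "L n k \<subseteq> R" by (auto simp: L_def P_def poly_over_def)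
    have "0 \<in> P n k" using I PR by (auto simp: P_def intro: ring_closed_zero ideal_in_zero)
    then show "0 \<in> L n k" unfolding L_def by force
  next
    fix x y assume "x \<in> L n k" "y \<in> L n k"
    then obtain p q where "p \<in> P n k" "x = poly.coeff p k" "q \<in> P n k" "y = poly.coeff q k"
      by (auto simp: L_def)
    moreover from this have "p + q \<in> P n k"
      using I PR unfolding P_def by (auto intro: ring_closed_add ideal_in_add degree_add_le)
    ultimately show "x + y \<in> L n k" unfolding L_def by (metis coeff_add image_eqI)
  next
    fix c x assume c: "c \<in> R" and "x \<in> L n k"
    then obtain p where p: "p \<in> P n k" "x = poly.coeff p k" by (auto simp: L_def)
    have "c \<in> adjoin R a" using adjoin_base[OF R] c by auto
    then have "Polynomial.smult c p \<in> P n k"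
      using I PR p c unfolding P_def
      by (auto intro: poly_over_smult[OF R] ideal_in_mult order.trans[OF degree_smult_le])
    then show "c * x \<in> L n k" unfolding L_def p(2) by (metis coeff_smult image_eqI)
  qed
  have L_mono: "L m j \<subseteq> L n k" if "m \<le> n" "j \<le> k" for m n j k
  proof
    fix x assume "x \<in> L m j"
    then obtain p where p: "p \<in> P m j" "x = poly.coeff p j" by (auto simp: L_def)
    let ?q = "Polynomial.monom 1 (k - j) * p"
    have "?q \<in> poly_over R"
      using p by (auto simp: P_def intro!: ring_closed_mult[OF PR] poly_over_monom[OF R] ring_closed_one[OF R])
    moreover have "degree ?q \<le> k"
      using p that order.trans[OF degree_mult_le, of "Polynomial.monom 1 (k - j)" p k] degree_monom_le[of "1::'a" "k - j"]
      by (auto simp: P_def)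
    moreover have "poly ?q a \<in> I n"
      using p that I I_mono[of m n] ring_closed_power[OF ring_closed_adjoin[OF R] adjoin_gen[OF R]]
      by (auto simp: P_def poly_monom intro!: ideal_in_mult)
    moreover have "poly.coeff ?q k = x" using p that by (simp add: coeff_monom_mult)
    ultimately show "x \<in> L n k" unfolding L_def P_def by (intro image_eqI[where x = ?q]) auto
  qed
  have stab: "\<exists>N. \<forall>n\<ge>N. J n = J N" if "\<And>n. ideal_in R (J n)" "\<And>m n. m \<le> n \<Longrightarrow> J m \<subseteq> J n" for J :: "nat \<Rightarrow> 'a set"
    using acc that unfolding ascending_chain_condition_def by (simp add: monoI)
  \<comment> \<open>The diagonal chain settles all k > N at once, since \<open>L n k\<close> is then
    squeezed between two of its stable members; only the finitely many k \<le> N remain, which is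
    why the maximum \<open>M\<close> exists.\<close>
  obtain N where N: "\<And>n. n \<ge> N \<Longrightarrow> L n n = L N N"
    using stab[of "\<lambda>n. L n n"] L_ideal L_mono by auto
  have "\<forall>k. \<exists>N. \<forall>n\<ge>N. L n k = L N k"
    using stab[of "\<lambda>n. L n k" for k] L_ideal L_mono by auto
  then obtain N' where N': "\<And>k n. n \<ge> N' k \<Longrightarrow> L n k = L (N' k) k" by metis
  define M where "M = Max (insert N (N' ` {..N}))"
  have M: "N \<le> M" "k \<le> N \<Longrightarrow> N' k \<le> M" for k unfolding M_def by (auto intro!: Max_ge simp del: Max_insert)
  have L_stab: "L n k = L M k" if "n \<ge> M" for n k
  proof (cases "k \<le> N")
    case True
    then show ?thesis using N'[of k n] N'[of k M] M(2)[of k] that by simp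
  next
    case False
    have "L N N \<subseteq> L M k" using False M by (intro L_mono) auto
    moreover have "L M k \<subseteq> L n k" using that by (intro L_mono) auto
    moreover have "L n k \<subseteq> L (max n k) (max n k)" by (intro L_mono) auto
    moreover have "L (max n k) (max n k) = L N N" using M that by (intro N) auto
    ultimately show ?thesis by auto
  qed
  \<comment> \<open>All leading coefficients already occur at stage \<open>M\<close>, so subtracting
    a polynomial of \<open>P M (Suc k)\<close> with the same top coefficient lowers the degree and
    stays in stage n.\<close>
  have step: "p \<in> P n k \<Longrightarrow> poly p a \<in> I M" if n: "n \<ge> M" for n k p
  proof (induction k arbitrary: p)
    case 0
    then have "poly.coeff p 0 \<in> L M 0" using L_stab[OF n, of 0] by (auto simp: L_def)
    then obtain q where "q \<in> P M 0" "poly.coeff q 0 = poly.coeff p 0" by (auto simp: L_def)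
    then have "q = p" using 0 by (auto simp: P_def poly_eq_iff) (metis coeff_eq_0 neq0_conv)
    with \<open>q \<in> P M 0\<close> show ?case by (simp add: P_def)
  next
    case (Suc k)
    then have "poly.coeff p (Suc k) \<in> L M (Suc k)" using L_stab[OF n, of "Suc k"] by (auto simp: L_def)
    then obtain q where q: "q \<in> P M (Suc k)" "poly.coeff q (Suc k) = poly.coeff p (Suc k)" by (auto simp: L_def)
    have "degree (p - q) \<le> k"
    proof (rule degree_le, intro allI impI)
      fix i assume "k < i"
      then consider "i = Suc k" | "i > Suc k" by linarith
      then show "poly.coeff (p - q) i = 0"
        using q Suc.prems by cases (auto simp: P_def coeff_eq_0)
    qed
    moreover have "poly q a \<in> I n" using q I_mono[OF n] by (auto simp: P_def)
    ultimately have "p - q \<in> P n k"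
      using q Suc.prems I PR ring_closed_adjoin[OF R]
      unfolding P_def by (auto intro: ring_closed_diff ideal_in_diff)
    from Suc.IH[OF this] have "poly (p - q) a \<in> I M" .
    moreover have "poly q a \<in> I M" using q by (auto simp: P_def)
    ultimately have "poly (p - q) a + poly q a \<in> I M" using I ideal_in_add by blast
    then show ?case by simp
  qed
  have "I n = I M" if "n \<ge> M" for n
  proof
    show "I n \<subseteq> I M"
    proof
      fix x assume x: "x \<in> I n"
      then have "x \<in> adjoin R a" using I ideal_in_subset by blast
      then obtain p where "p \<in> poly_over R" "x = poly p a" by (auto simp: adjoin_def)
      then show "x \<in> I M" using step[OF that, of p "degree p"] x by (auto simp: P_def)
    qed
  qed (use that I_mono in auto)
  then show "\<exists>N. \<forall>n\<ge>N. I n = I N" by blast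
qed

section \<open>The Nullstellensatz\<close>

text \<open>Fraction-free Gaussian elimination over the domain that \<open>R\<close> induces modulo
  \<open>M\<close>: more vectors than coordinates admit a relation with a coefficient outside
  \<open>M\<close>. Working modulo a prime avoids fraction fields; for the zero ideal of a field it
  is ordinary linear algebra.\<close>

lemma linear_dependence:
  assumes S: "ring_closed S" and M: "prime_in S M" and R: "ring_closed R" "R \<subseteq> S"
    and "finite B" "finite I" "card B < card I"
    and v: "\<And>i b. i \<in> I \<Longrightarrow> b \<in> B \<Longrightarrow> v i b \<in> R"
  shows "\<exists>c. (\<forall>i\<in>I. c i \<in> R) \<and> (\<exists>i\<in>I. c i \<notin> M) \<and> (\<forall>b\<in>B. (\<Sum>i\<in>I. c i * v i b) \<in> M)"
  using \<open>finite B\<close> \<open>finite I\<close> \<open>card B < card I\<close> v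
proof (induction B arbitrary: I v rule: finite_induct)
  case empty
  then have "I \<noteq> {}" by auto
  then show ?case using prime_in_one[OF M] ring_closed_one[OF R(1)]
    by (intro exI[of _ "\<lambda>_. 1"]) auto
next
  case (insert b0 B)
  note MI = prime_in_ideal[OF M]
  show ?case
  proof (cases "\<forall>i\<in>I. v i b0 \<in> M")
    case True
    have "card B < card I" using insert.prems(2) insert.hyps by simp
    then obtain c where
      c: "\<forall>i\<in>I. c i \<in> R" "\<exists>i\<in>I. c i \<notin> M" "\<forall>b\<in>B. (\<Sum>i\<in>I. c i * v i b) \<in> M"
      using insert.IH[OF insert.prems(1), of v] insert.prems(3) by blast
    moreover have "(\<Sum>i\<in>I. c i * v i b0) \<in> M"
      using True c(1) R by (intro ideal_in_sum[OF MI] ideal_in_mult[OF MI]) auto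
    ultimately show ?thesis by (intro exI[of _ c]) auto
  next
    case False
    then obtain i0 where i0: "i0 \<in> I" "v i0 b0 \<notin> M" by auto
    define q where "q = v i0 b0"
    define I' where "I' = I - {i0}"
    have I: "I = insert i0 I'" "i0 \<notin> I'" "finite I'" using i0 insert.prems by (auto simp: I'_def)
    have qR: "q \<in> R" using i0 insert.prems by (auto simp: q_def)
    \<comment> \<open>Cross-multiplication with the pivot \<open>q\<close> makes the coordinate
      \<open>b0\<close> vanish. Pulling the relation back multiplies the other coefficients by
      \<open>q\<close>, and by primality one of them stays outside \<open>M\<close>.\<close>
    define v' where "v' i b = q * v i b - v i b0 * v i0 b" for i b
    have "card B < card I'" using insert.prems insert.hyps I by simp
    moreover have "v' i b \<in> R" if "i \<in> I'" "b \<in> B" for i b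
      using insert.prems(3) that I qR R(1) unfolding v'_def by (intro ring_closed_intros) auto
    ultimately obtain c' where c': "\<And>i. i \<in> I' \<Longrightarrow> c' i \<in> R" "\<exists>i\<in>I'. c' i \<notin> M"
      "\<And>b. b \<in> B \<Longrightarrow> (\<Sum>i\<in>I'. c' i * v' i b) \<in> M" using insert.IH[of I' v'] I by blast
    define c where "c i = (if i = i0 then - (\<Sum>j\<in>I'. c' j * v j b0) else q * c' i)" for i
    have sum_c: "(\<Sum>i\<in>I. c i * v i b) = (\<Sum>i\<in>I'. c' i * v' i b)" for b
    proof -
      have "(\<Sum>i\<in>I'. c i * v i b) = (\<Sum>i\<in>I'. q * c' i * v i b)"
        using I by (intro sum.cong) (auto simp: c_def)
      then have "(\<Sum>i\<in>I. c i * v i b) = (\<Sum>i\<in>I'. q * c' i * v i b) - (\<Sum>j\<in>I'. c' j * v j b0) * v i0 b"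
        using I by (simp add: c_def)
      also have "\<dots> = (\<Sum>i\<in>I'. c' i * v' i b)"
        by (simp add: sum_distrib_right v'_def flip: sum_subtractf) (simp add: algebra_simps)
      finally show ?thesis .
    qed
    have "c i \<in> R" if "i \<in> I" for i
      using that c'(1) I qR R(1) insert.prems(3) unfolding c_def by (auto intro!: ring_closed_intros)
    moreover have "\<exists>i\<in>I. c i \<notin> M"
    proof -
      obtain i where i: "i \<in> I'" "c' i \<notin> M" using c' by auto
      then have "q * c' i \<notin> M" using i0 qR c'(1) R(2) prime_inD[OF M] unfolding q_def by blast
      then show ?thesis using i I by (intro bexI[of _ i]) (auto simp: c_def)
    qed
    moreover have "(\<Sum>i\<in>I. c i * v i b) \<in> M" if b: "b \<in> insert b0 B" for b
    proof (cases "b = b0")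
      case True
      then have "v' i b = 0" for i by (simp add: v'_def q_def mult.commute)
      then show ?thesis using ideal_in_zero[OF MI] by (simp add: sum_c)
    next
      case False
      then show ?thesis using b c'(3) by (simp add: sum_c)
    qed
    ultimately show ?thesis by blast
  qed
qed

text \<open>\<open>a\<close> is algebraic over the fraction field of \<open>R\<close> modulo
  \<open>M\<close>. Some coefficient is asked to be outside \<open>M\<close>; that the leading one
  can be is part of \<open>minimal_relation\<close>.\<close>

definition algebraic_mod :: "'a::comm_ring_1 set \<Rightarrow> 'a set \<Rightarrow> 'a \<Rightarrow> bool" where
  "algebraic_mod R M a \<longleftrightarrow> (\<exists>q\<in>poly_over R. poly q a \<in> M \<and> (\<exists>i. poly.coeff q i \<notin> M))"

text \<open>For a domain \<open>R/M\<close>: the localization at one nonzero element is a field.\<close>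

definition goldman :: "'a::comm_ring_1 set \<Rightarrow> 'a set \<Rightarrow> bool" where
  "goldman R M \<longleftrightarrow> (\<exists>f\<in>R - M. \<forall>c\<in>R - M. \<exists>g\<in>R. \<exists>k. c * g - f ^ k \<in> M)"

context
  fixes S M R :: "'a::comm_ring_1 set" and a :: 'a
  assumes S: "ring_closed S" and M: "prime_in S M"
    and R: "ring_closed R" "R \<subseteq> S" and a: "a \<in> S"
begin

private lemma MI: "ideal_in S M" using M by (rule prime_in_ideal)

private lemma PR: "ring_closed (poly_over R)" using R by (intro ring_closed_poly_over)

private lemma adjoin_subset: "adjoin R a \<subseteq> S" using S R a by (intro adjoin_least)

text \<open>Among the relations with a coefficient outside \<open>M\<close>, one of least degree is
  taken: a leading term with coefficient in \<open>M\<close> could be dropped, and a constant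
  relation would itself lie in \<open>M\<close>. The last conclusion says that the powers of
  \<open>a\<close> below this degree are linearly independent modulo \<open>M\<close>.\<close>

lemma minimal_relation:
  assumes "algebraic_mod R M a"
  obtains q where "q \<in> poly_over R" "poly q a \<in> M" "lead_coeff q \<notin> M" "degree q > 0"
    "\<And>h i. h \<in> poly_over R \<Longrightarrow> degree h < degree q \<Longrightarrow> poly h a \<in> M \<Longrightarrow> poly.coeff h i \<in> M"
proof -
  define T where "T q \<longleftrightarrow> q \<in> poly_over R \<and> poly q a \<in> M \<and> (\<exists>i. poly.coeff q i \<notin> M)" for q
  have "\<exists>q. T q" using assms by (auto simp: T_def algebraic_mod_def)
  then obtain q where q: "T q" and min: "\<And>h. T h \<Longrightarrow> degree q \<le> degree h"
    using ex_has_least_nat[of T _ degree] by auto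
  from q have q1: "q \<in> poly_over R" "poly q a \<in> M" by (auto simp: T_def)
  from q obtain i where i: "poly.coeff q i \<notin> M" by (auto simp: T_def)
  have lead: "lead_coeff q \<notin> M"
  proof
    assume lc: "lead_coeff q \<in> M"
    let ?m = "Polynomial.monom (lead_coeff q) (degree q)"
    have i': "i \<noteq> degree q" using i lc by auto
    have "i \<le> degree q" using i ideal_in_zero[OF MI] by (metis le_degree)
    with i' have pos: "degree q > 0" by simp
    have "degree (q - ?m) < degree q"
    proof (rule degree_lessI)
      show "\<forall>k\<ge>degree q. poly.coeff (q - ?m) k = 0" by (auto simp: coeff_eq_0)
    qed (use pos in auto)
    moreover have "T (q - ?m)" unfolding T_def
    proof (intro conjI exI)
      have "lead_coeff q \<in> R" using q1 by (simp add: poly_over_def)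
      then show "q - ?m \<in> poly_over R" using q1 R by (intro ring_closed_diff[OF PR] poly_over_monom)
      have "lead_coeff q * a ^ degree q \<in> M" using lc S a by (intro ideal_in_mult_right[OF MI]) (auto intro: ring_closed_power)
      then show "poly (q - ?m) a \<in> M" using q1 ideal_in_diff[OF S MI] by (auto simp: poly_monom)
      show "poly.coeff (q - ?m) i \<notin> M" using i i' by simp
    qed
    ultimately show False using min by fastforce
  qed
  have deg: "degree q > 0"
  proof (rule ccontr)
    assume "\<not> degree q > 0"
    then obtain c where "q = [:c:]" by (auto elim: degree_eq_zeroE)
    then show False using lead q1 by simp
  qed
  show thesis
  proof (rule that[OF q1 lead deg])
    fix h i assume "h \<in> poly_over R" "degree h < degree q" "poly h a \<in> M"
    then show "poly.coeff h i \<in> M" using min[of h] by (auto simp: T_def)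
  qed
qed

text \<open>Division by \<open>q\<close> without inverting its leading coefficient: every reduction
  step costs one factor of it, and the subtracted multiple of \<open>q\<close> disappears because
  \<open>poly q a\<close> lies in \<open>M\<close>.\<close>

lemma pseudo_division:
  assumes q: "q \<in> poly_over R" "poly q a \<in> M"
    and g: "g \<in> poly_over R"
    and pos: "degree q > 0"
  shows "\<exists>k h. h \<in> poly_over R \<and> degree h < degree q \<and> lead_coeff q ^ k * poly g a - poly h a \<in> M"
proof -
  define p where "p = lead_coeff q"
  have pR: "p \<in> R" using q by (auto simp: p_def poly_over_def)
  then have pS: "p \<in> S" using R by auto
  have "\<exists>k h. h \<in> poly_over R \<and> degree h < degree q \<and> p ^ k * poly g a - poly h a \<in> M"
    if "g \<in> poly_over R" "degree g < degree q + n" for n g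
    using that
  proof (induction n arbitrary: g)
    case 0
    then show ?case using ideal_in_zero[OF MI] by (intro exI[of _ 0] exI[of _ g]) auto
  next
    case (Suc n)
    let ?c = "poly.coeff g (degree q + n)"
    let ?g = "Polynomial.smult p g - Polynomial.monom ?c n * q"
    have cR: "?c \<in> R" using Suc.prems by (auto simp: poly_over_def)
    have gR: "?g \<in> poly_over R"
      by (intro ring_closed_diff[OF PR] ring_closed_mult[OF PR] poly_over_smult poly_over_monom R pR cR Suc.prems q)
    have "degree ?g < degree q + n"
    proof (rule degree_lessI)
      show "\<forall>k\<ge>degree q + n. poly.coeff ?g k = 0"
      proof (intro allI impI)
        fix k assume k: "degree q + n \<le> k"
        show "poly.coeff ?g k = 0"
        proof (cases "k = degree q + n")
          case True
          then show ?thesis by (simp add: coeff_monom_mult p_def mult.commute[of "lead_coeff q"])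
        next
          case False
          then have "poly.coeff g k = 0" "poly.coeff q (k - n) = 0" using k Suc.prems by (auto intro!: coeff_eq_0)
          then show ?thesis by (simp add: coeff_monom_mult)
        qed
      qed
    qed (use pos in auto)
    from Suc.IH[OF gR this] obtain k h where h: "h \<in> poly_over R" "degree h < degree q"
      "p ^ k * poly ?g a - poly h a \<in> M" by blast
    have "p ^ k * (?c * a ^ n) * poly q a \<in> M"
      using q pS cR R a S by (intro ideal_in_mult[OF MI]) (auto intro!: ring_closed_intros)
    from ideal_in_add[OF MI h(3) this] have "p ^ Suc k * poly g a - poly h a \<in> M"
      by (simp add: algebra_simps poly_monom)
    then show ?case using h by blast
  qed
  from this[OF g, of "Suc (degree g)"] show ?thesis by (simp add: p_def)
qed

text \<open>If \<open>a\<close> were transcendental, \<open>adjoin R a\<close> would be a polynomial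
  ring modulo \<open>M\<close>. With f a Goldman element, 1 + a f divides a power of f, but f is
  invertible modulo 1 + a f; so 1 + a f would be a unit although it has positive degree over a
  domain.\<close>

lemma goldman_imp_algebraic:
  assumes "goldman (adjoin R a) M"
  shows "algebraic_mod R M a"
proof (rule ccontr)
  assume "\<not> algebraic_mod R M a"
  then have trans: "poly.coeff q i \<in> M" if "q \<in> poly_over R" "poly q a \<in> M" for q i
    using that unfolding algebraic_mod_def by blast
  from assms obtain f where f: "f \<in> adjoin R a" "f \<notin> M"
    and fc: "\<And>c. c \<in> adjoin R a - M \<Longrightarrow> \<exists>g\<in>adjoin R a. \<exists>k. c * g - f ^ k \<in> M"
    unfolding goldman_def by blast
  from f obtain F where F: "F \<in> poly_over R" "f = poly F a" by (auto simp: adjoin_def)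
  have AR: "ring_closed (adjoin R a)" using R by (intro ring_closed_adjoin)
  define C where "C = pCons 1 F"
  have C: "C \<in> poly_over R" using F ring_closed_one[OF R(1)] by (simp add: C_def poly_over_pCons_iff)
  define c where "c = poly C a"
  have c_eq: "c = 1 + a * f" by (simp add: c_def C_def F)
  have cA: "c \<in> adjoin R a" using C by (auto simp: c_def adjoin_def)
  have "c \<notin> M"
  proof
    assume "c \<in> M"
    then have "poly.coeff C 0 \<in> M" using trans C by (auto simp: c_def)
    then show False using prime_in_one[OF M] by (simp add: C_def)
  qed
  then obtain g k where g: "g \<in> adjoin R a" "c * g - f ^ k \<in> M" using fc cA by blast
  \<comment> \<open>\<open>a f\<close> is \<open>- 1\<close> modulo \<open>c\<close>, so \<open>c\<close> divides \<open>1\<close> up to sign.\<close>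
  obtain h where h: "h \<in> adjoin R a" "c * h - 1 \<in> M"
  proof -
    have "\<exists>u\<in>adjoin R a. (- a * f) ^ k = 1 - c * u"
    proof (induction k)
      case (Suc k)
      then obtain u where u: "u \<in> adjoin R a" "(- a * f) ^ k = 1 - c * u" by blast
      have "(- a * f) ^ Suc k = (1 - c) * (1 - c * u)" using u by (simp add: c_eq)
      also have "\<dots> = 1 - c * (1 + u - c * u)" by (simp add: algebra_simps)
      finally show ?case using u cA AR by (intro bexI[of _ "1 + u - c * u"]) (auto intro!: ring_closed_intros)
    qed (use AR in \<open>auto intro!: bexI[of _ 0] ring_closed_intros\<close>)
    then obtain u where u: "u \<in> adjoin R a" "(- a * f) ^ k = 1 - c * u" by blast
    have "(- a) ^ k * (c * g - f ^ k) \<in> M"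
      using S a by (intro ideal_in_mult[OF MI] g) (auto intro!: ring_closed_intros)
    moreover have "(- a) ^ k * (c * g - f ^ k) = c * ((- a) ^ k * g + u) - 1"
      using u by (simp add: algebra_simps power_mult_distrib[symmetric] flip: power_minus)
    moreover have "(- a) ^ k * g + u \<in> adjoin R a"
      using u g AR adjoin_gen[OF R(1)] by (auto intro!: ring_closed_intros)
    ultimately show thesis using that by metis
  qed
  then obtain H where H: "H \<in> poly_over R" "h = poly H a" by (auto simp: adjoin_def)
  have CH: "poly.coeff (C * H - 1) i \<in> M" for i
  proof (rule trans)
    show "C * H - 1 \<in> poly_over R" by (intro ring_closed_diff ring_closed_mult ring_closed_one PR C H)
    show "poly (C * H - 1) a \<in> M" using h H by (simp add: c_def)
  qed
  have zeroM: "0 \<in> M" using ideal_in_zero[OF MI] .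
  \<comment> \<open>The degree modulo \<open>M\<close>: the last index whose coefficient is outside
    \<open>M\<close>, which may be smaller than \<open>degree\<close>.\<close>
  have top: "\<exists>n. poly.coeff p n \<notin> M \<and> (\<forall>j>n. poly.coeff p j \<in> M)" if "\<exists>i. poly.coeff p i \<notin> M" for p
  proof -
    have "finite {i. poly.coeff p i \<notin> M}"
      by (rule finite_subset[of _ "{..degree p}"]) (use zeroM in \<open>auto intro!: le_degree\<close>)
    then show ?thesis using that Max_in[of "{i. poly.coeff p i \<notin> M}"] Max_ge[of "{i. poly.coeff p i \<notin> M}"]
      by (intro exI[of _ "Max {i. poly.coeff p i \<notin> M}"]) fastforce
  qed
  have "\<exists>i. poly.coeff F i \<notin> M"
  proof (rule ccontr)
    assume "\<not> (\<exists>i. poly.coeff F i \<notin> M)"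
    then have "f \<in> M" unfolding F poly_altdef
      using S a by (intro ideal_in_sum[OF MI] ideal_in_mult_right[OF MI]) (auto intro!: ring_closed_intros)
    then show False using f by simp
  qed
  then obtain n where n: "poly.coeff F n \<notin> M" "\<And>j. j > n \<Longrightarrow> poly.coeff F j \<in> M" using top by blast
  have Cn: "poly.coeff C (Suc n) \<notin> M" "\<And>j. j > Suc n \<Longrightarrow> poly.coeff C j \<in> M"
    using n by (auto simp: C_def coeff_pCons split: nat.splits)
  have "\<exists>i. poly.coeff H i \<notin> M"
  proof (rule ccontr)
    assume "\<not> (\<exists>i. poly.coeff H i \<notin> M)"
    then have "h \<in> M" unfolding H poly_altdef
      using S a by (intro ideal_in_sum[OF MI] ideal_in_mult_right[OF MI]) (auto intro!: ring_closed_intros)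
    then have "c * h \<in> M" using cA adjoin_subset by (intro ideal_in_mult[OF MI]) auto
    then have "c * h - (c * h - 1) \<in> M" by (intro ideal_in_diff[OF S MI] h)
    then show False using prime_in_one[OF M] by simp
  qed
  then obtain m where m: "poly.coeff H m \<notin> M" "\<And>j. j > m \<Longrightarrow> poly.coeff H j \<in> M" using top by blast
  have CS: "poly.coeff C i \<in> S" "poly.coeff H i \<in> S" for i using C H R by (auto simp: poly_over_def)
  \<comment> \<open>\<open>C\<close> and \<open>H\<close> have degrees \<open>Suc n\<close> and
    \<open>m\<close> modulo \<open>M\<close>, so up to \<open>M\<close> the coefficient of their
    product at the sum is the product of the two top coefficients. As \<open>C * H\<close> is
    congruent to 1 and \<open>Suc n + m\<close> is positive, this is the contradiction.\<close>
  have "poly.coeff (C * H) (Suc n + m) - poly.coeff C (Suc n) * poly.coeff H m \<in> M"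
  proof -
    have "poly.coeff (C * H) (Suc n + m) = (\<Sum>i\<le>Suc n + m. poly.coeff C i * poly.coeff H (Suc n + m - i))"
      by (simp add: coeff_mult)
    also have "\<dots> = poly.coeff C (Suc n) * poly.coeff H m
        + (\<Sum>i\<in>{..Suc n + m} - {Suc n}. poly.coeff C i * poly.coeff H (Suc n + m - i))"
      by (subst sum.remove[of _ "Suc n"]) auto
    finally have eq: "poly.coeff (C * H) (Suc n + m) - poly.coeff C (Suc n) * poly.coeff H m =
        (\<Sum>i\<in>{..Suc n + m} - {Suc n}. poly.coeff C i * poly.coeff H (Suc n + m - i))" by simp
    show ?thesis unfolding eq
    proof (intro ideal_in_sum[OF MI])
      fix i assume "i \<in> {..Suc n + m} - {Suc n}"
      then have "i > Suc n \<or> Suc n + m - i > m" by auto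
      then show "poly.coeff C i * poly.coeff H (Suc n + m - i) \<in> M"
        using Cn m CS by (auto intro: ideal_in_mult[OF MI] ideal_in_mult_right[OF MI])
    qed
  qed
  moreover have "poly.coeff (C * H) (Suc n + m) \<in> M" using CH[of "Suc n + m"] by (simp add: coeff_1)
  ultimately have "poly.coeff (C * H) (Suc n + m) -
      (poly.coeff (C * H) (Suc n + m) - poly.coeff C (Suc n) * poly.coeff H m) \<in> M"
    using ideal_in_diff[OF S MI] by blast
  then have "poly.coeff C (Suc n) * poly.coeff H m \<in> M"
    by (simp only: diff_diff_eq2 add_diff_cancel_left')
  then show False using prime_inD[OF M] Cn m CS by blast
qed

text \<open>The Goldman element of \<open>R\<close> is r p. Here p, the leading coefficient of a
  minimal relation of \<open>a\<close>, pays for reducing elements of \<open>adjoin R a\<close>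
  below the degree of that relation, and r is an element of \<open>R\<close> that is a multiple of
  the old Goldman element modulo \<open>M\<close>. Comparing constant coefficients of the reduced
  expressions then removes \<open>a\<close>.\<close>

lemma goldman_descends:
  assumes "goldman (adjoin R a) M"
  shows "goldman R M"
proof -
  obtain q where q: "q \<in> poly_over R" "poly q a \<in> M" and lead: "lead_coeff q \<notin> M" and pos: "degree q > 0"
    and min: "\<And>h i. h \<in> poly_over R \<Longrightarrow> degree h < degree q \<Longrightarrow> poly h a \<in> M \<Longrightarrow> poly.coeff h i \<in> M"
    using minimal_relation[OF goldman_imp_algebraic[OF assms]] by blast
  define p where "p = lead_coeff q"
  define D where "D = degree q"
  have pR: "p \<in> R" using q by (auto simp: p_def poly_over_def)
  have pM: "p \<notin> M" using lead by (simp add: p_def)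
  have pS: "p \<in> S" using pR R by auto
  have div: "\<exists>k h. h \<in> poly_over R \<and> degree h < D \<and> p ^ k * x - poly h a \<in> M" if "x \<in> adjoin R a" for x
    using that pseudo_division[OF q _ pos] unfolding p_def D_def adjoin_def by blast
  from assms obtain f where f: "f \<in> adjoin R a" "f \<notin> M"
    and fc: "\<And>c. c \<in> adjoin R a - M \<Longrightarrow> \<exists>g\<in>adjoin R a. \<exists>k. c * g - f ^ k \<in> M"
    unfolding goldman_def by blast
  have fS: "f \<in> S" using f adjoin_subset by auto
  have AR: "ring_closed (adjoin R a)" using R by (intro ring_closed_adjoin)
  have RA: "R \<subseteq> adjoin R a" using adjoin_base[OF R(1)] .
  \<comment> \<open>The powers of \<open>f\<close> up to \<open>D\<close> are linearly dependent over \<open>R\<close>, which gives a multiple of \<open>f\<close> in \<open>R\<close>.\<close>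
  obtain r t where r: "r \<in> R" "r \<notin> M" "t \<in> adjoin R a" "r - f * t \<in> M"
  proof -
    have "\<forall>j. \<exists>k h. h \<in> poly_over R \<and> degree h < D \<and> p ^ k * f ^ j - poly h a \<in> M"
      using div ring_closed_power[OF AR f(1)] by blast
    then obtain k h where h: "\<And>j. h j \<in> poly_over R" "\<And>j. degree (h j) < D"
      "\<And>j. p ^ k j * f ^ j - poly (h j) a \<in> M" by metis
    \<comment> \<open>A common exponent: p^K clears the denominators of all the powers of f
      involved.\<close>
    define K where "K = (\<Sum>j\<le>D. k j)"
    have K: "k j \<le> K" if "j \<le> D" for j unfolding K_def using that by (intro member_le_sum) auto
    define v where "v j i = p ^ (K - k j) * poly.coeff (h j) i" for j i
    have "v j i \<in> R" for i j using h(1) pR R unfolding v_def by (auto intro!: ring_closed_intros simp: poly_over_def)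
    then obtain c where c: "\<forall>j\<in>{..D}. c j \<in> R" "\<exists>j\<in>{..D}. c j \<notin> M"
      "\<forall>i\<in>{..<D}. (\<Sum>j\<le>D. c j * v j i) \<in> M"
      using linear_dependence[OF S M R, of "{..<D}" "{..D}" v] by auto
    have poly_h: "poly (h j) a = (\<Sum>i<D. poly.coeff (h j) i * a ^ i)" for j
    proof -
      have "poly (h j) a = (\<Sum>i\<le>degree (h j). poly.coeff (h j) i * a ^ i)" by (simp add: poly_altdef)
      also have "\<dots> = (\<Sum>i<D. poly.coeff (h j) i * a ^ i)"
        using h(2)[of j] by (intro sum.mono_neutral_left) (auto simp: not_le[symmetric] coeff_eq_0 intro: le_degree)
      finally show ?thesis .
    qed
    have 1: "(\<Sum>j\<le>D. c j * (p ^ (K - k j) * poly (h j) a)) \<in> M"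
    proof -
      have "(\<Sum>j\<le>D. c j * (p ^ (K - k j) * poly (h j) a)) = (\<Sum>j\<le>D. \<Sum>i<D. c j * v j i * a ^ i)"
        by (simp add: poly_h v_def sum_distrib_left mult.assoc)
      also have "\<dots> = (\<Sum>i<D. (\<Sum>j\<le>D. c j * v j i) * a ^ i)"
        by (subst sum.swap) (simp add: sum_distrib_right)
      also have "\<dots> \<in> M"
      proof (rule ideal_in_sum[OF MI])
        fix i assume "i \<in> {..<D}"
        then show "(\<Sum>j\<le>D. c j * v j i) * a ^ i \<in> M"
          using c(3) S a by (intro ideal_in_mult_right[OF MI]) (auto intro!: ring_closed_intros)
      qed
      finally show ?thesis .
    qed
    have 2: "(\<Sum>j\<le>D. c j * (p ^ (K - k j) * (p ^ k j * f ^ j - poly (h j) a))) \<in> M"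
      using c(1) R pS S by (intro ideal_in_sum[OF MI] ideal_in_mult[OF MI] h(3)) (auto intro!: ring_closed_intros)
    have "(\<Sum>j\<le>D. c j * (p ^ (K - k j) * poly (h j) a)) + (\<Sum>j\<le>D. c j * (p ^ (K - k j) * (p ^ k j * f ^ j - poly (h j) a)))
      = (\<Sum>j\<le>D. c j * ((p ^ (K - k j) * p ^ k j) * f ^ j))"
      by (simp add: algebra_simps flip: sum.distrib)
    also have "\<dots> = (\<Sum>j\<le>D. c j * (p ^ K * f ^ j))"
      using K by (intro sum.cong) (auto simp flip: power_add)
    also have "\<dots> = p ^ K * (\<Sum>j\<le>D. c j * f ^ j)" by (simp add: sum_distrib_left algebra_simps)
    finally have "p ^ K * (\<Sum>j\<le>D. c j * f ^ j) \<in> M" using ideal_in_add[OF MI 1 2] by simp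
    moreover have "(\<Sum>j\<le>D. c j * f ^ j) \<in> S" using c(1) R S fS by (auto intro!: ring_closed_intros)
    ultimately have rel: "(\<Sum>j\<le>D. c j * f ^ j) \<in> M"
      using pM prime_inD[OF M, of "p ^ K"] prime_in_power[OF M S pS] ring_closed_power[OF S pS] by blast
    have "\<exists>j. j \<le> D \<and> c j \<notin> M" using c(2) by auto
    \<comment> \<open>Terms before the first coefficient outside \<open>M\<close> vanish modulo
      \<open>M\<close>. Cancelling f^j0, possible because \<open>M\<close> is prime and does not
      contain f, leaves \<open>c j0\<close> congruent to f t.\<close>
    then obtain j0 where j0: "j0 \<le> D" "c j0 \<notin> M" and "\<forall>j<j0. \<not> (j \<le> D \<and> c j \<notin> M)"
      using exists_least_iff[of "\<lambda>j. j \<le> D \<and> c j \<notin> M"] by blast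
    then have j0_min: "\<And>j. j < j0 \<Longrightarrow> j \<le> D \<Longrightarrow> c j \<in> M" by blast
    define t where "t = - (\<Sum>j\<in>{Suc j0..D}. c j * f ^ (j - Suc j0))"
    have "(\<Sum>j\<le>D. c j * f ^ j) = (\<Sum>j<j0. c j * f ^ j) + (\<Sum>j\<in>{j0..D}. c j * f ^ j)"
      using j0(1) by (subst sum.union_disjoint[symmetric]) (auto intro!: sum.cong)
    moreover have "(\<Sum>j\<in>{j0..D}. c j * f ^ j) = f ^ j0 * (c j0 - f * t)"
    proof -
      have "(\<Sum>j\<in>{j0..D}. c j * f ^ j) = c j0 * f ^ j0 + (\<Sum>j\<in>{Suc j0..D}. c j * f ^ j)"
        using j0(1) by (simp add: sum.atLeast_Suc_atMost)
      also have "(\<Sum>j\<in>{Suc j0..D}. c j * f ^ j) = (\<Sum>j\<in>{Suc j0..D}. f ^ j0 * (f * (c j * f ^ (j - Suc j0))))"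
      proof (intro sum.cong refl)
        fix j assume "j \<in> {Suc j0..D}"
        then have "f ^ j = f ^ j0 * (f * f ^ (j - Suc j0))" by (simp flip: power_Suc power_add)
        then show "c j * f ^ j = f ^ j0 * (f * (c j * f ^ (j - Suc j0)))" by (simp add: algebra_simps)
      qed
      finally show ?thesis by (simp add: t_def sum_distrib_left algebra_simps)
    qed
    moreover have "(\<Sum>j<j0. c j * f ^ j) \<in> M"
      using j0 j0_min fS S by (intro ideal_in_sum[OF MI] ideal_in_mult_right[OF MI]) (auto intro!: ring_closed_intros)
    ultimately have M1: "f ^ j0 * (c j0 - f * t) \<in> M"
      using rel ideal_in_diff[OF S MI, of "(\<Sum>j\<le>D. c j * f ^ j)" "(\<Sum>j<j0. c j * f ^ j)"] by simp
    have t: "t \<in> adjoin R a" using c(1) RA f AR unfolding t_def by (auto intro!: ring_closed_intros)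
    have "c j0 - f * t \<in> S" using t j0(1) c(1) R adjoin_subset fS S by (intro ring_closed_intros) auto
    then have "c j0 - f * t \<in> M"
      using prime_inD[OF M M1] prime_in_power[OF M S fS] f(2) ring_closed_power[OF S fS] by blast
    then show thesis using that[of "c j0" t] j0 c(1) t by auto
  qed
  have tS: "t \<in> S" and rS: "r \<in> S" using r R adjoin_subset by auto
  have "r * p \<in> R - M" using r pR pM R rS pS by (auto intro: ring_closed_intros dest: prime_inD[OF M])
  moreover have "\<exists>g\<in>R. \<exists>k. c * g - (r * p) ^ k \<in> M" if c: "c \<in> R - M" for c
  proof -
    have cS: "c \<in> S" using c R by auto
    from fc[of c] c RA obtain g k where g: "g \<in> adjoin R a" "c * g - f ^ k \<in> M" by auto
    have gS: "g \<in> S" using g adjoin_subset by auto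
    have "r ^ k - f ^ k * t ^ k \<in> M"
    proof -
      have "r ^ k - (f * t) ^ k = (r - f * t) * (\<Sum>i<k. (f * t) ^ (k - Suc i) * r ^ i)"
        by (rule power_diff_sumr2)
      also have "\<dots> \<in> M" using r(4) rS fS tS S by (intro ideal_in_mult_right[OF MI]) (auto intro!: ring_closed_intros)
      finally show ?thesis by (simp add: power_mult_distrib)
    qed
    moreover have "t ^ k * (c * g - f ^ k) \<in> M" using tS S by (intro ideal_in_mult[OF MI] g) (auto intro!: ring_closed_intros)
    ultimately have "t ^ k * (c * g - f ^ k) - (r ^ k - f ^ k * t ^ k) \<in> M"
      using ideal_in_diff[OF S MI] by blast
    then have cg: "c * (t ^ k * g) - r ^ k \<in> M" by (simp add: algebra_simps)
    have "t ^ k * g \<in> adjoin R a" using r g AR by (auto intro!: ring_closed_intros)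
    then obtain l h where h: "h \<in> poly_over R" "degree h < D" "p ^ l * (t ^ k * g) - poly h a \<in> M" using div by blast
    have "p ^ l * (c * (t ^ k * g) - r ^ k) - c * (p ^ l * (t ^ k * g) - poly h a) \<in> M"
      by (rule ideal_in_diff[OF S MI]; rule ideal_in_mult[OF MI])
        (use cg h cS pS S in \<open>auto intro!: ring_closed_intros\<close>)
    then have eq: "c * poly h a - p ^ l * r ^ k \<in> M" by (simp add: algebra_simps)
    \<comment> \<open>This polynomial has degree below that of the minimal relation and value in
      \<open>M\<close> at \<open>a\<close>, so its constant coefficient lies in
      \<open>M\<close>.\<close>
    define h' where "h' = Polynomial.smult c h - [:p ^ l * r ^ k:]"
    have "h' \<in> poly_over R" unfolding h'_def using c h r pR R
      by (intro ring_closed_diff[OF PR] poly_over_smult poly_over_const) (auto intro!: ring_closed_intros)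
    moreover have "degree h' < D" unfolding h'_def
      using h(2) pos D_def by (intro degree_diff_less) (auto intro: le_less_trans[OF degree_smult_le])
    moreover have "poly h' a \<in> M" using eq by (simp add: h'_def)
    ultimately have "poly.coeff h' 0 \<in> M" using min D_def by auto
    then have c0: "c * poly.coeff h 0 - p ^ l * r ^ k \<in> M" by (simp add: h'_def)
    \<comment> \<open>The factor p^k r^l completes p^l r^k to a power of the single element r
      p.\<close>
    define g' where "g' = poly.coeff h 0 * (p ^ k * r ^ l)"
    have "(p ^ k * r ^ l) * (c * poly.coeff h 0 - p ^ l * r ^ k) \<in> M"
      using c0 pS rS S by (intro ideal_in_mult[OF MI]) (auto intro!: ring_closed_intros)
    then have "c * g' - (r * p) ^ (k + l) \<in> M"
      by (simp add: g'_def algebra_simps power_add power_mult_distrib)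
    moreover have "g' \<in> R" using h r pR R unfolding g'_def by (auto intro!: ring_closed_intros simp: poly_over_def)
    ultimately show ?thesis by blast
  qed
  ultimately show ?thesis unfolding goldman_def by blast
qed

end

section \<open>Localization\<close>

locale multiplicative_subset = cring R for R (structure) +
  fixes S
  assumes S_carrier: "S \<subseteq> carrier R" and S_one: "\<one> \<in> S"
    and S_mult: "s \<in> S \<Longrightarrow> t \<in> S \<Longrightarrow> s \<otimes> t \<in> S"
begin

lemma S_closed [simp]: "s \<in> S \<Longrightarrow> s \<in> carrier R"
  using S_carrier by auto

lemma frac_rel_iff:
  "((a, s), (b, t)) \<in> frac_rel R S \<longleftrightarrow> a \<in> carrier R \<and> s \<in> S \<and> b \<in> carrier R \<and> t \<in> S \<and>
     (\<exists>u\<in>S. u \<otimes> (a \<otimes> t) = u \<otimes> (b \<otimes> s))"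
proof -
  have "u \<otimes> ((a \<otimes> t) \<ominus> (b \<otimes> s)) = \<zero> \<longleftrightarrow> u \<otimes> (a \<otimes> t) = u \<otimes> (b \<otimes> s)"
    if "a \<in> carrier R" "s \<in> S" "b \<in> carrier R" "t \<in> S" "u \<in> S" for u
  proof -
    have "u \<otimes> ((a \<otimes> t) \<ominus> (b \<otimes> s)) = u \<otimes> (a \<otimes> t) \<ominus> u \<otimes> (b \<otimes> s)"
      using that by (simp add: minus_eq r_distr r_minus)
    then show ?thesis using that by simp
  qed
  then show ?thesis unfolding frac_rel_def by auto
qed

lemma frac_rel_equiv: "equiv (carrier R \<times> S) (frac_rel R S)"
proof (rule equivI)
  show "frac_rel R S \<subseteq> (carrier R \<times> S) \<times> carrier R \<times> S" by (auto simp: frac_rel_def)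
  show "refl_on (carrier R \<times> S) (frac_rel R S)"
    using S_one by (auto simp: refl_on_def frac_rel_iff)
  show "sym (frac_rel R S)" by (auto simp: sym_def frac_rel_iff) metis
  show "trans (frac_rel R S)"
  proof (rule transI, clarify)
    fix a s b t c w assume "((a, s), (b, t)) \<in> frac_rel R S" "((b, t), (c, w)) \<in> frac_rel R S"
    then obtain u v where [simp]: "a \<in> carrier R" "s \<in> S" "b \<in> carrier R" "t \<in> S" "c \<in> carrier R" "w \<in> S" "u \<in> S" "v \<in> S"
      and u: "u \<otimes> (a \<otimes> t) = u \<otimes> (b \<otimes> s)" and v: "v \<otimes> (b \<otimes> w) = v \<otimes> (c \<otimes> t)"
      by (auto simp: frac_rel_iff)
    have "(u \<otimes> v \<otimes> t) \<otimes> (a \<otimes> w) = (v \<otimes> w) \<otimes> (u \<otimes> (a \<otimes> t))" by (simp add: m_ac)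
    also have "\<dots> = (u \<otimes> s) \<otimes> (v \<otimes> (b \<otimes> w))" by (simp add: u m_ac)
    also have "\<dots> = (u \<otimes> v \<otimes> t) \<otimes> (c \<otimes> s)" by (simp add: v m_ac)
    finally show "((a, s), (c, w)) \<in> frac_rel R S"
      by (auto simp: frac_rel_iff intro!: bexI[of _ "u \<otimes> v \<otimes> t"] S_mult)
  qed
qed

lemma frac_eq_iff:
  assumes "a \<in> carrier R" "s \<in> S" "b \<in> carrier R" "t \<in> S"
  shows "frac R S a s = frac R S b t \<longleftrightarrow> (\<exists>u\<in>S. u \<otimes> (a \<otimes> t) = u \<otimes> (b \<otimes> s))"
  unfolding frac_def using assms
  by (subst eq_equiv_class_iff[OF frac_rel_equiv]) (auto simp: frac_rel_iff)

lemma frac_cancel: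
  "a \<in> carrier R \<Longrightarrow> s \<in> S \<Longrightarrow> u \<in> S \<Longrightarrow> frac R S (u \<otimes> a) (u \<otimes> s) = frac R S a s"
  by (subst frac_eq_iff) (auto intro!: S_mult bexI[of _ \<one>] S_one simp: m_ac)

abbreviation "L \<equiv> localization R S"

lemma loc_carrier: "carrier L = {frac R S a s | a s. a \<in> carrier R \<and> s \<in> S}"
  by (auto simp: localization_def quotient_def frac_def)

lemma frac_in_carrier [simp]: "a \<in> carrier R \<Longrightarrow> s \<in> S \<Longrightarrow> frac R S a s \<in> carrier L"
  by (auto simp: loc_carrier)

lemma loc_carrierE:
  assumes "x \<in> carrier L"
  obtains a s where "x = frac R S a s" "a \<in> carrier R" "s \<in> S"
  using assms by (auto simp: loc_carrier)

lemma loc_zero: "\<zero>\<^bsub>L\<^esub> = frac R S \<zero> \<one>" and loc_one: "\<one>\<^bsub>L\<^esub> = frac R S \<one> \<one>"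
  by (simp_all add: localization_def)

lemma loc_mult:
  assumes "a \<in> carrier R" "s \<in> S" "b \<in> carrier R" "t \<in> S"
  shows "frac R S a s \<otimes>\<^bsub>L\<^esub> frac R S b t = frac R S (a \<otimes> b) (s \<otimes> t)"
proof -
  have "congruent2 (frac_rel R S) (frac_rel R S) (\<lambda>(a, s) (b, t). frac R S (a \<otimes> b) (s \<otimes> t))"
  proof (rule congruent2I', clarify)
    fix a s a' s' b t b' t'
    assume "((a, s), (a', s')) \<in> frac_rel R S" "((b, t), (b', t')) \<in> frac_rel R S"
    then obtain u v where [simp]: "a \<in> carrier R" "s \<in> S" "a' \<in> carrier R" "s' \<in> S"
        "b \<in> carrier R" "t \<in> S" "b' \<in> carrier R" "t' \<in> S" "u \<in> S" "v \<in> S"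
      and u: "u \<otimes> (a \<otimes> s') = u \<otimes> (a' \<otimes> s)" and v: "v \<otimes> (b \<otimes> t') = v \<otimes> (b' \<otimes> t)"
      by (auto simp: frac_rel_iff)
    have "(u \<otimes> v) \<otimes> ((a \<otimes> b) \<otimes> (s' \<otimes> t')) = (u \<otimes> (a \<otimes> s')) \<otimes> (v \<otimes> (b \<otimes> t'))" by (simp add: m_ac)
    also have "\<dots> = (u \<otimes> v) \<otimes> ((a' \<otimes> b') \<otimes> (s \<otimes> t))" by (simp add: u v) (simp add: m_ac)
    finally show "frac R S (a \<otimes> b) (s \<otimes> t) = frac R S (a' \<otimes> b') (s' \<otimes> t')"
      by (subst frac_eq_iff) (auto intro!: S_mult bexI[of _ "u \<otimes> v"])
  qed
  from UN_equiv_class2[OF frac_rel_equiv frac_rel_equiv this, of "(a, s)" "(b, t)"] assms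
  show ?thesis by (simp add: localization_def frac_def split_def)
qed

lemma loc_add:
  assumes "a \<in> carrier R" "s \<in> S" "b \<in> carrier R" "t \<in> S"
  shows "frac R S a s \<oplus>\<^bsub>L\<^esub> frac R S b t = frac R S (a \<otimes> t \<oplus> b \<otimes> s) (s \<otimes> t)"
proof -
  have "congruent2 (frac_rel R S) (frac_rel R S) (\<lambda>(a, s) (b, t). frac R S (a \<otimes> t \<oplus> b \<otimes> s) (s \<otimes> t))"
  proof (rule congruent2I', clarify)
    fix a s a' s' b t b' t'
    assume "((a, s), (a', s')) \<in> frac_rel R S" "((b, t), (b', t')) \<in> frac_rel R S"
    then obtain u v where [simp]: "a \<in> carrier R" "s \<in> S" "a' \<in> carrier R" "s' \<in> S"
        "b \<in> carrier R" "t \<in> S" "b' \<in> carrier R" "t' \<in> S" "u \<in> S" "v \<in> S"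
      and u: "u \<otimes> (a \<otimes> s') = u \<otimes> (a' \<otimes> s)" and v: "v \<otimes> (b \<otimes> t') = v \<otimes> (b' \<otimes> t)"
      by (auto simp: frac_rel_iff)
    have "(u \<otimes> v) \<otimes> ((a \<otimes> t \<oplus> b \<otimes> s) \<otimes> (s' \<otimes> t')) =
        (v \<otimes> t \<otimes> t') \<otimes> (u \<otimes> (a \<otimes> s')) \<oplus> (u \<otimes> s \<otimes> s') \<otimes> (v \<otimes> (b \<otimes> t'))"
      by (simp add: l_distr r_distr m_ac)
    also have "\<dots> = (v \<otimes> t \<otimes> t') \<otimes> (u \<otimes> (a' \<otimes> s)) \<oplus> (u \<otimes> s \<otimes> s') \<otimes> (v \<otimes> (b' \<otimes> t))"
      by (simp only: u v)
    also have "\<dots> = (u \<otimes> v) \<otimes> ((a' \<otimes> t' \<oplus> b' \<otimes> s') \<otimes> (s \<otimes> t))"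
      by (simp add: l_distr r_distr m_ac)
    finally show "frac R S (a \<otimes> t \<oplus> b \<otimes> s) (s \<otimes> t) = frac R S (a' \<otimes> t' \<oplus> b' \<otimes> s') (s' \<otimes> t')"
      by (subst frac_eq_iff) (auto intro!: S_mult bexI[of _ "u \<otimes> v"])
  qed
  from UN_equiv_class2[OF frac_rel_equiv frac_rel_equiv this, of "(a, s)" "(b, t)"] assms
  show ?thesis by (simp add: localization_def frac_def split_def)
qed

lemma loc_cring: "cring L"
proof (rule cringI)
  show "abelian_group L"
  proof (rule abelian_groupI)
    fix x y assume "x \<in> carrier L" "y \<in> carrier L"
    then show "x \<oplus>\<^bsub>L\<^esub> y \<in> carrier L"
      by (auto elim!: loc_carrierE simp: loc_add S_mult)
  next
    show "\<zero>\<^bsub>L\<^esub> \<in> carrier L" by (simp add: loc_zero S_one)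
  next
    fix x y z assume "x \<in> carrier L" "y \<in> carrier L" "z \<in> carrier L"
    then obtain a s b t c w where x: "x = frac R S a s" "y = frac R S b t" "z = frac R S c w"
      and [simp]: "a \<in> carrier R" "s \<in> S" "b \<in> carrier R" "t \<in> S" "c \<in> carrier R" "w \<in> S"
      by (auto elim!: loc_carrierE)
    have "(a \<otimes> t \<oplus> b \<otimes> s) \<otimes> w \<oplus> c \<otimes> (s \<otimes> t) = a \<otimes> (t \<otimes> w) \<oplus> (b \<otimes> w \<oplus> c \<otimes> t) \<otimes> s"
      by (simp add: l_distr r_distr m_ac a_assoc)
    then show "x \<oplus>\<^bsub>L\<^esub> y \<oplus>\<^bsub>L\<^esub> z = x \<oplus>\<^bsub>L\<^esub> (y \<oplus>\<^bsub>L\<^esub> z)"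
      by (simp add: x loc_add S_mult m_assoc)
  next
    fix x y assume "x \<in> carrier L" "y \<in> carrier L"
    then show "x \<oplus>\<^bsub>L\<^esub> y = y \<oplus>\<^bsub>L\<^esub> x"
      by (auto elim!: loc_carrierE simp: loc_add S_mult m_comm a_comm)
  next
    fix x assume "x \<in> carrier L"
    then show "\<zero>\<^bsub>L\<^esub> \<oplus>\<^bsub>L\<^esub> x = x"
      by (auto elim!: loc_carrierE simp: loc_add loc_zero S_one)
  next
    fix x assume "x \<in> carrier L"
    then obtain a s where x: "x = frac R S a s" "a \<in> carrier R" "s \<in> S" by (rule loc_carrierE)
    have "\<ominus> a \<otimes> s \<oplus> a \<otimes> s = \<zero>" using x by (simp add: l_minus l_neg)
    moreover have "frac R S \<zero> (s \<otimes> s) = frac R S \<zero> \<one>"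
      using x by (subst frac_eq_iff) (auto intro!: S_mult bexI[of _ \<one>] S_one)
    ultimately show "\<exists>y\<in>carrier L. y \<oplus>\<^bsub>L\<^esub> x = \<zero>\<^bsub>L\<^esub>"
      using x by (intro bexI[of _ "frac R S (\<ominus> a) s"]) (auto simp: loc_add loc_zero)
  qed
next
  show "comm_monoid L"
  proof (rule comm_monoidI)
    fix x y assume "x \<in> carrier L" "y \<in> carrier L"
    then show "x \<otimes>\<^bsub>L\<^esub> y \<in> carrier L" "x \<otimes>\<^bsub>L\<^esub> y = y \<otimes>\<^bsub>L\<^esub> x"
      by (auto elim!: loc_carrierE simp: loc_mult S_mult m_ac)
  next
    show "\<one>\<^bsub>L\<^esub> \<in> carrier L" by (simp add: loc_one S_one)
  next
    fix x y z assume "x \<in> carrier L" "y \<in> carrier L" "z \<in> carrier L"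
    then show "x \<otimes>\<^bsub>L\<^esub> y \<otimes>\<^bsub>L\<^esub> z = x \<otimes>\<^bsub>L\<^esub> (y \<otimes>\<^bsub>L\<^esub> z)"
      by (auto elim!: loc_carrierE simp: loc_mult S_mult m_ac)
  next
    fix x assume "x \<in> carrier L"
    then show "\<one>\<^bsub>L\<^esub> \<otimes>\<^bsub>L\<^esub> x = x"
      by (auto elim!: loc_carrierE simp: loc_mult loc_one S_one)
  qed
next
  fix x y z assume "x \<in> carrier L" "y \<in> carrier L" "z \<in> carrier L"
  then obtain a s b t c w where x: "x = frac R S a s" "y = frac R S b t" "z = frac R S c w"
    and [simp]: "a \<in> carrier R" "s \<in> S" "b \<in> carrier R" "t \<in> S" "c \<in> carrier R" "w \<in> S"
    by (auto elim!: loc_carrierE)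
  have "(x \<oplus>\<^bsub>L\<^esub> y) \<otimes>\<^bsub>L\<^esub> z = frac R S ((a \<otimes> t \<oplus> b \<otimes> s) \<otimes> c) (s \<otimes> t \<otimes> w)"
    by (simp add: x loc_add loc_mult S_mult)
  also have "\<dots> = frac R S (w \<otimes> ((a \<otimes> t \<oplus> b \<otimes> s) \<otimes> c)) (w \<otimes> (s \<otimes> t \<otimes> w))"
    by (simp add: frac_cancel S_mult)
  also have "\<dots> = x \<otimes>\<^bsub>L\<^esub> z \<oplus>\<^bsub>L\<^esub> y \<otimes>\<^bsub>L\<^esub> z"
    by (simp add: x loc_add loc_mult S_mult r_distr l_distr m_ac)
  finally show "(x \<oplus>\<^bsub>L\<^esub> y) \<otimes>\<^bsub>L\<^esub> z = x \<otimes>\<^bsub>L\<^esub> z \<oplus>\<^bsub>L\<^esub> y \<otimes>\<^bsub>L\<^esub> z" .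
qed

sublocale loc: cring L by (rule loc_cring)

lemma loc_uminus: "a \<in> carrier R \<Longrightarrow> s \<in> S \<Longrightarrow> \<ominus>\<^bsub>L\<^esub> frac R S a s = frac R S (\<ominus> a) s"
proof (rule loc.minus_equality)
  assume a: "a \<in> carrier R" "s \<in> S"
  have "\<ominus> a \<otimes> s \<oplus> a \<otimes> s = \<zero>" using a by (simp add: l_minus l_neg)
  moreover have "frac R S \<zero> (s \<otimes> s) = frac R S \<zero> \<one>"
    using a by (subst frac_eq_iff) (auto intro!: S_mult bexI[of _ \<one>] S_one)
  ultimately show "frac R S (\<ominus> a) s \<oplus>\<^bsub>L\<^esub> frac R S a s = \<zero>\<^bsub>L\<^esub>" using a by (simp add: loc_add loc_zero)
qed auto

definition \<iota> where "\<iota> a = frac R S a \<one>"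

lemma iota_hom: "ring_hom_cring R L \<iota>"
proof (rule ring_hom_cringI[OF is_cring loc_cring], rule ring_hom_memI)
qed (auto simp: \<iota>_def S_one loc_mult loc_add loc_one)

lemma iota_closed [simp]: "a \<in> carrier R \<Longrightarrow> \<iota> a \<in> carrier L"
  by (simp add: \<iota>_def S_one)

definition contraction where "contraction Q = {a \<in> carrier R. \<iota> a \<in> Q}"

lemma contraction_ideal: assumes "ideal Q L" shows "ideal (contraction Q) R"
  unfolding contraction_def
  by (rule ring_hom_ring.ideal_vimage[OF _ assms])
    (intro ring_hom_ringI2 cring.axioms(1)[OF is_cring] cring.axioms(1)[OF loc_cring] ring_hom_cring.homh[OF iota_hom])

lemma frac_in_ideal_iff:
  assumes Q: "ideal Q L" and a: "a \<in> carrier R" "s \<in> S"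
  shows "frac R S a s \<in> Q \<longleftrightarrow> a \<in> contraction Q"
proof
  assume "frac R S a s \<in> Q"
  then have "\<iota> s \<otimes>\<^bsub>L\<^esub> frac R S a s \<in> Q" using Q a by (simp add: ideal.I_l_closed)
  moreover have "\<iota> s \<otimes>\<^bsub>L\<^esub> frac R S a s = \<iota> a"
    unfolding \<iota>_def using a S_one frac_cancel[of a \<one> s] by (simp add: loc_mult)
  ultimately show "a \<in> contraction Q" using a by (simp add: contraction_def)
next
  assume "a \<in> contraction Q"
  then have "frac R S \<one> s \<otimes>\<^bsub>L\<^esub> \<iota> a \<in> Q" using Q a by (simp add: contraction_def ideal.I_l_closed)
  then show "frac R S a s \<in> Q" using a S_one by (simp add: \<iota>_def loc_mult)
qed

text \<open>Ideals of the localization are determined by their contractions, because every fraction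
  is a unit multiple of its numerator. This keeps chains of primes strict when they are
  contracted.\<close>

lemma contraction_mono_iff:
  assumes "ideal Q L" "ideal Q' L" shows "contraction Q \<subseteq> contraction Q' \<longleftrightarrow> Q \<subseteq> Q'"
proof
  assume *: "contraction Q \<subseteq> contraction Q'"
  show "Q \<subseteq> Q'"
  proof
    fix x assume "x \<in> Q"
    moreover from this have "x \<in> carrier L" using assms by (meson ideal.Icarr)
    ultimately show "x \<in> Q'" using * assms by (auto elim!: loc_carrierE simp: frac_in_ideal_iff)
  qed
qed (auto simp: contraction_def)

lemma contraction_disjoint:
  assumes Q: "ideal Q L" "Q \<noteq> carrier L" shows "contraction Q \<inter> S = {}"
proof (rule ccontr)
  assume "contraction Q \<inter> S \<noteq> {}"
  then obtain s where s: "s \<in> S" "s \<in> contraction Q" by auto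
  then have "frac R S s s \<in> Q" using Q frac_in_ideal_iff by auto
  moreover have "frac R S s s = \<one>\<^bsub>L\<^esub>" using s S_one frac_cancel[of \<one> \<one> s] by (simp add: loc_one)
  ultimately show False using Q ideal.one_imp_carrier by metis
qed

lemma contraction_prime:
  assumes Q: "primeideal Q L" shows "primeideal (contraction Q) R"
proof (rule primeidealI)
  have QI: "ideal Q L" using Q by (simp add: primeideal.axioms)
  show "ideal (contraction Q) R" using contraction_ideal[OF QI] .
  show "cring R" by (rule is_cring)
  have "Q \<noteq> carrier L" using primeideal.I_notcarr[OF Q] by auto
  then have "\<one> \<notin> contraction Q" using contraction_disjoint[OF QI] S_one by auto
  then show "carrier R \<noteq> contraction Q" by auto
  fix a b assume ab: "a \<in> carrier R" "b \<in> carrier R" "a \<otimes> b \<in> contraction Q"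
  then have "\<iota> a \<otimes>\<^bsub>L\<^esub> \<iota> b \<in> Q" using S_one by (simp add: contraction_def \<iota>_def loc_mult)
  then have "\<iota> a \<in> Q \<or> \<iota> b \<in> Q" using primeideal.I_prime[OF Q iota_closed iota_closed] ab by blast
  then show "a \<in> contraction Q \<or> b \<in> contraction Q" using ab by (auto simp: contraction_def)
qed

definition extension where "extension I = {frac R S a s | a s. a \<in> I \<and> s \<in> S}"

lemma frac_in_extension_iff:
  assumes I: "ideal I R" and a: "a \<in> carrier R" "s \<in> S"
  shows "frac R S a s \<in> extension I \<longleftrightarrow> (\<exists>u\<in>S. u \<otimes> a \<in> I)"
proof
  interpret I: ideal I R by fact
  assume "frac R S a s \<in> extension I"
  then obtain b t where b: "b \<in> I" "t \<in> S" "frac R S a s = frac R S b t" by (auto simp: extension_def)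
  moreover have [simp]: "b \<in> carrier R" using b I.Icarr by auto
  ultimately obtain u where u: "u \<in> S" "u \<otimes> (a \<otimes> t) = u \<otimes> (b \<otimes> s)" using a by (auto simp: frac_eq_iff)
  have "(u \<otimes> t) \<otimes> a = u \<otimes> (a \<otimes> t)" using u(1) a b by (simp add: m_ac)
  also have "\<dots> \<in> I" using u a b by (simp add: I.I_l_closed I.I_r_closed)
  finally show "\<exists>u\<in>S. u \<otimes> a \<in> I" using u b S_mult by blast
next
  assume "\<exists>u\<in>S. u \<otimes> a \<in> I"
  then obtain u where "u \<in> S" "u \<otimes> a \<in> I" by auto
  then have "frac R S (u \<otimes> a) (u \<otimes> s) \<in> extension I" using a S_mult by (auto simp: extension_def)
  then show "frac R S a s \<in> extension I" using a \<open>u \<in> S\<close> by (simp add: frac_cancel)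
qed

lemma extension_ideal: assumes I: "ideal I R" shows "ideal (extension I) L"
proof (rule idealI)
  interpret I: ideal I R by fact
  show "ring L" by (rule cring.axioms(1)[OF loc_cring])
  have [simp]: "a \<in> I \<Longrightarrow> a \<in> carrier R" for a by (rule I.Icarr)
  show "subgroup (extension I) (add_monoid L)"
  proof
    show "extension I \<subseteq> carrier (add_monoid L)" by (auto simp: extension_def)
    have "frac R S \<zero> \<one> \<in> extension I" using S_one I.zero_closed unfolding extension_def by blast
    then show "\<one>\<^bsub>add_monoid L\<^esub> \<in> extension I" by (simp add: loc_zero)
  next
    fix x y assume "x \<in> extension I" "y \<in> extension I"
    then obtain a s b t where "x = frac R S a s" "y = frac R S b t" "a \<in> I" "s \<in> S" "b \<in> I" "t \<in> S"
      by (auto simp: extension_def)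
    moreover from this have "a \<otimes> t \<oplus> b \<otimes> s \<in> I" by (simp add: I.I_r_closed I.a_closed)
    ultimately show "x \<otimes>\<^bsub>add_monoid L\<^esub> y \<in> extension I"
      using S_mult by (auto simp: loc_add extension_def)
  next
    fix x assume "x \<in> extension I"
    then obtain a s where "x = frac R S a s" "a \<in> I" "s \<in> S" by (auto simp: extension_def)
    moreover from this have "\<ominus> a \<in> I" by (simp add: I.a_inv_closed)
    ultimately show "inv\<^bsub>add_monoid L\<^esub> x \<in> extension I"
      using loc_uminus[of a s] by (auto simp: extension_def a_inv_def)
  qed
next
  interpret I: ideal I R by fact
  have [simp]: "a \<in> I \<Longrightarrow> a \<in> carrier R" for a by (rule I.Icarr)
  fix x y assume "x \<in> extension I" and y: "y \<in> carrier L"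
  then obtain a s b t where *: "x = frac R S a s" "y = frac R S b t" "a \<in> I" "s \<in> S" "b \<in> carrier R" "t \<in> S"
    by (auto simp: extension_def elim!: loc_carrierE)
  have "a \<otimes> b \<in> I" "b \<otimes> a \<in> I" using * by (auto simp: I.I_r_closed I.I_l_closed)
  then show "y \<otimes>\<^bsub>L\<^esub> x \<in> extension I" "x \<otimes>\<^bsub>L\<^esub> y \<in> extension I"
    using * S_mult by (auto simp: loc_mult extension_def)
qed

lemma genideal_iota:
  assumes X: "X \<subseteq> carrier R" shows "Idl\<^bsub>L\<^esub> (\<iota> ` X) = extension (Idl X)"
proof
  have I: "ideal (Idl X) R" using genideal_ideal[OF X] .
  have img: "\<iota> ` X \<subseteq> carrier L" using X by auto
  have "\<iota> ` X \<subseteq> extension (Idl X)"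
    using genideal_self[OF X] S_one by (auto simp: \<iota>_def extension_def)
  then show "Idl\<^bsub>L\<^esub> (\<iota> ` X) \<subseteq> extension (Idl X)" using extension_ideal[OF I] loc.genideal_minimal by auto
  have Q: "ideal (Idl\<^bsub>L\<^esub> (\<iota> ` X)) L" using loc.genideal_ideal[OF img] .
  have "X \<subseteq> contraction (Idl\<^bsub>L\<^esub> (\<iota> ` X))" using X loc.genideal_self[OF img] by (auto simp: contraction_def)
  then have "Idl X \<subseteq> contraction (Idl\<^bsub>L\<^esub> (\<iota> ` X))" using genideal_minimal contraction_ideal[OF Q] by auto
  then show "extension (Idl X) \<subseteq> Idl\<^bsub>L\<^esub> (\<iota> ` X)"
    using frac_in_ideal_iff[OF Q] by (auto simp: extension_def contraction_def)
qed

text \<open>Each ideal is the extension of its contraction, so the images of finitely many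
  generators of the contraction generate it.\<close>

lemma loc_noetherian: assumes "noetherian_ring R" shows "noetherian_ring L"
proof (rule loc.noetherian_ringI)
  fix Q assume Q: "ideal Q L"
  then obtain A where A: "A \<subseteq> carrier R" "finite A" "contraction Q = Idl A"
    using noetherian_ring.finetely_gen[OF assms contraction_ideal[OF Q]] by auto
  have "Q = extension (contraction Q)"
  proof
    show "Q \<subseteq> extension (contraction Q)"
    proof
      fix x assume x: "x \<in> Q"
      obtain a s where a: "x = frac R S a s" "a \<in> carrier R" "s \<in> S" using ideal.Icarr[OF Q x] by (rule loc_carrierE)
      with x frac_in_ideal_iff[OF Q a(2,3)] show "x \<in> extension (contraction Q)" by (auto simp: extension_def)
    qed
    show "extension (contraction Q) \<subseteq> Q"
    proof
      fix x assume "x \<in> extension (contraction Q)"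
      then obtain a s where a: "x = frac R S a s" "a \<in> contraction Q" "s \<in> S" by (auto simp: extension_def)
      then show "x \<in> Q" using frac_in_ideal_iff[OF Q, of a s] by (auto simp: contraction_def)
    qed
  qed
  then have "Q = Idl\<^bsub>L\<^esub> (\<iota> ` A)" using genideal_iota A by simp
  then show "\<exists>A\<subseteq>carrier L. finite A \<and> Q = Idl\<^bsub>L\<^esub> A" using A by (intro exI[of _ "\<iota> ` A"]) auto
qed

end

section \<open>A criterion for Cohen-Macaulay rings\<close>

text \<open>In a noetherian ring the union of a nonempty chain of ideals belongs to the chain; this
  is the bound that Zorn's lemma asks for.\<close>

lemma (in noetherian_ring) maximal_ideal_avoiding:
  assumes I: "ideal I R" "I \<inter> T = {}"
  obtains P where "ideal P R" "I \<subseteq> P" "P \<inter> T = {}"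
    "\<And>Q. ideal Q R \<Longrightarrow> P \<subseteq> Q \<Longrightarrow> Q \<inter> T = {} \<Longrightarrow> Q = P"
proof -
  define A where "A = {Q. ideal Q R \<and> I \<subseteq> Q \<and> Q \<inter> T = {}}"
  have "\<exists>P\<in>A. \<forall>Q\<in>A. P \<subseteq> Q \<longrightarrow> Q = P"
  proof (rule subset_Zorn_nonempty)
    show "A \<noteq> {}" using I by (auto simp: A_def)
    fix C assume C: "C \<noteq> {}" "subset.chain A C"
    then have "subset.chain {I. ideal I R} C" by (auto simp: subset_chain_def A_def)
    from ideal_chain_is_trivial[OF C(1) this] show "\<Union>C \<in> A" using C by (auto simp: subset_chain_def)
  qed
  then obtain P where "P \<in> A" "\<And>Q. Q \<in> A \<Longrightarrow> P \<subseteq> Q \<Longrightarrow> Q = P" by blast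
  then show thesis using that[of P] by (auto simp: A_def)
qed

text \<open>An ideal maximal among those missing a multiplicative set is prime: enlarging it by a or
  by b makes it meet \<open>T\<close>, and the product of the two elements so found lies in
  \<open>T\<close> and, if a b is in the ideal, in the ideal as well.\<close>

lemma (in cring) prime_avoiding:
  assumes "noetherian_ring R" and I: "ideal I R" "I \<inter> T = {}"
    and T: "T \<subseteq> carrier R" "\<one> \<in> T" "\<And>s t. s \<in> T \<Longrightarrow> t \<in> T \<Longrightarrow> s \<otimes> t \<in> T"
  obtains P where "primeideal P R" "I \<subseteq> P" "P \<inter> T = {}"
proof -
  obtain P where P: "ideal P R" "I \<subseteq> P" "P \<inter> T = {}"
    and max: "\<And>Q. ideal Q R \<Longrightarrow> P \<subseteq> Q \<Longrightarrow> Q \<inter> T = {} \<Longrightarrow> Q = P"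
    using noetherian_ring.maximal_ideal_avoiding[OF assms(1) I] by blast
  interpret P: ideal P R by fact
  have ex: "\<exists>p\<in>P. \<exists>r\<in>carrier R. p \<oplus> r \<otimes> a \<in> T" if a: "a \<in> carrier R" "a \<notin> P" for a
  proof (rule ccontr)
    assume no: "\<not> ?thesis"
    let ?Q = "P <+>\<^bsub>R\<^esub> PIdl a"
    have Q: "ideal ?Q R" using add_ideals[OF P(1) cgenideal_ideal[OF a(1)]] .
    have sub: "P \<subseteq> ?Q"
    proof
      fix p assume p: "p \<in> P"
      have "\<zero> \<in> PIdl a" using cgenideal_ideal[OF a(1)] by (simp add: additive_subgroup.zero_closed ideal.axioms(1))
      moreover have "p = p \<oplus> \<zero>" using p P.Icarr by simp
      ultimately show "p \<in> ?Q" unfolding set_add_def' using p by blast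
    qed
    have "?Q \<inter> T = {}" using no by (auto simp: set_add_def' cgenideal_def)
    then have "?Q = P" using max Q sub by auto
    moreover have "a \<in> ?Q"
    proof -
      have "\<zero> \<in> P" by (rule P.zero_closed)
      moreover have "a \<in> PIdl a" using cgenideal_self a by auto
      moreover have "a = \<zero> \<oplus> a" using a by simp
      ultimately show ?thesis unfolding set_add_def' by blast
    qed
    ultimately show False using a by simp
  qed
  have "primeideal P R"
  proof (rule primeidealI[OF P(1) is_cring])
    show "carrier R \<noteq> P" using T P by auto
    fix a b assume ab: "a \<in> carrier R" "b \<in> carrier R" "a \<otimes> b \<in> P"
    show "a \<in> P \<or> b \<in> P"
    proof (rule ccontr)
      assume "\<not> (a \<in> P \<or> b \<in> P)"
      then obtain p r q t where *: "p \<in> P" "r \<in> carrier R" "p \<oplus> r \<otimes> a \<in> T" "q \<in> P" "t \<in> carrier R" "q \<oplus> t \<otimes> b \<in> T"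
        using ex[of a] ex[of b] ab by auto
      have [simp]: "p \<in> carrier R" "q \<in> carrier R" using * P.Icarr by auto
      have "(p \<oplus> r \<otimes> a) \<otimes> (q \<oplus> t \<otimes> b) = p \<otimes> (q \<oplus> t \<otimes> b) \<oplus> ((r \<otimes> a) \<otimes> q \<oplus> (r \<otimes> t) \<otimes> (a \<otimes> b))"
        using * ab by (simp add: l_distr r_distr m_ac) (simp add: a_ac)
      also have "\<dots> \<in> P" using * ab by (simp add: P.a_closed P.I_r_closed P.I_l_closed)
      finally show False using T(3)[OF *(3) *(6)] P by auto
    qed
  qed
  then show thesis using that P by blast
qed

text \<open>This yields that depth is at most dimension. If x is the last term and I the ideal of
  the earlier ones, the set of all s x^n with s outside \<open>P\<close> misses I, because x is a
  nonzerodivisor modulo I and I lies in \<open>P\<close>. A prime over I missing that set is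
  contained in \<open>P\<close> and omits x, so it is strictly smaller, and the recursion continues
  with it.\<close>

lemma (in cring) regular_sequence_prime_chain:
  assumes noeth: "noetherian_ring R"
    and xs: "set xs \<subseteq> carrier R"
    and reg: "\<And>i a. i < length xs \<Longrightarrow> a \<in> carrier R \<Longrightarrow>
        xs ! i \<otimes> a \<in> Idl (set (take i xs)) \<Longrightarrow> a \<in> Idl (set (take i xs))"
    and P: "primeideal P R" "set xs \<subseteq> P"
  shows "\<exists>p :: nat \<Rightarrow> 'a set. (\<forall>i\<le>length xs. primeideal (p i) R) \<and>
           (\<forall>i<length xs. p i \<subset> p (Suc i)) \<and> p (length xs) = P"
  using xs reg P
proof (induction xs arbitrary: P rule: rev_induct)
  case Nil
  then show ?case by (intro exI[of _ "\<lambda>_. P"]) auto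
next
  case (snoc x xs)
  interpret P: primeideal P R by fact
  have x: "x \<in> carrier R" "x \<in> P" using snoc.prems by auto
  have xs: "set xs \<subseteq> carrier R" using snoc.prems by auto
  define I where "I = Idl (set xs)"
  have I: "ideal I R" using genideal_ideal[OF xs] by (simp add: I_def)
  have IP: "I \<subseteq> P" unfolding I_def using snoc.prems by (intro genideal_minimal P.is_ideal) auto
  have colon: "a \<in> I" if "a \<in> carrier R" "x \<otimes> a \<in> I" for a
    using snoc.prems(2)[of "length xs" a] that by (simp add: I_def)
  have colon_pow: "a \<in> I" if "a \<in> carrier R" "a \<otimes> x [^] n \<in> I" for a and n :: nat
    using that
  proof (induction n arbitrary: a)
    case (Suc n)
    have "a \<otimes> x [^] Suc n = x \<otimes> (a \<otimes> x [^] n)" using x Suc.prems(1) by (simp add: m_ac)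
    then have "x \<otimes> (a \<otimes> x [^] n) \<in> I" using Suc.prems(2) by (simp only:)
    from colon[OF _ this] have "a \<otimes> x [^] n \<in> I" using Suc.prems(1) x(1) by simp
    then show ?case by (rule Suc.IH[OF Suc.prems(1)])
  qed simp
  define T where "T = {s \<otimes> x [^] n | s (n::nat). s \<in> carrier R - P}"
  have "I \<inter> T = {}" using colon_pow IP by (auto simp: T_def)
  moreover have "T \<subseteq> carrier R" using x by (auto simp: T_def)
  moreover have "\<one> \<in> T"
  proof -
    have "\<one> \<notin> P" using P.I_notcarr P.one_imp_carrier by auto
    then show ?thesis unfolding T_def using x by (intro CollectI exI[of _ \<one>] exI[of _ "0::nat"]) auto
  qed
  moreover have "s \<otimes> t \<in> T" if st: "s \<in> T" "t \<in> T" for s t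
  proof -
    obtain a b :: 'a and n m :: nat where *: "s = a \<otimes> x [^] n" "t = b \<otimes> x [^] m" "a \<in> carrier R - P" "b \<in> carrier R - P"
      using st by (auto simp: T_def)
    have "s \<otimes> t = (a \<otimes> b) \<otimes> x [^] (n + m)" using * x by (simp add: nat_pow_mult[symmetric] m_ac)
    moreover have "a \<otimes> b \<in> carrier R - P" using * P.I_prime by auto
    ultimately show ?thesis unfolding T_def by blast
  qed
  ultimately obtain Q where Q: "primeideal Q R" "I \<subseteq> Q" "Q \<inter> T = {}"
    using prime_avoiding[OF noeth I] by metis
  interpret Q: primeideal Q R by fact
  have "\<one> \<notin> P" using P.I_notcarr P.one_imp_carrier by auto
  then have "x \<in> T" unfolding T_def using x by (intro CollectI exI[of _ \<one>] exI[of _ "1::nat"]) auto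
  moreover have "Q \<subseteq> P"
  proof
    fix s assume s: "s \<in> Q"
    show "s \<in> P"
    proof (rule ccontr)
      assume "s \<notin> P"
      then have "s \<in> T" unfolding T_def using s Q.Icarr by (intro CollectI exI[of _ s] exI[of _ "0::nat"]) auto
      then show False using Q s by auto
    qed
  qed
  ultimately have QP: "Q \<subset> P" using Q x by auto
  have "set xs \<subseteq> Q" using Q genideal_self[OF xs] by (auto simp: I_def)
  moreover have "a \<in> Idl (set (take i xs))" if "i < length xs" "a \<in> carrier R" "xs ! i \<otimes> a \<in> Idl (set (take i xs))" for i a
    using snoc.prems(2)[of i a] that by (simp add: nth_append)
  ultimately obtain p where p: "\<And>i. i \<le> length xs \<Longrightarrow> primeideal (p i) R"
      "\<And>i. i < length xs \<Longrightarrow> p i \<subset> p (Suc i)" "p (length xs) = Q"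
    using snoc.IH[of Q] xs Q(1) by blast
  show ?case
  proof (intro exI conjI allI impI)
    fix i assume "i \<le> length (xs @ [x])"
    then show "primeideal ((p(Suc (length xs) := P)) i) R"
      using p(1)[of i] snoc.prems(3) by auto
  next
    fix i assume "i < length (xs @ [x])"
    then show "(p(Suc (length xs) := P)) i \<subset> (p(Suc (length xs) := P)) (Suc i)"
      using p(2)[of i] p(3) QP by (cases "i = length xs") auto
  qed simp
qed

text \<open>The properness required in \<open>regular_sequence\<close> is automatic when \<open>m\<close> is a proper ideal.\<close>

definition regular_in :: "('a, 'b) ring_scheme \<Rightarrow> 'a set \<Rightarrow> 'a list \<Rightarrow> bool" where
  "regular_in R m xs \<longleftrightarrow> set xs \<subseteq> m \<and>
     (\<forall>i<length xs. \<forall>a\<in>carrier R.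
        xs ! i \<otimes>\<^bsub>R\<^esub> a \<in> Idl\<^bsub>R\<^esub> (set (take i xs)) \<longrightarrow> a \<in> Idl\<^bsub>R\<^esub> (set (take i xs)))"

text \<open>A sandwich: N is at most the depth by the images of \<open>xs\<close>, the depth is at
  most the dimension by \<open>regular_sequence_prime_chain\<close>, and the dimension is at most N
  because chains of primes contract to chains in \<open>R\<close>. The bound \<open>dim\<close> is
  global, so one N serves every maximal ideal.\<close>

lemma (in cring) cohen_macaulay_localization:
  assumes noeth: "noetherian_ring R" and m: "maximalideal m R"
    and xs: "regular_in R m xs" "length xs = N"
    and dim: "\<And>n p. (\<And>i. i \<le> n \<Longrightarrow> primeideal (p i) R) \<Longrightarrow> (\<And>i. i < n \<Longrightarrow> p i \<subset> p (Suc i)) \<Longrightarrow> n \<le> N"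
  shows "cohen_macaulay_local_ring (localization R (carrier R - m))"
proof -
  interpret m: primeideal m R using maximalideal_prime[OF m] .
  have mI: "ideal m R" by (rule m.is_ideal)
  have one: "\<one> \<notin> m" using m.I_notcarr m.one_imp_carrier by auto
  interpret multiplicative_subset R "carrier R - m"
    using one m.I_prime by unfold_locales auto
  define M where "M = extension m"
  have M: "ideal M L" unfolding M_def by (rule extension_ideal[OF mI])
  have contr_M: "contraction M = m"
  proof -
    have "\<iota> a \<in> M \<longleftrightarrow> a \<in> m" if "a \<in> carrier R" for a
      unfolding M_def \<iota>_def using that m.I_prime one mI
      by (subst frac_in_extension_iff) (auto intro: m.I_l_closed)
    then show ?thesis using m.Icarr by (auto simp: contraction_def)
  qed
  have proper: "M \<noteq> carrier L"
  proof
    assume "M = carrier L"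
    then have "\<one> \<in> contraction M" by (simp add: contraction_def)
    then show False using contr_M one by simp
  qed
  have sub: "Q \<subseteq> M" if Q: "ideal Q L" "Q \<noteq> carrier L" for Q
  proof -
    have "contraction Q \<subseteq> m" using contraction_disjoint[OF Q] by (auto simp: contraction_def)
    then show ?thesis using contraction_mono_iff[OF Q(1) M] contr_M by simp
  qed
  have max_M: "maximalideal M L"
    using M proper sub by (intro maximalidealI) auto
  have unique: "m' = M" if "maximalideal m' L" for m'
  proof -
    interpret m': maximalideal m' L by fact
    have "m' \<subseteq> M" using sub[OF m'.is_ideal] m'.I_notcarr by auto
    then show ?thesis using m'.I_maximal[OF M] proper ideal.Icarr[OF M] by auto
  qed
  have prime_M: "primeideal M L" using loc.maximalideal_prime[OF max_M] .
  have noeth_L: "noetherian_ring L" using loc_noetherian[OF noeth] .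
  have chain: "n \<le> N" if p: "\<forall>i\<le>n. primeideal (p i) L" "\<forall>i<n. p i \<subset> p (Suc i)" for n and p :: "nat \<Rightarrow> ('a \<times> 'a) set set"
  proof (rule dim[of n "\<lambda>i. contraction (p i)"])
    fix i assume "i \<le> n" then show "primeideal (contraction (p i)) R" using p contraction_prime by auto
  next
    fix i assume i: "i < n"
    have I: "ideal (p i) L" "ideal (p (Suc i)) L" using p i by (auto intro: primeideal.axioms)
    show "contraction (p i) \<subset> contraction (p (Suc i))"
      using i p contraction_mono_iff[OF I] contraction_mono_iff[OF I(2) I(1)] by (auto simp: less_le_not_le)
  qed
  have reg: "regular_sequence L (map \<iota> xs)"
    unfolding regular_sequence_def
  proof (intro conjI allI impI ballI)
    have xc: "set xs \<subseteq> carrier R" using xs m.Icarr by (auto simp: regular_in_def)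
    then show "set (map \<iota> xs) \<subseteq> carrier L" by auto
    have "set (map \<iota> xs) \<subseteq> M" using xs contr_M by (auto simp: regular_in_def contraction_def)
    then have "Idl\<^bsub>L\<^esub> (set (map \<iota> xs)) \<subseteq> M" by (rule loc.genideal_minimal[OF M])
    then show "Idl\<^bsub>L\<^esub> (set (map \<iota> xs)) \<noteq> carrier L" using proper ideal.Icarr[OF M] by blast
    fix i a assume i: "i < length (map \<iota> xs)" and a: "a \<in> carrier L"
      and *: "map \<iota> xs ! i \<otimes>\<^bsub>L\<^esub> a \<in> Idl\<^bsub>L\<^esub> (set (take i (map \<iota> xs)))"
    let ?I = "Idl (set (take i xs))"
    have tc: "set (take i xs) \<subseteq> carrier R" using xc set_take_subset[of i xs] by auto
    have I: "ideal ?I R" by (rule genideal_ideal[OF tc])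
    have eq: "Idl\<^bsub>L\<^esub> (set (take i (map \<iota> xs))) = extension ?I" using genideal_iota[OF tc] by (simp add: take_map)
    have xi: "xs ! i \<in> carrier R" using i xc by auto
    obtain b s where b: "a = frac R (carrier R - m) b s" "b \<in> carrier R" "s \<in> carrier R - m" using a by (rule loc_carrierE)
    have "frac R (carrier R - m) (xs ! i \<otimes> b) (\<one> \<otimes> s) \<in> extension ?I"
      using * i xi b S_one unfolding eq by (simp add: \<iota>_def loc_mult)
    \<comment> \<open>Membership in an extended ideal holds only up to a factor u outside m; it is
      absorbed into the numerator \<open>b\<close> before regularity in \<open>R\<close> is
      applied.\<close>
    then obtain u where u: "u \<in> carrier R - m" "u \<otimes> (xs ! i \<otimes> b) \<in> ?I"
      using frac_in_extension_iff[OF I] xi b by auto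
    then have "xs ! i \<otimes> (u \<otimes> b) \<in> ?I" using xi b by (simp add: m_ac)
    moreover have "u \<otimes> b \<in> carrier R" using u b by simp
    moreover have "i < length xs" using i by simp
    ultimately have "u \<otimes> b \<in> ?I" using xs(1) unfolding regular_in_def by blast
    then show "a \<in> Idl\<^bsub>L\<^esub> (set (take i (map \<iota> xs)))"
      unfolding eq b(1) using frac_in_extension_iff[OF I b(2,3)] u by blast
  qed
  have in_M: "set (map \<iota> xs) \<subseteq> M" using xs contr_M by (auto simp: regular_in_def contraction_def)
  have depth_ge: "enat N \<le> depth L M"
    unfolding depth_def using reg in_M xs(2) by (intro Sup_upper) (metis (mono_tags, lifting) CollectI length_map)
  have depth_le: "depth L M \<le> krull_dim L"
    unfolding depth_def
  proof (rule Sup_least, clarify)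
    fix ys assume ys: "set ys \<subseteq> M" "regular_sequence L ys"
    obtain p where "\<forall>i\<le>length ys. primeideal (p i) L" "\<forall>i<length ys. p i \<subset> p (Suc i)"
      using loc.regular_sequence_prime_chain[OF noeth_L _ _ prime_M ys(1)] ys(2)
      unfolding regular_sequence_def by blast
    then show "enat (length ys) \<le> krull_dim L" unfolding krull_dim_def by (intro Sup_upper) blast
  qed
  have "krull_dim L \<le> enat N"
    unfolding krull_dim_def using chain by (intro Sup_least) auto
  then have "depth L M = krull_dim L" using depth_ge depth_le by auto
  then show ?thesis unfolding cohen_macaulay_local_ring_def
    using loc_cring noeth_L max_M unique by metis
qed

lemma (in cring) cohen_macaulay_ringI:
  assumes "noetherian_ring R"
    and "\<And>m. maximalideal m R \<Longrightarrow> \<exists>xs. regular_in R m xs \<and> length xs = N"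
    and "\<And>n p. (\<And>i. i \<le> n \<Longrightarrow> primeideal (p i) R) \<Longrightarrow> (\<And>i. i < n \<Longrightarrow> p i \<subset> p (Suc i)) \<Longrightarrow> n \<le> N"
  shows "cohen_macaulay_ring R"
  unfolding cohen_macaulay_ring_def
proof (intro conjI allI impI is_cring assms(1))
  fix m assume m: "maximalideal m R"
  with assms(2) obtain xs where "regular_in R m xs" "length xs = N" by blast
  from cohen_macaulay_localization[OF assms(1) m this] assms(3)
  show "cohen_macaulay_local_ring (localization R (carrier R - m))" by blast
qed

text \<open>The criterion pulled back along the quotient map: ideals of \<open>R Quot J\<close>
  correspond to ideals above \<open>J\<close>, so both hypotheses speak of elements of
  \<open>R\<close> rather than of cosets.\<close>

lemma (in cring) cohen_macaulay_quotient:
  assumes J: "ideal J R" and noeth: "noetherian_ring R"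
    and reg: "\<And>m. maximalideal m R \<Longrightarrow> J \<subseteq> m \<Longrightarrow>
       \<exists>xs. set xs \<subseteq> m \<and> length xs = N \<and>
         (\<forall>i<length xs. \<forall>a\<in>carrier R.
            xs ! i \<otimes> a \<in> Idl (J \<union> set (take i xs)) \<longrightarrow> a \<in> Idl (J \<union> set (take i xs)))"
    and dim: "\<And>n p. (\<And>i. i \<le> n \<Longrightarrow> primeideal (p i) R \<and> J \<subseteq> p i) \<Longrightarrow>
       (\<And>i. i < n \<Longrightarrow> p i \<subset> p (Suc i)) \<Longrightarrow> n \<le> N"
  shows "cohen_macaulay_ring (R Quot J)"
proof -
  interpret J: ideal J R by fact
  let ?A = "R Quot J" and ?\<pi> = "(+>) J"
  interpret A: cring ?A by (rule J.quotient_is_cring[OF is_cring])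
  interpret \<pi>: ring_hom_ring R ?A ?\<pi> by (rule J.rcos_ring_hom_ring)
  define c where "c Q = {r \<in> carrier R. ?\<pi> r \<in> Q}" for Q
  have c_ideal: "ideal (c Q) R" if "ideal Q ?A" for Q
    unfolding c_def by (rule \<pi>.ideal_vimage[OF that])
  have surj: "\<exists>r\<in>carrier R. x = ?\<pi> r" if "x \<in> carrier ?A" for x
    using that A_RCOSETS_def'[of R J] unfolding FactRing_def by auto
  have image_c: "?\<pi> ` c Q = Q" if Q: "ideal Q ?A" for Q
  proof
    show "Q \<subseteq> ?\<pi> ` c Q"
    proof
      fix x assume "x \<in> Q"
      then show "x \<in> ?\<pi> ` c Q" using surj[OF ideal.Icarr[OF Q \<open>x \<in> Q\<close>]] by (auto simp: c_def)
    qed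
  qed (auto simp: c_def)
  have J_c: "J \<subseteq> c Q" if Q: "ideal Q ?A" for Q
  proof
    fix j assume j: "j \<in> J"
    have "\<zero>\<^bsub>?A\<^esub> = J" unfolding FactRing_def by simp
    moreover have "\<zero>\<^bsub>?A\<^esub> \<in> Q" by (rule additive_subgroup.zero_closed[OF ideal.axioms(1)[OF Q]])
    ultimately have "?\<pi> j \<in> Q" by (simp only: J.a_rcos_const[OF j])
    then show "j \<in> c Q" using J.Icarr[OF j] by (simp only: c_def mem_Collect_eq)
  qed
  have c_mono: "c Q \<subset> c Q'" if "ideal Q ?A" "ideal Q' ?A" "Q \<subset> Q'" for Q Q'
  proof -
    have "c Q \<subseteq> c Q'" using that by (auto simp: c_def)
    moreover have "c Q \<noteq> c Q'" using image_c[OF that(1)] image_c[OF that(2)] that(3) by (metis less_irrefl)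
    ultimately show ?thesis by blast
  qed
  have c_prime: "primeideal (c Q) R" if Q: "primeideal Q ?A" for Q
  proof (rule primeidealI)
    have QI: "ideal Q ?A" using Q by (rule primeideal.axioms)
    show "ideal (c Q) R" by (rule c_ideal[OF QI])
    show "cring R" by (rule is_cring)
    show "carrier R \<noteq> c Q"
    proof
      assume "carrier R = c Q"
      then have "\<one> \<in> c Q" using one_closed by simp
      then have "?\<pi> \<one> \<in> Q" unfolding c_def by blast
      then have "Q = carrier ?A" using ideal.one_imp_carrier[OF QI] \<pi>.hom_one by simp
      then show False using primeideal.I_notcarr[OF Q] by simp
    qed
    fix a b assume ab: "a \<in> carrier R" "b \<in> carrier R" "a \<otimes> b \<in> c Q"
    then have "?\<pi> (a \<otimes> b) \<in> Q" unfolding c_def by blast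
    then have "?\<pi> a \<otimes>\<^bsub>?A\<^esub> ?\<pi> b \<in> Q" using \<pi>.hom_mult[OF ab(1,2)] by simp
    then have "?\<pi> a \<in> Q \<or> ?\<pi> b \<in> Q"
      using primeideal.I_prime[OF Q \<pi>.hom_closed \<pi>.hom_closed] ab by blast
    then show "a \<in> c Q \<or> b \<in> c Q" using ab by (auto simp: c_def)
  qed
  have Idl_image: "?\<pi> a \<in> Idl\<^bsub>?A\<^esub> (?\<pi> ` X) \<longleftrightarrow> a \<in> Idl (J \<union> X)"
    if X: "X \<subseteq> carrier R" and a: "a \<in> carrier R" for X a
  proof
    have JX: "J \<union> X \<subseteq> carrier R" using X J.Icarr by auto
    have I: "ideal (Idl (J \<union> X)) R" by (rule genideal_ideal[OF JX])
    have "ideal (?\<pi> ` (Idl (J \<union> X))) ?A" by (rule ring_ideal_imp_quot_ideal[OF J I])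
    moreover have "?\<pi> ` X \<subseteq> ?\<pi> ` (Idl (J \<union> X))" using genideal_self[OF JX] by auto
    ultimately have sub: "Idl\<^bsub>?A\<^esub> (?\<pi> ` X) \<subseteq> ?\<pi> ` (Idl (J \<union> X))" by (rule A.genideal_minimal)
    assume "?\<pi> a \<in> Idl\<^bsub>?A\<^esub> (?\<pi> ` X)"
    then obtain b where b: "b \<in> Idl (J \<union> X)" "?\<pi> a = ?\<pi> b" using sub by auto
    have bc: "b \<in> carrier R" using b ideal.Icarr[OF I] by auto
    have "a \<ominus> b \<in> J" using quotient_eq_iff_same_a_r_cos[OF J a bc] b by simp
    then have "a \<ominus> b \<in> Idl (J \<union> X)" using genideal_self[OF JX] by auto
    then have "(a \<ominus> b) \<oplus> b \<in> Idl (J \<union> X)" using b I by (simp add: additive_subgroup.a_closed ideal.axioms(1))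
    then show "a \<in> Idl (J \<union> X)" using a bc by (simp add: minus_eq a_assoc l_neg)
  next
    have X': "?\<pi> ` X \<subseteq> carrier ?A" using X by auto
    have Q: "ideal (Idl\<^bsub>?A\<^esub> (?\<pi> ` X)) ?A" by (rule A.genideal_ideal[OF X'])
    have "J \<union> X \<subseteq> c (Idl\<^bsub>?A\<^esub> (?\<pi> ` X))"
      using J_c[OF Q] A.genideal_self[OF X'] X by (auto simp: c_def)
    then have "Idl (J \<union> X) \<subseteq> c (Idl\<^bsub>?A\<^esub> (?\<pi> ` X))" by (rule genideal_minimal[OF c_ideal[OF Q]])
    then show "a \<in> Idl (J \<union> X) \<Longrightarrow> ?\<pi> a \<in> Idl\<^bsub>?A\<^esub> (?\<pi> ` X)" by (auto simp: c_def)
  qed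
  show ?thesis
  proof (rule A.cohen_macaulay_ringI)
    show "noetherian_ring ?A"
    proof (rule A.noetherian_ringI)
      fix Q assume Q: "ideal Q ?A"
      obtain B where B: "B \<subseteq> carrier R" "finite B" "c Q = Idl B"
        using noetherian_ring.finetely_gen[OF noeth c_ideal[OF Q]] by auto
      have B': "?\<pi> ` B \<subseteq> carrier ?A" using B by auto
      have "B \<subseteq> c Q" using B genideal_self by auto
      then have "Idl\<^bsub>?A\<^esub> (?\<pi> ` B) \<subseteq> Q" by (intro A.genideal_minimal[OF Q]) (auto simp: c_def)
      moreover have "Q \<subseteq> Idl\<^bsub>?A\<^esub> (?\<pi> ` B)"
      proof
        fix x assume "x \<in> Q"
        then obtain r where r: "r \<in> c Q" "x = ?\<pi> r" using image_c[OF Q] by blast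
        have "Idl B \<subseteq> Idl (J \<union> B)" using B J.Icarr by (intro subset_Idl_subset) auto
        then show "x \<in> Idl\<^bsub>?A\<^esub> (?\<pi> ` B)" using r B Idl_image[of B r] by (auto simp: c_def)
      qed
      ultimately show "\<exists>B\<subseteq>carrier ?A. finite B \<and> Q = Idl\<^bsub>?A\<^esub> B" using B B' by (intro exI[of _ "?\<pi> ` B"]) auto
    qed
  next
    fix m assume m: "maximalideal m ?A"
    interpret m: maximalideal m ?A by fact
    have "maximalideal (c m) R"
    proof (rule maximalidealI)
      show "ideal (c m) R" by (rule c_ideal[OF m.is_ideal])
      show "carrier R \<noteq> c m" using c_prime[OF A.maximalideal_prime[OF m]] primeideal.I_notcarr by blast
      fix I assume I: "ideal I R" "c m \<subseteq> I" "I \<subseteq> carrier R"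
      have "ideal (?\<pi> ` I) ?A" by (rule ring_ideal_imp_quot_ideal[OF J I(1)])
      moreover have "m \<subseteq> ?\<pi> ` I" using image_c[OF m.is_ideal] I by blast
      moreover have "?\<pi> ` I \<subseteq> carrier ?A" using I by auto
      ultimately consider "?\<pi> ` I = m" | "?\<pi> ` I = carrier ?A" using m.I_maximal by blast
      then show "I = c m \<or> I = carrier R"
      proof cases
        case 1
        then have "I \<subseteq> c m" using I by (auto simp: c_def)
        then show ?thesis using I by auto
      next
        case 2
        have "?\<pi> \<one> \<in> carrier ?A" by simp
        then obtain b where b: "b \<in> I" "?\<pi> \<one> = ?\<pi> b" using 2 by (metis imageE)
        have bc: "b \<in> carrier R" using b I by auto
        have "\<one> \<ominus> b \<in> J" using quotient_eq_iff_same_a_r_cos[OF J one_closed bc] b by simp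
        then have "\<one> \<ominus> b \<in> I" using J_c[OF m.is_ideal] I by auto
        then have "(\<one> \<ominus> b) \<oplus> b \<in> I" using b I by (simp add: additive_subgroup.a_closed ideal.axioms(1))
        then have "\<one> \<in> I" using bc by (simp add: minus_eq a_assoc l_neg)
        then show ?thesis using ideal.one_imp_carrier[OF I(1)] by simp
      qed
    qed
    from reg[OF this J_c[OF m.is_ideal]] obtain xs where xs: "set xs \<subseteq> c m" "length xs = N"
      and colon: "\<And>i a. i < length xs \<Longrightarrow> a \<in> carrier R \<Longrightarrow>
         xs ! i \<otimes> a \<in> Idl (J \<union> set (take i xs)) \<Longrightarrow> a \<in> Idl (J \<union> set (take i xs))" by blast
    have xc: "set xs \<subseteq> carrier R" using xs by (auto simp: c_def)
    have "regular_in ?A m (map ?\<pi> xs)"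
      unfolding regular_in_def
    proof (intro conjI allI impI ballI)
      show "set (map ?\<pi> xs) \<subseteq> m" using xs by (auto simp: c_def)
      fix i a assume i: "i < length (map ?\<pi> xs)" and a: "a \<in> carrier ?A"
        and *: "map ?\<pi> xs ! i \<otimes>\<^bsub>?A\<^esub> a \<in> Idl\<^bsub>?A\<^esub> (set (take i (map ?\<pi> xs)))"
      obtain r where r: "r \<in> carrier R" "a = ?\<pi> r" using surj[OF a] by auto
      have tc: "set (take i xs) \<subseteq> carrier R" using xc set_take_subset[of i xs] by auto
      have eq: "set (take i (map ?\<pi> xs)) = ?\<pi> ` set (take i xs)" by (simp add: take_map)
      have xi: "xs ! i \<in> carrier R" using i xc by auto
      have "?\<pi> (xs ! i \<otimes> r) \<in> Idl\<^bsub>?A\<^esub> (?\<pi> ` set (take i xs))"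
        using * i r xi unfolding eq by simp
      then have "xs ! i \<otimes> r \<in> Idl (J \<union> set (take i xs))"
        by (rule iffD1[OF Idl_image[OF tc m_closed[OF xi r(1)]]])
      then have "r \<in> Idl (J \<union> set (take i xs))" using colon i r by simp
      then show "a \<in> Idl\<^bsub>?A\<^esub> (set (take i (map ?\<pi> xs)))" using Idl_image[OF tc r(1)] r eq by simp
    qed
    then show "\<exists>xs. regular_in ?A m xs \<and> length xs = N" using xs by (intro exI[of _ "map ?\<pi> xs"]) auto
  next
    fix n and p :: "nat \<Rightarrow> 'a set set"
    assume p: "\<And>i. i \<le> n \<Longrightarrow> primeideal (p i) ?A" "\<And>i. i < n \<Longrightarrow> p i \<subset> p (Suc i)"
    have pI: "ideal (p i) ?A" if "i \<le> n" for i using p(1)[OF that] by (rule primeideal.axioms)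
    show "n \<le> N"
    proof (rule dim[of n "\<lambda>i. c (p i)"])
      show "primeideal (c (p i)) R \<and> J \<subseteq> c (p i)" if "i \<le> n" for i using c_prime J_c p pI that by auto
      show "c (p i) \<subset> c (p (Suc i))" if "i < n" for i using c_mono pI p that by auto
    qed
  qed
qed

section \<open>Subrings of a type class ring as algebraic structures\<close>

definition class_ring :: "'a::comm_ring_1 set \<Rightarrow> 'a ring" where
  "class_ring S = \<lparr>carrier = S, mult = (*), one = 1, zero = 0, add = (+)\<rparr>"

lemma class_ring_simps [simp]:
  "carrier (class_ring S) = S" "x \<otimes>\<^bsub>class_ring S\<^esub> y = x * y" "x \<oplus>\<^bsub>class_ring S\<^esub> y = x + y"
  "\<one>\<^bsub>class_ring S\<^esub> = 1" "\<zero>\<^bsub>class_ring S\<^esub> = 0"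
  by (simp_all add: class_ring_def)

lemma class_ring_cring: assumes S: "ring_closed S" shows "cring (class_ring S)"
proof (rule cringI)
  show "abelian_group (class_ring S)"
  proof (rule abelian_groupI)
    fix x assume "x \<in> carrier (class_ring S)"
    then show "\<exists>y\<in>carrier (class_ring S). y \<oplus>\<^bsub>class_ring S\<^esub> x = \<zero>\<^bsub>class_ring S\<^esub>"
      using S by (intro bexI[of _ "- x"]) (auto intro: ring_closed_intros)
  qed (use S in \<open>auto simp: algebra_simps intro: ring_closed_intros\<close>)
  show "comm_monoid (class_ring S)"
    by (rule comm_monoidI) (use S in \<open>auto simp: algebra_simps intro: ring_closed_intros\<close>)
qed (auto simp: algebra_simps)

lemma class_ring_uminus:
  assumes S: "ring_closed S" and x: "x \<in> S" shows "\<ominus>\<^bsub>class_ring S\<^esub> x = - x"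
proof -
  interpret cring "class_ring S" using S by (rule class_ring_cring)
  show ?thesis by (rule minus_equality) (use S x in \<open>auto intro: ring_closed_intros\<close>)
qed

lemma class_ring_ideal_iff: assumes S: "ring_closed S"
  shows "ideal I (class_ring S) \<longleftrightarrow> ideal_in S I"
proof
  assume "ideal I (class_ring S)"
  then interpret I: ideal I "class_ring S" .
  show "ideal_in S I" unfolding ideal_in_def
    using I.Icarr additive_subgroup.zero_closed[OF ideal.axioms(1)[OF I.is_ideal]]
      additive_subgroup.a_closed[OF ideal.axioms(1)[OF I.is_ideal]] I.I_l_closed by auto
next
  assume I: "ideal_in S I"
  interpret cring "class_ring S" using S by (rule class_ring_cring)
  have um: "\<ominus>\<^bsub>class_ring S\<^esub> x = - x" if "x \<in> I" for x
    using class_ring_uminus[OF S] ideal_in_subset[OF I that] by auto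
  show "ideal I (class_ring S)"
  proof (rule idealI)
    show "ring (class_ring S)" by (rule ring_axioms)
    show "subgroup I (add_monoid (class_ring S))"
    proof
      show "inv\<^bsub>add_monoid (class_ring S)\<^esub> x \<in> I" if "x \<in> I" for x
        using um[OF that] ideal_in_uminus[OF S I that] by (simp add: a_inv_def)
    qed (use I in \<open>auto intro: ideal_in_zero ideal_in_add ideal_in_subset\<close>)
  qed (use I in \<open>auto intro: ideal_in_mult ideal_in_mult_right\<close>)
qed

lemma class_ring_prime: assumes S: "ring_closed S" and P: "primeideal P (class_ring S)"
  shows "prime_in S P"
proof -
  interpret P: primeideal P "class_ring S" by fact
  have "1 \<notin> P" using P.one_imp_carrier P.I_notcarr by auto
  then show ?thesis unfolding prime_in_def
    using P.is_ideal P.I_prime class_ring_ideal_iff[OF S] by auto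
qed

text \<open>The ideal M + a S properly contains \<open>M\<close>, hence contains 1. Inverses modulo
  \<open>M\<close> are the form in which the Nullstellensatz takes maximality.\<close>

lemma class_ring_maximal:
  assumes S: "ring_closed S" and M: "maximalideal M (class_ring S)" and a: "a \<in> S - M"
  shows "\<exists>b\<in>S. a * b - 1 \<in> M"
proof -
  interpret cring "class_ring S" using S by (rule class_ring_cring)
  interpret M: maximalideal M "class_ring S" by fact
  have I: "ideal_in S M" using M.is_ideal class_ring_ideal_iff[OF S] by simp
  define Q where "Q = {x + a * b | x b. x \<in> M \<and> b \<in> S}"
  have "ideal_in S Q" unfolding ideal_in_def
  proof (intro conjI ballI)
    show "Q \<subseteq> S" using a ideal_in_subset[OF I]
      by (auto simp: Q_def intro: ring_closed_add[OF S] ring_closed_mult[OF S])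
    show "0 \<in> Q" using I S by (auto simp: Q_def intro!: exI[of _ 0] intro: ideal_in_zero ring_closed_intros)
  next
    fix u v assume "u \<in> Q" "v \<in> Q"
    then obtain x b y c where "u = x + a * b" "v = y + a * c" "x \<in> M" "b \<in> S" "y \<in> M" "c \<in> S" by (auto simp: Q_def)
    then show "u + v \<in> Q" using I S unfolding Q_def
      by (intro CollectI exI[of _ "x + y"] exI[of _ "b + c"])
        (auto simp: algebra_simps intro: ring_closed_intros ideal_in_add)
  next
    fix r u assume "r \<in> S" "u \<in> Q"
    then obtain x b where "u = x + a * b" "x \<in> M" "b \<in> S" by (auto simp: Q_def)
    then show "r * u \<in> Q" using I S \<open>r \<in> S\<close> unfolding Q_def
      by (intro CollectI exI[of _ "r * x"] exI[of _ "r * b"])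
        (auto simp: algebra_simps intro: ring_closed_intros ideal_in_mult)
  qed
  then have "ideal Q (class_ring S)" using class_ring_ideal_iff[OF S] by simp
  moreover have "M \<subseteq> Q" using S by (force simp: Q_def intro: ring_closed_intros)
  moreover have "a \<in> Q" unfolding Q_def
    using S I by (intro CollectI exI[of _ 0] exI[of _ 1]) (auto intro: ideal_in_zero ring_closed_intros)
  ultimately have "Q = S" using M.I_maximal[of Q] \<open>ideal_in S Q\<close> a by (auto simp: ideal_in_def)
  then have "1 \<in> Q" using S by (simp add: ring_closed_one)
  then obtain x b where "1 = x + a * b" "x \<in> M" "b \<in> S" by (auto simp: Q_def)
  then have "a * b - 1 = - x" by (simp add: algebra_simps)
  then show ?thesis using ideal_in_uminus[OF S I \<open>x \<in> M\<close>] \<open>b \<in> S\<close> by metis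
qed

text \<open>Choosing again and again an element outside the ideal generated so far would turn an
  ideal without finite generating set into a chain that never becomes stationary.\<close>

lemma class_ring_noetherian:
  assumes S: "ring_closed S" and acc: "ascending_chain_condition S"
  shows "noetherian_ring (class_ring S)"
proof -
  interpret cring "class_ring S" using S by (rule class_ring_cring)
  show ?thesis
  proof (rule noetherian_ringI, rule ccontr)
    fix I assume I: "ideal I (class_ring S)" and no: "\<not> (\<exists>A\<subseteq>carrier (class_ring S). finite A \<and> I = Idl\<^bsub>class_ring S\<^esub> A)"
    let ?Idl = "genideal (class_ring S)"
    have IS: "I \<subseteq> S" using ideal.Icarr[OF I] by auto
    have ex: "\<exists>x. x \<in> I - ?Idl A" if "finite A" "A \<subseteq> I" for A
    proof -
      have "A \<subseteq> carrier (class_ring S)" using that(2) IS by simp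
      then have "I \<noteq> ?Idl A" using no that(1) by blast
      then show ?thesis using genideal_minimal[OF I that(2)] by blast
    qed
    define f where "f = rec_nat {} (\<lambda>_ A. insert (SOME x. x \<in> I - ?Idl A) A)"
    have f: "f 0 = {}" "f (Suc n) = insert (SOME x. x \<in> I - ?Idl (f n)) (f n)" for n by (simp_all add: f_def)
    have fin: "finite (f n) \<and> f n \<subseteq> I" for n
      by (induction n) (use someI_ex[OF ex] in \<open>auto simp: f\<close>)
    have fS: "f n \<subseteq> carrier (class_ring S)" for n using fin IS by auto
    have "mono (\<lambda>n. ?Idl (f n))"
      by (intro incseq_SucI subset_Idl_subset fS) (auto simp: f)
    moreover have "ideal_in S (?Idl (f n))" for n
      using genideal_ideal[OF fS] class_ring_ideal_iff[OF S] by simp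
    ultimately obtain N where N: "\<forall>n\<ge>N. ?Idl (f n) = ?Idl (f N)"
      using acc[unfolded ascending_chain_condition_def, rule_format, of "\<lambda>n. ?Idl (f n)"] by blast
    let ?x = "SOME x. x \<in> I - ?Idl (f N)"
    have "?x \<notin> ?Idl (f N)" using someI_ex[OF ex] fin by blast
    moreover have "?x \<in> ?Idl (f (Suc N))" using genideal_self[OF fS[of "Suc N"]] by (auto simp: f)
    ultimately show False using N[rule_format, of "Suc N"] by simp
  qed
qed

section \<open>Bases of polynomial rings\<close>

definition weight :: "('v \<Rightarrow> nat) \<Rightarrow> ('v \<Rightarrow>\<^sub>0 nat) \<Rightarrow> nat" where
  "weight w m = (\<Sum>v\<in>Poly_Mapping.keys m. Poly_Mapping.lookup m v * w v)"

lemma weight_superset: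
  "finite A \<Longrightarrow> Poly_Mapping.keys m \<subseteq> A \<Longrightarrow> weight w m = (\<Sum>v\<in>A. Poly_Mapping.lookup m v * w v)"
  unfolding weight_def by (rule sum.mono_neutral_left) (auto simp: in_keys_iff)

lemma weight_add [simp]: "weight w (m + n) = weight w m + weight w n"
proof -
  let ?A = "Poly_Mapping.keys m \<union> Poly_Mapping.keys n"
  have "Poly_Mapping.keys (m + n) \<subseteq> ?A" by (rule keys_add)
  then show ?thesis
    by (simp add: weight_superset[of ?A] lookup_add algebra_simps sum.distrib)
qed

lemma weight_zero [simp]: "weight w 0 = 0"
  by (simp add: weight_def)

lemma weight_single [simp]: "weight w (Poly_Mapping.single v k) = k * w v"
  by (simp add: weight_def)

abbreviation const :: "'k::zero \<Rightarrow> ('v, 'k) mpoly" where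
  "const c \<equiv> Poly_Mapping.single 0 c"

definition low :: "('v \<Rightarrow> nat) \<Rightarrow> nat \<Rightarrow> ('v, 'k::field) mpoly \<Rightarrow> bool" where
  "low w n p \<longleftrightarrow> (\<forall>k\<in>Poly_Mapping.keys p. weight w k < n)"

text \<open>A weighted degree replaces a monomial order: the leading monomial must be strictly
  heavier than all others. Ties never have to be broken, and leading monomials still multiply
  (\<open>leading_mult\<close>).\<close>

definition leading :: "('v \<Rightarrow> nat) \<Rightarrow> ('v, 'k::field) mpoly \<Rightarrow> ('v \<Rightarrow>\<^sub>0 nat) \<Rightarrow> bool" where
  "leading w p m \<longleftrightarrow> low w (weight w m) (p - Poly_Mapping.single m 1)"

lemma low_zero [simp]: "low w n 0"
  by (simp add: low_def)

lemma low_add: "low w n p \<Longrightarrow> low w n q \<Longrightarrow> low w n (p + q)"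
  unfolding low_def using keys_add[of p q] by blast

lemma low_uminus [simp]: "low w n (- p) \<longleftrightarrow> low w n p"
  unfolding low_def by (simp add: in_keys_iff)

lemma low_sum: "(\<And>i. i \<in> A \<Longrightarrow> low w n (f i)) \<Longrightarrow> low w n (sum f A)"
  by (induction A rule: infinite_finite_induct) (auto intro: low_add)

lemma low_mult_monom: "low w n p \<Longrightarrow> low w (weight w m + n) (Poly_Mapping.single m c * p)"
  unfolding low_def using keys_mult[of "Poly_Mapping.single m c" p]
  by (force split: if_splits)

lemma low_mult: "low w n p \<Longrightarrow> low w n' q \<Longrightarrow> low w (n + n') (p * q)"
  unfolding low_def using keys_mult[of p q] by (force intro: add_strict_mono)

lemma low_monom: "weight w m < n \<Longrightarrow> low w n (Poly_Mapping.single m c)"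
  by (auto simp: low_def split: if_splits)

lemma leading_mult:
  assumes "leading w p m" "leading w q n" shows "leading w (p * q) (m + n)"
proof -
  define p' where "p' = p - Poly_Mapping.single m 1"
  define q' where "q' = q - Poly_Mapping.single n 1"
  have low: "low w (weight w m) p'" "low w (weight w n) q'"
    using assms by (simp_all add: leading_def p'_def q'_def)
  have eq: "p * q - Poly_Mapping.single (m + n) 1 =
      Poly_Mapping.single m 1 * q' + (Poly_Mapping.single n 1 * p' + p' * q')"
    by (simp add: p'_def q'_def algebra_simps mult_single)
  show ?thesis unfolding leading_def eq
    using low_mult_monom[OF low(2), of m 1] low_mult_monom[OF low(1), of n 1] low_mult[OF low]
    by (auto intro!: low_add simp: add.commute)
qed

lemma leading_one: "leading w 1 0"
  by (simp add: leading_def)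

lemma leading_monom: "leading w (Poly_Mapping.single m 1) m"
  by (simp add: leading_def)

lemma leading_pvar: "leading w (pvar v) (Poly_Mapping.single v 1)"
  by (simp add: pvar_def leading_monom)

lemma leading_add_low: "leading w p m \<Longrightarrow> low w (weight w m) q \<Longrightarrow> leading w (p + q) m"
  unfolding leading_def using low_add[of w _ "p - Poly_Mapping.single m 1" q] by (simp add: algebra_simps)

lemma leading_prod:
  "(\<And>i. i \<in> A \<Longrightarrow> leading w (f i) (g i)) \<Longrightarrow> leading w (prod f A) (sum g A)"
  by (induction A rule: infinite_finite_induct) (auto intro: leading_one leading_mult)

lemma leading_power_pvar:
  assumes "leading w p (Poly_Mapping.single v j)"
  shows "leading w (p ^ n) (Poly_Mapping.single v (n * j))"
proof (induction n)
  case (Suc n)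
  then show ?case using leading_mult[OF assms Suc] by (simp add: single_add[symmetric])
qed (simp add: leading_one)

lemma low_const_mult: "low w n p \<Longrightarrow> low w n (const c * p)"
  using low_mult_monom[of w n p 0 c] by simp

definition mpolys :: "'v set \<Rightarrow> ('v, 'k::field) mpoly set" where
  "mpolys V = {p. \<forall>m\<in>Poly_Mapping.keys p. Poly_Mapping.keys m \<subseteq> V}"

lemma poly_ring_class_ring: "poly_ring V = class_ring (mpolys V)"
  by (simp add: poly_ring_def class_ring_def mpolys_def)

lemma single_in_mpolys: "Poly_Mapping.keys m \<subseteq> V \<Longrightarrow> Poly_Mapping.single m c \<in> mpolys V"
  by (auto simp: mpolys_def split: if_splits)

lemma const_in_mpolys [simp]: "const c \<in> mpolys V"
  by (simp add: single_in_mpolys)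

lemma pvar_in_mpolys: "v \<in> V \<Longrightarrow> pvar v \<in> mpolys V"
  by (simp add: pvar_def single_in_mpolys)

lemma ring_closed_mpolys: "ring_closed (mpolys V)"
  unfolding ring_closed_def
proof (intro conjI ballI)
  show "1 \<in> mpolys V" using const_in_mpolys[of 1 V] by simp
  fix p q :: "('a, 'b) mpoly" assume "p \<in> mpolys V" "q \<in> mpolys V"
  then have pq: "\<And>m. m \<in> Poly_Mapping.keys p \<Longrightarrow> Poly_Mapping.keys m \<subseteq> V"
    "\<And>m. m \<in> Poly_Mapping.keys q \<Longrightarrow> Poly_Mapping.keys m \<subseteq> V" by (auto simp: mpolys_def)
  have "Poly_Mapping.keys (p - q) \<subseteq> Poly_Mapping.keys p \<union> Poly_Mapping.keys q"
    by (auto simp: in_keys_iff lookup_minus)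
  then show "p - q \<in> mpolys V" unfolding mpolys_def using pq by blast
  show "p * q \<in> mpolys V" unfolding mpolys_def
  proof (intro CollectI ballI)
    fix m assume "m \<in> Poly_Mapping.keys (p * q)"
    then obtain a b where "m = a + b" "a \<in> Poly_Mapping.keys p" "b \<in> Poly_Mapping.keys q"
      using keys_mult[of p q] by blast
    then show "Poly_Mapping.keys m \<subseteq> V" using keys_add[of a b] pq by blast
  qed
qed

lemma mpoly_sum_monoms: "p = (\<Sum>m\<in>Poly_Mapping.keys p. Poly_Mapping.single m (Poly_Mapping.lookup p m))"
  by (rule poly_mapping_eqI) (auto simp: lookup_sum lookup_single when_def in_keys_iff sum.delta')

text \<open>The linear map sending the monomial m to \<open>b m\<close>, with \<open>p\<close> in
  the role of the coefficient vector. It serves both for expansions in a basis and for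
  substitutions.\<close>

definition combine :: "(('v \<Rightarrow>\<^sub>0 nat) \<Rightarrow> ('v, 'k) mpoly) \<Rightarrow> ('v, 'k::field) mpoly \<Rightarrow> ('v, 'k) mpoly" where
  "combine b p = (\<Sum>m\<in>Poly_Mapping.keys p. const (Poly_Mapping.lookup p m) * b m)"

lemma combine_superset:
  "finite A \<Longrightarrow> Poly_Mapping.keys p \<subseteq> A \<Longrightarrow> combine b p = (\<Sum>m\<in>A. const (Poly_Mapping.lookup p m) * b m)"
  unfolding combine_def by (rule sum.mono_neutral_left) (auto simp: in_keys_iff)

lemma combine_add: "combine b (p + q) = combine b p + combine b q"
proof -
  let ?A = "Poly_Mapping.keys p \<union> Poly_Mapping.keys q"
  have "Poly_Mapping.keys (p + q) \<subseteq> ?A" by (rule keys_add)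
  then show ?thesis
    by (simp add: combine_superset[of ?A] lookup_add single_add algebra_simps sum.distrib)
qed

lemma combine_zero [simp]: "combine b 0 = 0"
  by (simp add: combine_def)

lemma combine_single [simp]: "combine b (Poly_Mapping.single m c) = const c * b m"
  by (simp add: combine_def)

lemma combine_sum: "combine b (sum f A) = (\<Sum>i\<in>A. combine b (f i))"
  by (induction A rule: infinite_finite_induct) (auto simp: combine_add)

lemma combine_uminus: "combine b (- p) = - combine b p"
  using combine_add[of b p "- p"] by (simp add: eq_neg_iff_add_eq_0 add.commute)

lemma combine_diff: "combine b (p - q) = combine b p - combine b q"
  using combine_add[of b p "- q"] by (simp add: combine_uminus)

lemma combine_const_mult: "combine b (const c * p) = const c * combine b p"
proof -
  have "Poly_Mapping.lookup (const c * p) m = c * Poly_Mapping.lookup p m" for m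
    by (simp add: mult_map_scale_conv_mult[symmetric] Poly_Mapping.map.rep_eq when_def)
  moreover from this have "Poly_Mapping.keys (const c * p) \<subseteq> Poly_Mapping.keys p"
    by (auto simp: in_keys_iff)
  ultimately show ?thesis
    by (simp add: combine_superset[of "Poly_Mapping.keys p"] sum_distrib_left mult_single mult.assoc[symmetric])
qed

lemma combine_mult:
  assumes b: "\<And>m n. b (m + n) = b m * b n"
  shows "combine b (p * q) = combine b p * combine b q"
proof -
  have "combine b (Poly_Mapping.single m c * q) = const c * b m * combine b q" for m c
  proof -
    have "Poly_Mapping.single m c * q = (\<Sum>n\<in>Poly_Mapping.keys q. Poly_Mapping.single (m + n) (c * Poly_Mapping.lookup q n))"
      by (subst mpoly_sum_monoms[of q]) (simp add: sum_distrib_left mult_single)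
    then have "combine b (Poly_Mapping.single m c * q) =
        (\<Sum>n\<in>Poly_Mapping.keys q. const (c * Poly_Mapping.lookup q n) * (b m * b n))"
      by (simp add: combine_sum b)
    also have "\<dots> = const c * b m * combine b q"
      unfolding combine_def sum_distrib_left
      by (intro sum.cong refl) (simp add: mult_single[of 0 _ 0, simplified, symmetric] ac_simps)
    finally show ?thesis .
  qed
  note 1 = this
  have "combine b (p * q) = (\<Sum>m\<in>Poly_Mapping.keys p. combine b (Poly_Mapping.single m (Poly_Mapping.lookup p m) * q))"
    by (subst mpoly_sum_monoms[of p]) (simp add: sum_distrib_right combine_sum)
  then show ?thesis by (simp add: 1 combine_def[of b p] sum_distrib_right)
qed

lemma combine_in_mpolys:
  assumes "\<And>m. Poly_Mapping.keys m \<subseteq> V \<Longrightarrow> b m \<in> mpolys V" "p \<in> mpolys V"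
  shows "combine b p \<in> mpolys V"
  unfolding combine_def
  by (intro ring_closed_sum[OF ring_closed_mpolys] ring_closed_mult[OF ring_closed_mpolys] const_in_mpolys assms)
    (use assms in \<open>auto simp: mpolys_def\<close>)

text \<open>The matrix of \<open>b\<close> against the monomials is unitriangular with respect to
  weight, so \<open>b\<close> is a vector space basis of \<open>mpolys V\<close>: independence is
  \<open>combine_inj\<close>, spanning is \<open>combine_surj\<close>.\<close>

locale triangular_family =
  fixes w :: "'v \<Rightarrow> nat" and V :: "'v set" and b :: "('v \<Rightarrow>\<^sub>0 nat) \<Rightarrow> ('v, 'k::field) mpoly"
  assumes closed: "\<And>m. Poly_Mapping.keys m \<subseteq> V \<Longrightarrow> b m \<in> mpolys V"
    and lead: "\<And>m. Poly_Mapping.keys m \<subseteq> V \<Longrightarrow> leading w (b m) m"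
begin

text \<open>A heaviest monomial of \<open>p\<close> survives in \<open>combine b p\<close>: any
  other \<open>b n\<close> contributes n and monomials strictly lighter than n, hence not this
  one.\<close>

lemma combine_inj:
  assumes p: "p \<in> mpolys V" "combine b p = 0"
  shows "p = 0"
proof (rule ccontr)
  assume "p \<noteq> 0"
  then have ne: "weight w ` Poly_Mapping.keys p \<noteq> {}" by (simp add: keys_eq_empty)
  then obtain m where m: "m \<in> Poly_Mapping.keys p" "weight w m = Max (weight w ` Poly_Mapping.keys p)"
    using Max_in[OF finite_imageI[OF finite_keys] ne] by (metis imageE)
  have le: "weight w n \<le> weight w m" if "n \<in> Poly_Mapping.keys p" for n
    using m(2) that by simp
  have "Poly_Mapping.lookup (combine b p) m =
      (\<Sum>n\<in>Poly_Mapping.keys p. Poly_Mapping.lookup (const (Poly_Mapping.lookup p n) * b n) m)"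
    by (simp add: combine_def lookup_sum)
  also have "\<dots> = (\<Sum>n\<in>Poly_Mapping.keys p. if n = m then Poly_Mapping.lookup p m else 0)"
  proof (rule sum.cong[OF refl])
    fix n assume n: "n \<in> Poly_Mapping.keys p"
    have nV: "Poly_Mapping.keys n \<subseteq> V" using p n by (auto simp: mpolys_def)
    define l where "l = b n - Poly_Mapping.single n 1"
    have "low w (weight w n) l" using lead[OF nV] by (simp add: leading_def l_def)
    then have "m \<notin> Poly_Mapping.keys l" using le[OF n] by (auto simp: low_def)
    then have "Poly_Mapping.lookup (b n) m = (if n = m then 1 else 0)"
      by (auto simp: l_def in_keys_iff lookup_minus lookup_single when_def)
    then show "Poly_Mapping.lookup (const (Poly_Mapping.lookup p n) * b n) m = (if n = m then Poly_Mapping.lookup p m else 0)"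
      by (cases "n = m") (simp_all add: mult_map_scale_conv_mult[symmetric] Poly_Mapping.map.rep_eq when_def)
  qed
  also have "\<dots> = Poly_Mapping.lookup p m" using m by simp
  finally show False using p m by (simp add: in_keys_iff)
qed

text \<open>By induction on the weight, since \<open>b m\<close> differs from the monomial m by
  lighter monomials, which are combinations already.\<close>

lemma combine_surj:
  assumes "q \<in> mpolys V"
  shows "\<exists>p\<in>mpolys V. combine b p = q"
proof -
  note C = ring_closed_mpolys[of V]
  have mono: "\<exists>p\<in>mpolys V. combine b p = Poly_Mapping.single m c" if "Poly_Mapping.keys m \<subseteq> V" for m c
    using that
  proof (induction "weight w m" arbitrary: m c rule: less_induct)
    case less
    define l where "l = b m - Poly_Mapping.single m 1"
    have low: "low w (weight w m) l" using lead[OF less.prems] by (simp add: leading_def l_def)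
    have lV: "l \<in> mpolys V" unfolding l_def by (intro ring_closed_diff[OF C] closed single_in_mpolys less.prems)
    have "\<forall>k\<in>Poly_Mapping.keys l. \<exists>p\<in>mpolys V. combine b p = Poly_Mapping.single k (Poly_Mapping.lookup l k)"
      using less.hyps low lV by (auto simp: low_def mpolys_def)
    then obtain P where P: "\<And>k. k \<in> Poly_Mapping.keys l \<Longrightarrow> P k \<in> mpolys V"
      "\<And>k. k \<in> Poly_Mapping.keys l \<Longrightarrow> combine b (P k) = Poly_Mapping.single k (Poly_Mapping.lookup l k)" by metis
    define p where "p = Poly_Mapping.single m c - const c * (\<Sum>k\<in>Poly_Mapping.keys l. P k)"
    have "p \<in> mpolys V" unfolding p_def
      by (intro ring_closed_diff[OF C] ring_closed_mult[OF C] ring_closed_sum[OF C] P single_in_mpolys less.prems const_in_mpolys)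
    moreover have "combine b p = Poly_Mapping.single m c"
    proof -
      have "combine b (\<Sum>k\<in>Poly_Mapping.keys l. P k) = l"
        by (subst (3) mpoly_sum_monoms) (simp add: combine_sum P)
      then have "combine b p = const c * b m - const c * l"
        by (simp add: p_def combine_diff combine_const_mult)
      also have "\<dots> = Poly_Mapping.single m c" by (simp add: l_def algebra_simps mult_single)
      finally show ?thesis .
    qed
    ultimately show ?case by blast
  qed
  then have "\<forall>k\<in>Poly_Mapping.keys q. \<exists>p\<in>mpolys V. combine b p = Poly_Mapping.single k (Poly_Mapping.lookup q k)"
    using assms by (auto simp: mpolys_def)
  then obtain P where P: "\<And>k. k \<in> Poly_Mapping.keys q \<Longrightarrow> P k \<in> mpolys V"
    "\<And>k. k \<in> Poly_Mapping.keys q \<Longrightarrow> combine b (P k) = Poly_Mapping.single k (Poly_Mapping.lookup q k)" by metis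
  have "combine b (\<Sum>k\<in>Poly_Mapping.keys q. P k) = q"
    by (subst (3) mpoly_sum_monoms) (simp add: combine_sum P)
  moreover have "(\<Sum>k\<in>Poly_Mapping.keys q. P k) \<in> mpolys V" by (intro ring_closed_sum[OF C] P)
  ultimately show ?thesis by blast
qed

end

section \<open>Substitution homomorphisms\<close>

definition power_product :: "('v \<Rightarrow> ('v, 'k) mpoly) \<Rightarrow> ('v \<Rightarrow>\<^sub>0 nat) \<Rightarrow> ('v, 'k::field) mpoly" where
  "power_product \<sigma> m = (\<Prod>v\<in>Poly_Mapping.keys m. \<sigma> v ^ Poly_Mapping.lookup m v)"

lemma power_product_superset:
  "finite A \<Longrightarrow> Poly_Mapping.keys m \<subseteq> A \<Longrightarrow> power_product \<sigma> m = (\<Prod>v\<in>A. \<sigma> v ^ Poly_Mapping.lookup m v)"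
  unfolding power_product_def by (rule prod.mono_neutral_left) (auto simp: in_keys_iff)

lemma power_product_add: "power_product \<sigma> (m + n) = power_product \<sigma> m * power_product \<sigma> n"
proof -
  let ?A = "Poly_Mapping.keys m \<union> Poly_Mapping.keys n"
  have "Poly_Mapping.keys (m + n) \<subseteq> ?A" by (rule keys_add)
  then show ?thesis
    by (simp add: power_product_superset[of ?A] lookup_add power_add prod.distrib)
qed

text \<open>Substitution becomes a linear map given on monomials by a multiplicative family, whence
  its homomorphism laws.\<close>

lemma substitute_eq_combine: "substitute \<sigma> = combine (power_product \<sigma>)"
  by (rule ext) (simp add: substitute_def combine_def power_product_def)

lemma substitute_add: "substitute \<sigma> (p + q) = substitute \<sigma> p + substitute \<sigma> q"
  and substitute_mult: "substitute \<sigma> (p * q) = substitute \<sigma> p * substitute \<sigma> q"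
  and substitute_const: "substitute \<sigma> (const c) = const c"
  by (simp_all add: substitute_eq_combine combine_add combine_diff combine_mult power_product_add)
    (simp add: power_product_def)

lemma substitute_pvar: "substitute \<sigma> (pvar v) = \<sigma> v"
  by (simp add: substitute_eq_combine pvar_def power_product_def)

lemma substitute_one: "substitute \<sigma> 1 = 1"
  using substitute_const[of \<sigma> 1] by simp

lemma substitute_sum: "substitute \<sigma> (sum f A) = (\<Sum>i\<in>A. substitute \<sigma> (f i))"
  by (simp add: substitute_eq_combine combine_sum)

lemma substitute_power: "substitute \<sigma> (p ^ n) = substitute \<sigma> p ^ n"
  by (induction n) (auto simp: substitute_mult substitute_one)

lemma substitute_prod: "substitute \<sigma> (prod f A) = (\<Prod>i\<in>A. substitute \<sigma> (f i))"
  by (induction A rule: infinite_finite_induct) (auto simp: substitute_mult substitute_one)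

lemma combine_substitute: "substitute \<sigma> (combine b p) = combine (\<lambda>m. substitute \<sigma> (b m)) p"
  by (simp add: combine_def substitute_sum substitute_mult substitute_const)

section \<open>Edge ideals of whiskered clutters\<close>

definition squarefree_monom :: "'v set \<Rightarrow> ('v \<Rightarrow>\<^sub>0 nat)" where
  "squarefree_monom e = (\<Sum>v\<in>e. Poly_Mapping.single v 1)"

lemma lookup_squarefree_monom: "finite e \<Longrightarrow> Poly_Mapping.lookup (squarefree_monom e) v = (if v \<in> e then 1 else 0)"
  by (simp add: squarefree_monom_def lookup_sum lookup_single when_def sum.delta')

lemma keys_squarefree_monom: "finite e \<Longrightarrow> Poly_Mapping.keys (squarefree_monom e) = e"
  by (auto simp: in_keys_iff lookup_squarefree_monom split: if_splits)

lemma prod_pvar: "finite e \<Longrightarrow> (\<Prod>v\<in>e. pvar v) = Poly_Mapping.single (squarefree_monom e) 1"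
  by (induction e rule: finite_induct) (auto simp: squarefree_monom_def pvar_def mult_single add.commute)

lemma pvar_power: "pvar v ^ i = Poly_Mapping.single (Poly_Mapping.single v i) 1"
  by (induction i) (simp_all add: pvar_def mult_single flip: single_add)

lemma ring_closed_consts: "ring_closed (range const)"
  unfolding ring_closed_def
proof (intro conjI ballI)
  show "1 \<in> range const" by (metis rangeI single_one)
qed (auto simp: single_diff[symmetric] mult_single)

lemma poly_over_consts_mpolys:
  assumes "p \<in> poly_over (range const)" "x \<in> mpolys V" shows "poly p x \<in> mpolys V"
  unfolding poly_altdef
proof (intro ring_closed_intros ring_closed_mpolys)
  fix i show "poly.coeff p i \<in> mpolys V" using assms by (auto simp: poly_over_def dest: spec[of _ i])
qed (use assms in auto)

lemma substitute_poly:
  assumes "p \<in> poly_over (range const)"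
  shows "substitute \<sigma> (poly p x) = poly p (substitute \<sigma> x)"
proof -
  have "substitute \<sigma> (poly.coeff p i) = poly.coeff p i" for i
  proof -
    obtain c where "poly.coeff p i = const c" using assms by (auto simp: poly_over_def dest: spec[of _ i])
    then show ?thesis by (simp add: substitute_const)
  qed
  then show ?thesis by (simp add: poly_altdef substitute_sum substitute_mult substitute_power)
qed

lemma leading_poly_pvar:
  assumes p: "p \<in> poly_over (range const)" "lead_coeff p = 1" and w: "w v > 0"
  shows "leading w (poly p (pvar v)) (Poly_Mapping.single v (degree p))"
proof -
  have X: "leading w (pvar v ^ i) (Poly_Mapping.single v i)" for i
    using leading_power_pvar[OF leading_pvar, of w v i] by simp
  have "poly p (pvar v) = pvar v ^ degree p + (\<Sum>i<degree p. poly.coeff p i * pvar v ^ i)"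
    using p(2) by (simp add: poly_altdef lessThan_Suc_atMost[symmetric])
  moreover have "low w (weight w (Poly_Mapping.single v (degree p))) (\<Sum>i<degree p. poly.coeff p i * pvar v ^ i)"
  proof (rule low_sum)
    fix i assume i: "i \<in> {..<degree p}"
    obtain c where c: "poly.coeff p i = const c" using p(1) by (auto simp: poly_over_def dest: spec[of _ i])
    have "pvar v ^ i = (Poly_Mapping.single (Poly_Mapping.single v i) 1 :: ('a, 'b) mpoly)" by (rule pvar_power)
    then show "low w (weight w (Poly_Mapping.single v (degree p))) (poly.coeff p i * pvar v ^ i)"
      unfolding c using i w by (intro low_const_mult) (auto intro!: low_monom)
  qed
  ultimately show ?thesis using leading_add_low[OF X] by metis
qed

text \<open>\<open>r\<close> retracts \<open>X\<close> onto \<open>V\<close>; the sets \<open>fibre i\<close> are the additional edges.\<close>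

locale whiskered =
  fixes X V :: "'v set" and r :: "'v \<Rightarrow> 'v" and K :: "'k::field itself"
  assumes finite_X: "finite X" and V_subset: "V \<subseteq> X"
    and r_in: "\<And>v. v \<in> X \<Longrightarrow> r v \<in> V" and r_id: "\<And>v. v \<in> V \<Longrightarrow> r v = v"
begin

definition fibre :: "'v \<Rightarrow> 'v set" where
  "fibre i = {v \<in> X. r v = i}"

lemma fibre: "fibre i \<subseteq> X" "finite (fibre i)"
  using finite_X by (auto simp: fibre_def)

lemma self_in_fibre: "i \<in> V \<Longrightarrow> i \<in> fibre i"
  using V_subset r_id by (auto simp: fibre_def)

lemma fibre_card_pos: "i \<in> V \<Longrightarrow> card (fibre i) > 0"
  using self_in_fibre fibre(2) by (metis card_gt_0_iff empty_iff)

text \<open>In the coordinates \<open>v\<close> for \<open>v \<in> V\<close> and \<open>v - r v\<close> for \<open>v \<in> X - V\<close>, the generator of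
  \<open>fibre i\<close> is monic in \<open>i\<close>; \<open>\<phi>\<close> is the change of coordinates.\<close>

definition \<phi> :: "('v, 'k) mpoly \<Rightarrow> ('v, 'k) mpoly" where
  "\<phi> = substitute (\<lambda>v. if v \<in> X - V then pvar v - pvar (r v) else pvar v)"

text \<open>The preimage under \<open>\<phi>\<close> of the variable \<open>v\<close> in the fibre
  over \<open>i\<close> (\<open>phi_shift\<close>). For v \<noteq> i it contains the variable
  \<open>i\<close>, which is what makes the product over a fibre monic in \<open>i\<close>.\<close>

definition shift :: "'v \<Rightarrow> 'v \<Rightarrow> ('v, 'k) mpoly" where
  "shift i v = (if v = i then pvar v else pvar v + pvar i)"

lemma phi_shift: "i \<in> V \<Longrightarrow> v \<in> fibre i \<Longrightarrow> \<phi> (shift i v) = pvar v"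
  using V_subset r_id by (auto simp: \<phi>_def shift_def substitute_add substitute_pvar fibre_def)

lemma phi_pvar: "v \<in> X - V \<Longrightarrow> \<phi> (pvar v) = pvar v - pvar (r v)"
  "v \<in> V \<Longrightarrow> \<phi> (pvar v) = pvar v"
  by (auto simp: \<phi>_def substitute_pvar)

text \<open>New vertices weigh 2 and old ones 1, so that v dominates in v - r v. Hence the change of
  coordinates \<open>\<phi>\<close> is bijective on \<open>mpolys X\<close>.\<close>

lemma triangular_phi:
  "triangular_family (\<lambda>v. if v \<in> V then 1 else 2) X
     (power_product (\<lambda>v. if v \<in> X - V then pvar v - pvar (r v) else pvar v) :: _ \<Rightarrow> ('v, 'k) mpoly)"
  (is "triangular_family ?w X (power_product ?\<sigma>)")
proof
  fix m :: "'v \<Rightarrow>\<^sub>0 nat" assume m: "Poly_Mapping.keys m \<subseteq> X"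
  show "power_product ?\<sigma> m \<in> mpolys X" unfolding power_product_def
  proof (intro ring_closed_intros ring_closed_mpolys)
    fix v assume "v \<in> Poly_Mapping.keys m"
    then have v: "v \<in> X" using m by auto
    show "?\<sigma> v \<in> mpolys X"
      using v V_subset r_in by (auto intro!: ring_closed_diff[OF ring_closed_mpolys] pvar_in_mpolys)
  qed
  have lead1: "leading ?w (?\<sigma> v) (Poly_Mapping.single v 1)" if "v \<in> X" for v
  proof (cases "v \<in> V")
    case False
    then have "low ?w (weight ?w (Poly_Mapping.single v 1)) (- (pvar (r v) :: ('v, 'k) mpoly))"
      using r_in[OF that] unfolding low_uminus pvar_def by (intro low_monom) simp
    from leading_add_low[OF leading_pvar this] show ?thesis using False that by simp
  qed (simp add: leading_pvar[unfolded One_nat_def])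
  have "leading ?w (?\<sigma> v ^ Poly_Mapping.lookup m v) (Poly_Mapping.single v (Poly_Mapping.lookup m v))"
    if "v \<in> Poly_Mapping.keys m" for v
  proof -
    have "v \<in> X" using m that by auto
    from leading_power_pvar[OF lead1[OF this], of "Poly_Mapping.lookup m v"] show ?thesis
      by (simp only: mult_1_right)
  qed
  then have "leading ?w (power_product ?\<sigma> m) (\<Sum>v\<in>Poly_Mapping.keys m. Poly_Mapping.single v (Poly_Mapping.lookup m v))"
    unfolding power_product_def by (rule leading_prod)
  moreover have "(\<Sum>v\<in>Poly_Mapping.keys m. Poly_Mapping.single v (Poly_Mapping.lookup m v)) = m"
    by (rule poly_mapping_eqI) (auto simp: lookup_sum lookup_single when_def in_keys_iff sum.delta')
  ultimately show "leading ?w (power_product ?\<sigma> m) m" by simp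
qed

text \<open>The weighting opposite to that of \<open>triangular_phi\<close>: in \<open>shift\<close>
  the old vertex \<open>i\<close> has to dominate the sum of v and i, so here the old vertices are
  the heavy ones.\<close>

definition w :: "'v \<Rightarrow> nat" where
  "w v = (if v \<in> V then 2 else 1)"

lemma leading_shift: "i \<in> V \<Longrightarrow> v \<in> fibre i \<Longrightarrow> leading w (shift i v) (Poly_Mapping.single i 1)"
proof -
  assume i: "i \<in> V" "v \<in> fibre i"
  show ?thesis
  proof (cases "v = i")
    case False
    then have "v \<notin> V" using i r_id by (auto simp: fibre_def)
    then have "low w (weight w (Poly_Mapping.single i 1)) (pvar v :: ('v, 'k) mpoly)"
      using i by (auto simp: w_def pvar_def intro!: low_monom)
    from leading_add_low[OF leading_pvar this] show ?thesis using False by (simp add: shift_def add.commute)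
  qed (simp add: shift_def leading_pvar[unfolded One_nat_def])
qed

lemma leading_prod_shift:
  assumes i: "i \<in> V" and A: "A \<subseteq> fibre i"
  shows "leading w (\<Prod>v\<in>A. shift i v) (Poly_Mapping.single i (card A))"
proof -
  have "leading w (\<Prod>v\<in>A. shift i v) (\<Sum>v\<in>A. Poly_Mapping.single i 1)"
    using assms by (intro leading_prod leading_shift) auto
  moreover have "(\<Sum>v\<in>A. Poly_Mapping.single i (1::nat)) = Poly_Mapping.single i (card A)"
    by (induction A rule: infinite_finite_induct) (auto simp: single_add[symmetric])
  ultimately show ?thesis by simp
qed

text \<open>The polynomial \<open>p\<close> is \<open>u v k\<close> written in the new coordinates.\<close>

definition adapted :: "('v \<Rightarrow> nat \<Rightarrow> ('v, 'k) mpoly) \<Rightarrow> bool" where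
  "adapted u \<longleftrightarrow> (\<forall>v\<in>X. \<forall>k. \<exists>p\<in>mpolys X. u v k = \<phi> p \<and> leading w p (Poly_Mapping.single v k))"

definition product :: "('v \<Rightarrow> nat \<Rightarrow> ('v, 'k) mpoly) \<Rightarrow> ('v \<Rightarrow>\<^sub>0 nat) \<Rightarrow> ('v, 'k) mpoly" where
  "product u m = (\<Prod>v\<in>X. u v (Poly_Mapping.lookup m v))"

lemma phi_closed: "p \<in> mpolys X \<Longrightarrow> \<phi> p \<in> mpolys X"
  unfolding \<phi>_def substitute_eq_combine
  using triangular_family.closed[OF triangular_phi] by (intro combine_in_mpolys)

text \<open>Two triangular systems are composed. In the new coordinates the products are triangular
  for \<open>w\<close>, and \<open>\<phi>\<close> is a linear bijection that carries them to
  \<open>product u\<close>.\<close>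

lemma adapted_basis:
  assumes "adapted u"
  shows "q \<in> mpolys X \<Longrightarrow> \<exists>p\<in>mpolys X. combine (product u) p = q"
    and "p \<in> mpolys X \<Longrightarrow> combine (product u) p = 0 \<Longrightarrow> p = 0"
    and "product u m \<in> mpolys X"
    and "p \<in> mpolys X \<Longrightarrow> combine (product u) p \<in> mpolys X"
proof -
  obtain P where P: "\<And>v k. v \<in> X \<Longrightarrow> P v k \<in> mpolys X" "\<And>v k. v \<in> X \<Longrightarrow> u v k = \<phi> (P v k)"
    "\<And>v k. v \<in> X \<Longrightarrow> leading w (P v k) (Poly_Mapping.single v k)"
    using assms unfolding adapted_def by metis
  define b where "b m = (\<Prod>v\<in>X. P v (Poly_Mapping.lookup m v))" for m
  have product_b: "product u = (\<lambda>m. \<phi> (b m))"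
    by (rule ext) (auto simp: product_def b_def \<phi>_def substitute_prod P(2) intro!: prod.cong)
  then have comb: "combine (product u) p = \<phi> (combine b p)" for p
    by (simp add: \<phi>_def combine_substitute)
  have b_in: "b m \<in> mpolys X" for m
    unfolding b_def by (intro ring_closed_prod[OF ring_closed_mpolys] P)
  then show "product u m \<in> mpolys X" unfolding product_b by (intro phi_closed)
  interpret B: triangular_family w X b
  proof
    fix m :: "'v \<Rightarrow>\<^sub>0 nat" assume m: "Poly_Mapping.keys m \<subseteq> X"
    show "b m \<in> mpolys X" by (rule b_in)
    have "leading w (b m) (\<Sum>v\<in>X. Poly_Mapping.single v (Poly_Mapping.lookup m v))"
      unfolding b_def by (intro leading_prod P)
    moreover have "(\<Sum>v\<in>X. Poly_Mapping.single v (Poly_Mapping.lookup m v)) = m"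
      using finite_X m by (intro poly_mapping_eqI) (auto simp: lookup_sum lookup_single when_def in_keys_iff sum.delta')
    ultimately show "leading w (b m) m" by simp
  qed
  interpret F: triangular_family "\<lambda>v. if v \<in> V then 1 else 2" X
    "power_product (\<lambda>v. if v \<in> X - V then pvar v - pvar (r v) else pvar v) :: _ \<Rightarrow> ('v, 'k) mpoly"
    by (rule triangular_phi)
  have comb_b: "combine b p \<in> mpolys X" if "p \<in> mpolys X" for p
    using that b_in by (intro combine_in_mpolys)
  show "p \<in> mpolys X \<Longrightarrow> combine (product u) p \<in> mpolys X"
    unfolding comb by (intro phi_closed comb_b)
  show "\<exists>p\<in>mpolys X. combine (product u) p = q" if q: "q \<in> mpolys X"
  proof -
    obtain q' where q': "q' \<in> mpolys X" "\<phi> q' = q"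
      using F.combine_surj[OF q] unfolding \<phi>_def substitute_eq_combine by blast
    then show ?thesis using B.combine_surj[OF q'(1)] unfolding comb by blast
  qed
  show "p = 0" if p: "p \<in> mpolys X" "combine (product u) p = 0"
  proof (rule B.combine_inj[OF p(1)], rule F.combine_inj[OF comb_b[OF p(1)]])
    show "combine (power_product (\<lambda>v. if v \<in> X - V then pvar v - pvar (r v) else pvar v)) (combine b p) = 0"
      using p(2) unfolding comb \<phi>_def substitute_eq_combine .
  qed
qed

end

lemma single_mult_sum: "Poly_Mapping.single n 1 * (p :: ('v, 'k::field) mpoly) =
    (\<Sum>m\<in>Poly_Mapping.keys p. Poly_Mapping.single (n + m) (Poly_Mapping.lookup p m))"
proof -
  have "Poly_Mapping.single n 1 * p = Poly_Mapping.single n 1 *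
      (\<Sum>m\<in>Poly_Mapping.keys p. Poly_Mapping.single m (Poly_Mapping.lookup p m))"
    by (subst mpoly_sum_monoms[symmetric]) simp
  then show ?thesis by (simp add: sum_distrib_left mult_single)
qed

text \<open>Multiplying a coefficient vector by a monomial translates the index of the basis; this
  is how multiplication by a generator is read on coordinates.\<close>

lemma combine_shift:
  "combine b (Poly_Mapping.single n 1 * p) = combine (\<lambda>m. b (n + m)) p"
  unfolding single_mult_sum by (simp add: combine_sum combine_def[of _ p])

lemma keys_single_mult:
  "Poly_Mapping.keys (Poly_Mapping.single n 1 * p :: ('v, 'k::field) mpoly) = (+) n ` Poly_Mapping.keys p"
proof -
  have "Poly_Mapping.lookup (Poly_Mapping.single n 1 * p) (n + m) = Poly_Mapping.lookup p m" for m
    unfolding single_mult_sum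
    by (auto simp: lookup_sum lookup_single when_def in_keys_iff)
  then have "(+) n ` Poly_Mapping.keys p \<subseteq> Poly_Mapping.keys (Poly_Mapping.single n 1 * p)"
    by (auto simp: in_keys_iff)
  moreover have "Poly_Mapping.keys (Poly_Mapping.single n 1 * p) \<subseteq> (+) n ` Poly_Mapping.keys p"
    using keys_mult[of "Poly_Mapping.single n 1" p] by auto
  ultimately show ?thesis by blast
qed

lemma (in ring) genideal_union_genideal:
  assumes "A \<subseteq> carrier R" "B \<subseteq> carrier R" shows "Idl (Idl A \<union> B) = Idl (A \<union> B)"
proof
  have AB: "A \<union> B \<subseteq> carrier R" using assms by auto
  have I: "ideal (Idl (A \<union> B)) R" by (rule genideal_ideal[OF AB])
  have "Idl A \<subseteq> Idl (A \<union> B)" by (rule subset_Idl_subset[OF AB]) auto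
  then show "Idl (Idl A \<union> B) \<subseteq> Idl (A \<union> B)"
    using genideal_self[OF AB] by (intro genideal_minimal[OF I]) auto
  have "Idl A \<subseteq> carrier R" using ideal.Icarr[OF genideal_ideal[OF assms(1)]] by auto
  then show "Idl (A \<union> B) \<subseteq> Idl (Idl A \<union> B)"
    using assms genideal_self[OF assms(1)] by (intro subset_Idl_subset) auto
qed

text \<open>The \<open>f v\<close> will come from the Nullstellensatz for one maximal ideal; the
  basis built here depends on them and hence on that ideal.\<close>

locale whiskered_system = whiskered X V r K
  for X V :: "'v set" and r :: "'v \<Rightarrow> 'v" and K :: "'k::field itself" +
  fixes E :: "'v set set" and f :: "'v \<Rightarrow> ('v, 'k) mpoly poly"
  assumes E: "E \<subseteq> Pow V"
    and f: "\<And>v. v \<in> X - V \<Longrightarrow> f v \<in> poly_over (range const)"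
      "\<And>v. v \<in> X - V \<Longrightarrow> lead_coeff (f v) = 1" "\<And>v. v \<in> X - V \<Longrightarrow> degree (f v) > 0"
begin

definition coord :: "'v \<Rightarrow> ('v, 'k) mpoly" where
  "coord v = (if v \<in> V then pvar v else pvar v - pvar (r v))"

text \<open>For v in \<open>V\<close> this is the monomial of the additional edge at v; for a new
  vertex it is the member of the regular sequence belonging to v. \<open>gen_coord\<close> is the
  same element in the new coordinates, with leading exponent \<open>dg v\<close> in v.\<close>

definition gen :: "'v \<Rightarrow> ('v, 'k) mpoly" where
  "gen v = (if v \<in> V then (\<Prod>x\<in>fibre v. pvar x) else poly (f v) (coord v))"

definition gen_coord :: "'v \<Rightarrow> ('v, 'k) mpoly" where
  "gen_coord v = (if v \<in> V then (\<Prod>x\<in>fibre v. shift v x) else poly (f v) (pvar v))"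

definition dg :: "'v \<Rightarrow> nat" where
  "dg v = (if v \<in> V then card (fibre v) else degree (f v))"

lemma dg_pos: "v \<in> X \<Longrightarrow> dg v > 0"
  using f fibre_card_pos by (simp add: dg_def)

lemma shift_in: "v \<in> V \<Longrightarrow> x \<in> fibre v \<Longrightarrow> shift v x \<in> mpolys X"
  using V_subset fibre(1)[of v]
  by (auto simp: shift_def intro!: ring_closed_add[OF ring_closed_mpolys] pvar_in_mpolys)

lemma gen_coord:
  assumes v: "v \<in> X"
  shows "gen_coord v \<in> mpolys X" "\<phi> (gen_coord v) = gen v" "leading w (gen_coord v) (Poly_Mapping.single v (dg v))"
proof -
  show "gen_coord v \<in> mpolys X"
    unfolding gen_coord_def using v f(1)
    by (auto intro!: ring_closed_prod[OF ring_closed_mpolys] shift_in poly_over_consts_mpolys pvar_in_mpolys)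
  show "\<phi> (gen_coord v) = gen v"
  proof (cases "v \<in> V")
    case True
    then have "\<phi> (gen_coord v) = (\<Prod>x\<in>fibre v. \<phi> (shift v x))" by (simp add: gen_coord_def \<phi>_def substitute_prod)
    also have "\<dots> = (\<Prod>x\<in>fibre v. pvar x)" using True by (intro prod.cong refl phi_shift)
    finally show ?thesis using True by (simp add: gen_def)
  next
    case False
    then have "\<phi> (gen_coord v) = poly (f v) (\<phi> (pvar v))"
      using f(1) v by (simp add: gen_coord_def \<phi>_def substitute_poly)
    then show ?thesis using False v by (simp add: phi_pvar gen_def coord_def)
  qed
  show "leading w (gen_coord v) (Poly_Mapping.single v (dg v))"
  proof (cases "v \<in> V")
    case True
    then show ?thesis using leading_prod_shift[OF True order.refl] by (simp add: gen_coord_def dg_def)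
  next
    case False
    then show ?thesis using leading_poly_pvar[of "f v" w v] f v by (simp add: gen_coord_def dg_def w_def)
  qed
qed

lemma phi_coord: "v \<in> X \<Longrightarrow> \<phi> (pvar v) = coord v"
  by (simp add: coord_def phi_pvar)

lemma phi_mult: "\<phi> (p * q) = \<phi> p * \<phi> q" and phi_power: "\<phi> (p ^ n) = \<phi> p ^ n"
  and phi_prod: "\<phi> (prod g A) = (\<Prod>i\<in>A. \<phi> (g i))"
  by (simp_all add: \<phi>_def substitute_mult substitute_power substitute_prod)

text \<open>Expansion in base \<open>gen v\<close>: the exponent is divided by \<open>dg v\<close>,
  the quotient becoming an exponent of \<open>gen v\<close> and the remainder one of
  \<open>coord v\<close>. Multiplication by \<open>gen v\<close> is then exactly a shift of the
  exponent by \<open>dg v\<close>.\<close>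

definition u :: "'v \<Rightarrow> nat \<Rightarrow> ('v, 'k) mpoly" where
  "u v k = coord v ^ (k mod dg v) * gen v ^ (k div dg v)"

text \<open>For \<open>v \<in> V\<close>, this is \<open>u v (k + 1)\<close> divided by the variable \<open>v\<close>.\<close>

definition u_quot :: "'v \<Rightarrow> nat \<Rightarrow> ('v, 'k) mpoly" where
  "u_quot v k =
     (if Suc k mod dg v = 0 then (\<Prod>x\<in>fibre v - {v}. pvar x) * gen v ^ (Suc k div dg v - 1)
      else pvar v ^ (Suc k mod dg v - 1) * gen v ^ (Suc k div dg v))"

lemma adapted_aux:
  assumes v: "v \<in> X"
  shows "leading w (pvar v ^ j * gen_coord v ^ i) (Poly_Mapping.single v (j + i * dg v))"
    and "pvar v ^ j * gen_coord v ^ i \<in> mpolys X"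
proof -
  have "leading w (pvar v ^ j) (Poly_Mapping.single v j)"
    using leading_power_pvar[OF leading_pvar, of w v j] by simp
  from leading_mult[OF this leading_power_pvar[OF gen_coord(3)[OF v], of i]]
  show "leading w (pvar v ^ j * gen_coord v ^ i) (Poly_Mapping.single v (j + i * dg v))"
    by (simp add: single_add)
  show "pvar v ^ j * gen_coord v ^ i \<in> mpolys X"
    by (intro ring_closed_mult ring_closed_power ring_closed_mpolys pvar_in_mpolys gen_coord v)
qed

lemma u_adapted_at:
  assumes v: "v \<in> X"
  shows "\<exists>p\<in>mpolys X. u v k = \<phi> p \<and> leading w p (Poly_Mapping.single v k)"
proof (intro bexI conjI)
  let ?p = "pvar v ^ (k mod dg v) * gen_coord v ^ (k div dg v)"
  show "u v k = \<phi> ?p" using v by (simp add: u_def phi_mult phi_power phi_coord gen_coord)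
  show "leading w ?p (Poly_Mapping.single v k)" using adapted_aux(1)[OF v, of "k mod dg v" "k div dg v"] by simp
  show "?p \<in> mpolys X" by (rule adapted_aux(2)[OF v])
qed

lemma u_quot_adapted_at:
  assumes v: "v \<in> V"
  shows "\<exists>p\<in>mpolys X. u_quot v k = \<phi> p \<and> leading w p (Poly_Mapping.single v k)"
proof (cases "Suc k mod dg v = 0")
  case True
  have vX: "v \<in> X" using v V_subset by auto
  define q where "q = Suc k div dg v - 1"
  obtain t where t: "Suc k = dg v * t" using True by (metis mod_eq_0_iff_dvd dvdE)
  then have k: "Suc k = (q + 1) * dg v" using dg_pos[OF vX] by (cases t) (simp_all add: q_def)
  let ?p = "(\<Prod>x\<in>fibre v - {v}. shift v x) * gen_coord v ^ q"
  show ?thesis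
  proof (intro bexI conjI)
    have "\<phi> (\<Prod>x\<in>fibre v - {v}. shift v x) = (\<Prod>x\<in>fibre v - {v}. pvar x)"
      unfolding phi_prod using v by (intro prod.cong refl phi_shift) auto
    then show "u_quot v k = \<phi> ?p"
      using True vX by (simp add: u_quot_def phi_mult phi_power gen_coord q_def)
    have "leading w (\<Prod>x\<in>fibre v - {v}. shift v x) (Poly_Mapping.single v (dg v - 1))"
      using leading_prod_shift[OF v, of "fibre v - {v}"] v self_in_fibre[OF v] by (simp add: dg_def)
    from leading_mult[OF this leading_power_pvar[OF gen_coord(3)[OF vX], of q]]
    have "leading w ?p (Poly_Mapping.single v (dg v - 1 + q * dg v))" by (simp add: single_add)
    moreover have "dg v - 1 + q * dg v = k" using k dg_pos[OF vX] by simp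
    ultimately show "leading w ?p (Poly_Mapping.single v k)" by simp
    show "?p \<in> mpolys X"
      by (intro ring_closed_mult ring_closed_prod ring_closed_power ring_closed_mpolys gen_coord vX shift_in v) auto
  qed
next
  case False
  have vX: "v \<in> X" using v V_subset by auto
  let ?p = "pvar v ^ (Suc k mod dg v - 1) * gen_coord v ^ (Suc k div dg v)"
  show ?thesis
  proof (intro bexI conjI)
    show "u_quot v k = \<phi> ?p" using v vX False
      by (simp add: u_quot_def phi_mult phi_power phi_pvar gen_coord)
    have "(Suc k mod dg v - 1) + (Suc k div dg v) * dg v = k"
      using False div_mult_mod_eq[of "Suc k" "dg v"] by linarith
    then show "leading w ?p (Poly_Mapping.single v k)"
      using adapted_aux(1)[OF vX, of "Suc k mod dg v - 1" "Suc k div dg v"] by simp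
    show "?p \<in> mpolys X" by (rule adapted_aux(2)[OF vX])
  qed
qed

lemma adapted_u: "adapted u"
  using u_adapted_at by (simp add: adapted_def)

lemma adapted_u_quot: "e \<subseteq> V \<Longrightarrow> adapted (\<lambda>v. if v \<in> e then u_quot v else u v)"
  using u_adapted_at u_quot_adapted_at by (auto simp: adapted_def)

lemma u_add_dg: "v \<in> X \<Longrightarrow> u v (dg v + k) = gen v * u v k"
  using dg_pos[of v] by (simp add: u_def ac_simps)

lemma pvar_u_quot: assumes v: "v \<in> V" shows "pvar v * u_quot v k = u v (Suc k)"
proof (cases "Suc k mod dg v = 0")
  case True
  have "Suc k div dg v \<noteq> 0" using True by (metis div_mult_mod_eq add_0_right mult_0 nat.distinct(2))
  then have "gen v ^ (Suc k div dg v) = gen v * gen v ^ (Suc k div dg v - 1)"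
    by (metis power_minus_mult mult.commute not_gr_zero)
  moreover have "gen v = pvar v * (\<Prod>x\<in>fibre v - {v}. pvar x)"
    using v self_in_fibre fibre by (simp add: gen_def prod.remove)
  ultimately show ?thesis using True by (simp add: u_quot_def u_def ac_simps)
next
  case False
  then have "pvar v * pvar v ^ (Suc k mod dg v - 1) = (pvar v ^ (Suc k mod dg v) :: ('v, 'k) mpoly)"
    by (metis power_minus_mult mult.commute not_gr_zero)
  then show ?thesis using False v by (simp add: u_quot_def u_def coord_def flip: mult.assoc)
qed

lemma gen_product:
  assumes v: "v \<in> X"
  shows "gen v * product u m = product u (Poly_Mapping.single v (dg v) + m)"
proof -
  have "product u (Poly_Mapping.single v (dg v) + m) =
      (\<Prod>x\<in>X. (if x = v then gen v else 1) * u x (Poly_Mapping.lookup m x))"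
    unfolding product_def using u_add_dg[OF v]
    by (intro prod.cong refl) (auto simp: lookup_add lookup_single when_def)
  also have "\<dots> = gen v * product u m"
    using v finite_X by (simp add: prod.distrib product_def)
  finally show ?thesis ..
qed

text \<open>A variable v does not in general shift the system \<open>u\<close>: multiplying the
  largest remainder v^(dg v - 1) by v gives v^(dg v) and not the fibre monomial
  \<open>gen v\<close>. The cofactors \<open>u_quot\<close> on e are made so that one factor v leads
  from index k in \<open>u_quot\<close> to \<open>Suc k\<close> in \<open>u\<close>; as they are
  adapted too, every polynomial can be expanded in them.\<close>

lemma edge_product:
  assumes e: "e \<subseteq> V"
  shows "(\<Prod>v\<in>e. pvar v) * product (\<lambda>v. if v \<in> e then u_quot v else u v) m =
    product u (squarefree_monom e + m)"
proof -
  have fin: "finite e" using e V_subset finite_X by (meson finite_subset)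
  have "product u (squarefree_monom e + m) =
      (\<Prod>x\<in>X. (if x \<in> e then pvar x else 1) *
         (if x \<in> e then u_quot x else u x) (Poly_Mapping.lookup m x))"
    unfolding product_def using pvar_u_quot e
    by (intro prod.cong refl) (auto simp: lookup_add lookup_squarefree_monom[OF fin])
  also have "\<dots> = (\<Prod>x\<in>X. if x \<in> e then pvar x else 1) * product (\<lambda>v. if v \<in> e then u_quot v else u v) m"
    by (simp add: prod.distrib product_def)
  also have "(\<Prod>x\<in>X. if x \<in> e then pvar x else 1) = (\<Prod>v\<in>e. pvar v)"
    using e V_subset finite_X by (subst prod.inter_restrict[symmetric]) (auto intro!: prod.cong)
  finally show ?thesis ..
qed

text \<open>The indices whose basis element factors through an edge monomial or through
  \<open>gen v\<close> with v in \<open>W\<close> (\<open>basis_factor\<close>). Taking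
  \<open>V\<close> for \<open>W\<close> gives the edge ideal, and each further vertex adds one
  member of the regular sequence.\<close>

definition ideal_monoms :: "'v set \<Rightarrow> ('v \<Rightarrow>\<^sub>0 nat) set" where
  "ideal_monoms W = {m. Poly_Mapping.keys m \<subseteq> X \<and>
     ((\<exists>e\<in>E. \<forall>i\<in>e. Poly_Mapping.lookup m i \<ge> 1) \<or> (\<exists>v\<in>W. Poly_Mapping.lookup m v \<ge> dg v))}"

definition basis_span :: "'v set \<Rightarrow> ('v, 'k) mpoly set" where
  "basis_span W = combine (product u) ` {p \<in> mpolys X. Poly_Mapping.keys p \<subseteq> ideal_monoms W}"

lemma basis_spanI: "p \<in> mpolys X \<Longrightarrow> Poly_Mapping.keys p \<subseteq> ideal_monoms W \<Longrightarrow> combine (product u) p \<in> basis_span W"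
  by (auto simp: basis_span_def)

lemma basis_span_subset: "basis_span W \<subseteq> mpolys X"
  using adapted_basis(4)[OF adapted_u] by (auto simp: basis_span_def)

lemma basis_span_add: assumes "x \<in> basis_span W" "y \<in> basis_span W" shows "x + y \<in> basis_span W"
proof -
  obtain p q where *: "x = combine (product u) p" "p \<in> mpolys X" "Poly_Mapping.keys p \<subseteq> ideal_monoms W"
    "y = combine (product u) q" "q \<in> mpolys X" "Poly_Mapping.keys q \<subseteq> ideal_monoms W"
    using assms by (auto simp: basis_span_def)
  then have "combine (product u) (p + q) \<in> basis_span W"
    using keys_add[of p q] by (intro basis_spanI ring_closed_add[OF ring_closed_mpolys]) auto
  then show ?thesis using * by (simp add: combine_add)
qed

lemma basis_span_zero: "0 \<in> basis_span W"
  using basis_spanI[OF ring_closed_zero[OF ring_closed_mpolys], of W] by simp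

lemma basis_span_sum: "(\<And>i. i \<in> A \<Longrightarrow> g i \<in> basis_span W) \<Longrightarrow> sum g A \<in> basis_span W"
  by (induction A rule: infinite_finite_induct) (auto intro: basis_span_add basis_span_zero)

lemma keys_single_mult_in:
  assumes "p \<in> mpolys X" "Poly_Mapping.keys n \<subseteq> X"
    "\<And>m. Poly_Mapping.keys m \<subseteq> X \<Longrightarrow> n + m \<in> ideal_monoms W"
  shows "Poly_Mapping.keys (Poly_Mapping.single n 1 * p) \<subseteq> ideal_monoms W"
    "Poly_Mapping.single n 1 * p \<in> mpolys X"
  unfolding keys_single_mult using assms
  by (auto simp: mpolys_def intro: ring_closed_mult[OF ring_closed_mpolys] single_in_mpolys)
    (use assms in \<open>auto simp: keys_single_mult mpolys_def dest!: subsetD[OF keys_add]\<close>)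

lemma gen_mult_in_span:
  assumes v: "v \<in> W" "W \<subseteq> X" and s: "s \<in> mpolys X"
  shows "gen v * s \<in> basis_span W"
proof -
  have vX: "v \<in> X" using v by auto
  obtain p where p: "p \<in> mpolys X" "combine (product u) p = s" using adapted_basis(1)[OF adapted_u s] by auto
  let ?n = "Poly_Mapping.single v (dg v)"
  have "gen v * s = combine (product u) (Poly_Mapping.single ?n 1 * p)"
    unfolding combine_shift p(2)[symmetric]
    by (simp add: combine_def sum_distrib_left gen_product[OF vX, symmetric] mult.left_commute)
  moreover have "?n + m \<in> ideal_monoms W" if m: "Poly_Mapping.keys m \<subseteq> X" for m
  proof -
    have "Poly_Mapping.keys (?n + m) \<subseteq> {v} \<union> Poly_Mapping.keys m"
      using keys_add[of ?n m] by (auto split: if_splits)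
    then have "Poly_Mapping.keys (?n + m) \<subseteq> X" using m vX by blast
    moreover have "dg v \<le> Poly_Mapping.lookup (?n + m) v" by (simp add: lookup_add)
    ultimately show ?thesis using v(1) unfolding ideal_monoms_def by blast
  qed
  ultimately show ?thesis
    using keys_single_mult_in[OF p(1), of ?n W] vX by (simp add: basis_spanI)
qed

lemma edge_mult_in_span:
  assumes e: "e \<in> E" and s: "s \<in> mpolys X"
  shows "(\<Prod>v\<in>e. pvar v) * s \<in> basis_span W"
proof -
  have eV: "e \<subseteq> V" using e E by auto
  have fin: "finite e" using eV V_subset finite_X by (meson finite_subset)
  let ?u = "\<lambda>v. if v \<in> e then u_quot v else u v"
  \<comment> \<open>\<open>s\<close> is expanded in the basis with \<open>u_quot\<close> on e;
    multiplication by the edge monomial turns this into an expansion in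
    \<open>product u\<close>.\<close>
  obtain p where p: "p \<in> mpolys X" "combine (product ?u) p = s"
    using adapted_basis(1)[OF adapted_u_quot[OF eV] s] by auto
  let ?n = "squarefree_monom e"
  have "(\<Prod>v\<in>e. pvar v) * s = combine (product u) (Poly_Mapping.single ?n 1 * p)"
    unfolding combine_shift p(2)[symmetric]
    by (simp add: combine_def sum_distrib_left edge_product[OF eV, symmetric] mult.left_commute)
  moreover have "?n + m \<in> ideal_monoms W" if m: "Poly_Mapping.keys m \<subseteq> X" for m
  proof -
    have "Poly_Mapping.keys (?n + m) \<subseteq> X"
      using keys_add[of ?n m] m eV V_subset keys_squarefree_monom[OF fin] by blast
    moreover have "\<forall>i\<in>e. 1 \<le> Poly_Mapping.lookup (?n + m) i"
      by (simp add: lookup_add lookup_squarefree_monom[OF fin])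
    ultimately show ?thesis using e unfolding ideal_monoms_def by blast
  qed
  ultimately show ?thesis
    using keys_single_mult_in[OF p(1), of ?n W] eV V_subset fin by (simp add: basis_spanI keys_squarefree_monom)
qed

lemma basis_factor:
  assumes W: "W \<subseteq> X" and m: "m \<in> ideal_monoms W"
  obtains e s where "e \<in> E" "s \<in> mpolys X" "product u m = (\<Prod>v\<in>e. pvar v) * s"
  | v s where "v \<in> W" "s \<in> mpolys X" "product u m = gen v * s"
proof -
  from m consider e where "e \<in> E" "\<forall>i\<in>e. Poly_Mapping.lookup m i \<ge> 1"
    | v where "v \<in> W" "Poly_Mapping.lookup m v \<ge> dg v" by (auto simp: ideal_monoms_def)
  then show thesis
  proof cases
    case 1
    have eV: "e \<subseteq> V" using 1 E by auto
    have fin: "finite e" using eV V_subset finite_X by (meson finite_subset)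
    have "squarefree_monom e + (m - squarefree_monom e) = m"
      using 1 fin by (intro poly_mapping_eqI) (auto simp: lookup_add lookup_minus lookup_squarefree_monom)
    then have "product u m = (\<Prod>v\<in>e. pvar v) *
        product (\<lambda>v. if v \<in> e then u_quot v else u v) (m - squarefree_monom e)"
      using edge_product[OF eV] by metis
    then show ?thesis using that(1)[OF 1(1)] adapted_basis(3)[OF adapted_u_quot[OF eV]] by blast
  next
    case 2
    have vX: "v \<in> X" using 2 W by auto
    have "Poly_Mapping.single v (dg v) + (m - Poly_Mapping.single v (dg v)) = m"
      using 2 by (intro poly_mapping_eqI) (auto simp: lookup_add lookup_minus lookup_single when_def)
    then have "product u m = gen v * product u (m - Poly_Mapping.single v (dg v))"
      using gen_product[OF vX] by metis
    then show ?thesis using that(2)[OF 2(1)] adapted_basis(3)[OF adapted_u] by blast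
  qed
qed

lemma basis_span_ideal:
  assumes W: "W \<subseteq> X" shows "ideal_in (mpolys X) (basis_span W)"
  unfolding ideal_in_def
proof (intro conjI ballI basis_span_subset basis_span_zero basis_span_add)
  fix a x :: "('v, 'k) mpoly" assume a: "a \<in> mpolys X" and "x \<in> basis_span W"
  then obtain p where p: "x = combine (product u) p" "Poly_Mapping.keys p \<subseteq> ideal_monoms W"
    by (auto simp: basis_span_def)
  have "a * (const (Poly_Mapping.lookup p m) * product u m) \<in> basis_span W" if m: "m \<in> Poly_Mapping.keys p" for m
  proof -
    let ?c = "a * const (Poly_Mapping.lookup p m)"
    have c: "?c * s \<in> mpolys X" if "s \<in> mpolys X" for s
      using a that by (intro ring_closed_mult[OF ring_closed_mpolys]) auto
    have "m \<in> ideal_monoms W" using p m by auto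
    from W this show ?thesis
    proof (cases rule: basis_factor)
      case (1 e s)
      then have "a * (const (Poly_Mapping.lookup p m) * product u m) = (\<Prod>v\<in>e. pvar v) * (?c * s)" by (simp add: ac_simps)
      then show ?thesis using edge_mult_in_span[OF 1(1) c[OF 1(2)]] by simp
    next
      case (2 v s)
      then have "a * (const (Poly_Mapping.lookup p m) * product u m) = gen v * (?c * s)" by (simp add: ac_simps)
      then show ?thesis using gen_mult_in_span[OF 2(1) W c[OF 2(2)]] by simp
    qed
  qed
  then show "a * x \<in> basis_span W"
    unfolding p(1) combine_def sum_distrib_left by (rule basis_span_sum)
qed

lemma gen_in: "v \<in> X \<Longrightarrow> gen v \<in> mpolys X"
  using gen_coord phi_closed by metis

lemma edge_in: "e \<in> E \<Longrightarrow> (\<Prod>v\<in>e. pvar v) \<in> mpolys X"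
  using E V_subset by (intro ring_closed_prod[OF ring_closed_mpolys] pvar_in_mpolys) auto

text \<open>The point of the adapted basis: for every \<open>W\<close> the ideal is spanned by a
  subset of one and the same vector space basis, so membership is decided on indices.\<close>

lemma genideal_eq_span:
  assumes W: "W \<subseteq> X"
  shows "Idl\<^bsub>poly_ring X\<^esub> (edge_generators E \<union> gen ` W) = basis_span W"
proof
  interpret cring "class_ring (mpolys X)" by (rule class_ring_cring[OF ring_closed_mpolys])
  let ?G = "edge_generators E \<union> gen ` W"
  have G: "?G \<subseteq> carrier (class_ring (mpolys X))" using gen_in edge_in W by (auto simp: edge_generators_def)
  have one: "1 \<in> mpolys X" by (rule ring_closed_one[OF ring_closed_mpolys])
  have "?G \<subseteq> basis_span W"
    using gen_mult_in_span[OF _ W one] edge_mult_in_span[OF _ one] by (auto simp: edge_generators_def)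
  then show "Idl\<^bsub>poly_ring X\<^esub> ?G \<subseteq> basis_span W"
    unfolding poly_ring_class_ring
    using basis_span_ideal[OF W] class_ring_ideal_iff[OF ring_closed_mpolys] by (intro genideal_minimal) auto
  let ?I = "Idl\<^bsub>class_ring (mpolys X)\<^esub> ?G"
  have I: "ideal_in (mpolys X) ?I"
    using genideal_ideal[OF G] class_ring_ideal_iff[OF ring_closed_mpolys] by auto
  have "product u m \<in> ?I" if "m \<in> ideal_monoms W" for m
    using W that
  proof (cases rule: basis_factor)
    case (1 e s)
    then show ?thesis using ideal_in_mult_right[OF I 1(2)] genideal_self[OF G] by (auto simp: edge_generators_def)
  next
    case (2 v s)
    then show ?thesis using ideal_in_mult_right[OF I 2(2)] genideal_self[OF G] by auto
  qed
  then have "combine (product u) p \<in> ?I" if "Poly_Mapping.keys p \<subseteq> ideal_monoms W" for p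
    unfolding combine_def using that by (intro ideal_in_sum[OF I] ideal_in_mult[OF I]) auto
  then show "basis_span W \<subseteq> Idl\<^bsub>poly_ring X\<^esub> ?G" by (auto simp: basis_span_def poly_ring_class_ring)
qed

text \<open>Multiplication by \<open>gen y\<close> shifts the adapted basis, and the shift reflects membership.\<close>

lemma gen_regular:
  assumes W: "W \<subseteq> X" and y: "y \<in> X - V" "y \<notin> W" and a: "a \<in> mpolys X" "gen y * a \<in> basis_span W"
  shows "a \<in> basis_span W"
proof -
  have yX: "y \<in> X" using y by auto
  obtain p where p: "p \<in> mpolys X" "combine (product u) p = a" using adapted_basis(1)[OF adapted_u a(1)] by auto
  let ?n = "Poly_Mapping.single y (dg y)"
  have "gen y * a = combine (product u) (Poly_Mapping.single ?n 1 * p)"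
    unfolding combine_shift p(2)[symmetric]
    by (simp add: combine_def sum_distrib_left gen_product[OF yX, symmetric] mult.left_commute)
  moreover obtain q where q: "gen y * a = combine (product u) q" "q \<in> mpolys X" "Poly_Mapping.keys q \<subseteq> ideal_monoms W"
    using a(2) by (auto simp: basis_span_def)
  ultimately have "combine (product u) (Poly_Mapping.single ?n 1 * p - q) = 0" by (simp add: combine_diff)
  moreover have "Poly_Mapping.single ?n 1 * p - q \<in> mpolys X"
    using p q yX by (intro ring_closed_diff[OF ring_closed_mpolys] ring_closed_mult[OF ring_closed_mpolys] single_in_mpolys) auto
  ultimately have "Poly_Mapping.single ?n 1 * p - q = 0" by (metis adapted_basis(2)[OF adapted_u])
  then have "Poly_Mapping.single ?n 1 * p = q" by simp
  then have keys: "?n + m \<in> ideal_monoms W" if "m \<in> Poly_Mapping.keys p" for m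
    using q(3) that keys_single_mult[of ?n p] by auto
  have "m \<in> ideal_monoms W" if m: "m \<in> Poly_Mapping.keys p" for m
  proof -
    \<comment> \<open>The shift changes the exponent of y alone, and y is neither in an edge of
      \<open>E\<close> nor in \<open>W\<close>; so whichever condition holds after the shift held
      before it.\<close>
    have look: "Poly_Mapping.lookup (?n + m) v = Poly_Mapping.lookup m v" if "v \<noteq> y" for v
      using that by (simp add: lookup_add lookup_single when_def)
    have mX: "Poly_Mapping.keys m \<subseteq> X" using m p(1) by (auto simp: mpolys_def)
    from keys[OF m] consider e where "e \<in> E" "\<forall>i\<in>e. Poly_Mapping.lookup (?n + m) i \<ge> 1"
      | v where "v \<in> W" "Poly_Mapping.lookup (?n + m) v \<ge> dg v" by (auto simp: ideal_monoms_def)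
    then show ?thesis
    proof cases
      case 1
      then have "\<forall>i\<in>e. Poly_Mapping.lookup m i \<ge> 1" using look y E by (metis Diff_iff PowD subsetD)
      then show ?thesis using 1 mX by (auto simp: ideal_monoms_def)
    next
      case 2
      then have "v \<noteq> y" using y by auto
      then have "dg v \<le> Poly_Mapping.lookup m v" using 2 look[of v] by simp
      then show ?thesis using 2(1) mX unfolding ideal_monoms_def by blast
    qed
  qed
  then show ?thesis using p basis_spanI[of p W] by auto
qed

lemma edge_generators_fibres: "edge_generators (E \<union> fibre ` V) = edge_generators E \<union> gen ` V"
  by (auto simp: edge_generators_def gen_def)

text \<open>The fibre monomials are \<open>gen v\<close> for v in \<open>V\<close>, so the edge
  ideal together with the first i elements is the span belonging to \<open>V\<close> and the first i
  new vertices.\<close>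

lemma colon_edge_ideal:
  assumes ys: "distinct ys" "set ys = X - V" and i: "i < length ys" and a: "a \<in> mpolys X"
    and *: "gen (ys ! i) * a \<in> Idl\<^bsub>poly_ring X\<^esub> (edge_ideal X (E \<union> fibre ` V) \<union> set (take i (map gen ys)))"
  shows "a \<in> Idl\<^bsub>poly_ring X\<^esub> (edge_ideal X (E \<union> fibre ` V) \<union> set (take i (map gen ys)))"
proof -
  interpret cring "class_ring (mpolys X)" by (rule class_ring_cring[OF ring_closed_mpolys])
  define W where "W = V \<union> set (take i ys)"
  have W: "W \<subseteq> X" using ys V_subset set_take_subset[of i ys] by (auto simp: W_def)
  have "ys ! i \<notin> set (take i ys)" using ys(1) i by (auto simp: in_set_conv_nth nth_eq_iff_index_eq)
  moreover have yi: "ys ! i \<in> X - V" using ys i nth_mem by blast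
  ultimately have yW: "ys ! i \<notin> W" by (auto simp: W_def)
  have "Idl\<^bsub>class_ring (mpolys X)\<^esub> (Idl\<^bsub>class_ring (mpolys X)\<^esub> (edge_generators E \<union> gen ` V) \<union> gen ` set (take i ys))
      = Idl\<^bsub>class_ring (mpolys X)\<^esub> (edge_generators E \<union> gen ` V \<union> gen ` set (take i ys))"
    using gen_in edge_in W by (intro genideal_union_genideal) (auto simp: edge_generators_def W_def)
  then have "Idl\<^bsub>poly_ring X\<^esub> (edge_ideal X (E \<union> fibre ` V) \<union> set (take i (map gen ys))) = basis_span W"
    unfolding edge_ideal_def edge_generators_fibres genideal_eq_span[OF W, symmetric]
    by (simp add: poly_ring_class_ring take_map W_def image_Un Un_assoc)
  then show ?thesis using gen_regular[OF W yi yW a] * by simp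
qed

end

section \<open>Dimension and depth\<close>

lemma acc_consts: "ascending_chain_condition (range const :: ('v, 'k::field) mpoly set)"
  unfolding ascending_chain_condition_def
proof (intro allI impI)
  fix I :: "nat \<Rightarrow> ('v, 'k) mpoly set"
  assume I: "\<forall>n. ideal_in (range const) (I n)" and "mono I"
  have all: "I n = range const" if x: "x \<in> I n" "x \<noteq> 0" for n x
  proof -
    have In: "ideal_in (range const) (I n)" using I by simp
    obtain c where c: "x = const c" using ideal_in_subset[OF In x(1)] by auto
    have "const d \<in> I n" for d
    proof -
      have "const (d / c) * x \<in> I n" using ideal_in_mult[OF In _ x(1)] by simp
      moreover have "c \<noteq> 0" using x c by auto
      then have "const (d / c) * x = const d" using c by (simp add: mult_single)
      ultimately show ?thesis by simp
    qed
    then show ?thesis using In by (auto simp: ideal_in_def)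
  qed
  show "\<exists>N. \<forall>n\<ge>N. I n = I N"
  proof (cases "\<exists>N. \<exists>x\<in>I N. x \<noteq> 0")
    case True
    then obtain N x where x: "x \<in> I N" "x \<noteq> 0" by auto
    have "I n = I N" if "n \<ge> N" for n
      using all[OF x] all[of x n] x monoD[OF \<open>mono I\<close> that] by auto
    then show ?thesis by blast
  next
    case False
    then have "I n = {0}" for n using I by (auto simp: ideal_in_def)
    then show ?thesis by simp
  qed
qed

lemma mpolys_empty: "mpolys {} = (range const :: ('v, 'k::field) mpoly set)"
proof
  show "mpolys {} \<subseteq> (range const :: ('v, 'k) mpoly set)"
  proof
    fix p :: "('v, 'k) mpoly" assume "p \<in> mpolys {}"
    then have "Poly_Mapping.keys p \<subseteq> {0}" by (auto simp: mpolys_def)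
    then have "p = const (Poly_Mapping.lookup p 0)"
      by (intro poly_mapping_eqI) (auto simp: lookup_single when_def in_keys_iff)
    then show "p \<in> range const" by blast
  qed
qed auto

lemma mpolys_mono: "V \<subseteq> W \<Longrightarrow> mpolys V \<subseteq> mpolys W"
  by (auto simp: mpolys_def)

lemma mpolys_least:
  assumes R: "ring_closed R" "range const \<subseteq> R" "\<And>v. v \<in> V \<Longrightarrow> pvar v \<in> R"
  shows "mpolys V \<subseteq> (R :: ('v, 'k::field) mpoly set)"
proof
  fix p :: "('v, 'k) mpoly" assume p: "p \<in> mpolys V"
  have "Poly_Mapping.single m c \<in> R" if m: "Poly_Mapping.keys m \<subseteq> V" for m c
  proof -
    have "power_product pvar m \<in> R"
      unfolding power_product_def using m R by (intro ring_closed_prod ring_closed_power) auto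
    moreover have "power_product pvar m = (Poly_Mapping.single m 1 :: ('v, 'k) mpoly)"
    proof -
      have "(\<Prod>v\<in>A. Poly_Mapping.single (Poly_Mapping.single v (Poly_Mapping.lookup m v)) 1) =
        (Poly_Mapping.single (\<Sum>v\<in>A. Poly_Mapping.single v (Poly_Mapping.lookup m v)) 1 :: ('v, 'k) mpoly)" for A
        by (induction A rule: infinite_finite_induct) (auto simp: mult_single)
      moreover have "(\<Sum>v\<in>Poly_Mapping.keys m. Poly_Mapping.single v (Poly_Mapping.lookup m v)) = m"
        by (rule poly_mapping_eqI) (auto simp: lookup_sum lookup_single when_def in_keys_iff sum.delta')
      ultimately show ?thesis unfolding power_product_def pvar_power by metis
    qed
    moreover have "const c \<in> R" using R(2) by auto
    ultimately have "const c * Poly_Mapping.single m 1 \<in> R" using ring_closed_mult[OF R(1)] by metis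
    then show ?thesis by (simp add: mult_single)
  qed
  then have "(\<Sum>m\<in>Poly_Mapping.keys p. Poly_Mapping.single m (Poly_Mapping.lookup p m)) \<in> R"
    using p by (intro ring_closed_sum[OF R(1)]) (auto simp: mpolys_def)
  then show "p \<in> R" by (subst mpoly_sum_monoms)
qed

lemma mpolys_insert: "mpolys (insert v V) = adjoin (mpolys V) (pvar v)"
proof
  show "mpolys (insert v V) \<subseteq> adjoin (mpolys V) (pvar v)"
    using adjoin_base[OF ring_closed_mpolys, of V "pvar v"] adjoin_gen[OF ring_closed_mpolys, of "pvar v" V]
    by (intro mpolys_least ring_closed_adjoin ring_closed_mpolys) (auto intro: pvar_in_mpolys)
  show "adjoin (mpolys V) (pvar v) \<subseteq> mpolys (insert v V)"
    by (intro adjoin_least ring_closed_mpolys mpolys_mono pvar_in_mpolys) auto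
qed

theorem acc_mpolys: "finite V \<Longrightarrow> ascending_chain_condition (mpolys V :: ('v, 'k::field) mpoly set)"
proof (induction V rule: finite_induct)
  case empty
  then show ?case by (simp add: mpolys_empty acc_consts)
next
  case (insert v V)
  then show ?case by (simp add: mpolys_insert hilbert_basis ring_closed_mpolys)
qed

text \<open>Zariski's lemma through Goldman domains. Modulo \<open>M\<close> the polynomial ring is
  a field, so 1 is a Goldman element; \<open>goldman_descends\<close> peels off one variable after
  the other until the ring generated by \<open>\<theta>\<close> is reached, where
  \<open>goldman_imp_algebraic\<close> applies over the constants. The field need not be
  algebraically closed, so f may have any positive degree.\<close>

theorem nullstellensatz:
  fixes M :: "('v, 'k::field) mpoly set"
  assumes V: "finite V" and M: "prime_in (mpolys V) M"
    and max: "\<And>a. a \<in> mpolys V - M \<Longrightarrow> \<exists>b\<in>mpolys V. a * b - 1 \<in> M"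
    and \<theta>: "\<theta> \<in> mpolys V"
  obtains f where "f \<in> poly_over (range const)" "lead_coeff f = 1" "degree f > 0" "poly f \<theta> \<in> M"
proof -
  note S = ring_closed_mpolys[of V] and MI = prime_in_ideal[OF M]
  have const_sub: "range const \<subseteq> (mpolys V :: ('v, 'k) mpoly set)" by auto
  \<comment> \<open>\<open>\<theta>\<close> is adjoined before all variables although it already
    lies in the polynomial ring: it has to generate the last ring left once the variables are
    removed.\<close>
  define A where "A vs = foldr (\<lambda>v R. adjoin R (pvar v)) vs (adjoin (range const) \<theta>)" for vs :: "'v list"
  have A_simps: "A [] = adjoin (range const) \<theta>" "A (v # vs) = adjoin (A vs) (pvar v)" for v vs
    by (simp_all add: A_def)
  have A: "ring_closed (A vs) \<and> A vs \<subseteq> mpolys V \<and> range const \<subseteq> A vs \<and> pvar ` set vs \<subseteq> A vs"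
    if "set vs \<subseteq> V" for vs
    using that
  proof (induction vs)
    case Nil
    show ?case using adjoin_base[OF ring_closed_consts, of \<theta>] adjoin_least[OF ring_closed_mpolys const_sub \<theta>]
        ring_closed_adjoin[OF ring_closed_consts, of \<theta>] by (simp add: A_simps)
  next
    case (Cons v vs)
    then have IH: "ring_closed (A vs)" "A vs \<subseteq> mpolys V" "range const \<subseteq> A vs" "pvar ` set vs \<subseteq> A vs" by auto
    have "pvar v \<in> (mpolys V :: ('v, 'k) mpoly set)" using Cons.prems by (intro pvar_in_mpolys) simp
    from adjoin_least[OF ring_closed_mpolys IH(2) this] have "adjoin (A vs) (pvar v) \<subseteq> mpolys V" .
    moreover have "pvar ` set (v # vs) \<subseteq> adjoin (A vs) (pvar v)"
      using adjoin_base[OF IH(1), of "pvar v"] adjoin_gen[OF IH(1), of "pvar v"] IH(4) by simp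
    moreover have "range const \<subseteq> adjoin (A vs) (pvar v)"
      using IH(3) adjoin_base[OF IH(1), of "pvar v"] by (rule order_trans)
    ultimately show ?case unfolding A_simps using ring_closed_adjoin[OF IH(1), of "pvar v"] by blast
  qed
  have descend: "goldman (A vs) M \<Longrightarrow> goldman (A []) M" if "set vs \<subseteq> V" for vs
    using that
  proof (induction vs)
    case (Cons v vs)
    have "goldman (adjoin (A vs) (pvar v)) M" using Cons.prems(1) by (simp add: A_simps)
    then have "goldman (A vs) M"
      using A[of vs] Cons.prems by (intro goldman_descends[OF S M, of "A vs" "pvar v"]) (auto intro: pvar_in_mpolys)
    then show ?case using Cons by simp
  qed
  obtain vs where vs: "set vs = V" using finite_list[OF V] by auto
  have "mpolys V \<subseteq> A vs" using A[of vs] vs by (intro mpolys_least) auto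
  then have "A vs = mpolys V" using A[of vs] vs by auto
  moreover have "goldman (mpolys V) M"
    unfolding goldman_def using max prime_in_one[OF M] ring_closed_one[OF S]
    by (intro bexI[of _ 1]) auto
  ultimately have "goldman (adjoin (range const) \<theta>) M" using descend[of vs] vs by (simp add: A_simps)
  note alg = goldman_imp_algebraic[OF S M ring_closed_consts const_sub \<theta> this]
  obtain q where q: "q \<in> poly_over (range const)" "poly q \<theta> \<in> M" "lead_coeff q \<notin> M" "degree q > 0"
    by (rule minimal_relation[OF S M ring_closed_consts const_sub \<theta> alg])
  obtain c where c: "lead_coeff q = const c" using q(1) by (auto simp: poly_over_def dest: spec[of _ "degree q"])
  have "c \<noteq> 0" using q(3) c ideal_in_zero[OF MI] by auto
  define f where "f = Polynomial.smult (const (1 / c)) q"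
  have coeff_f: "poly.coeff f (degree q) = 1" using c \<open>c \<noteq> 0\<close> by (simp add: f_def mult_single)
  have deg: "degree f = degree q"
  proof (rule antisym)
    show "degree f \<le> degree q" unfolding f_def by (rule degree_smult_le)
    show "degree q \<le> degree f" using coeff_f by (intro le_degree) simp
  qed
  show thesis
  proof (rule that)
    show "f \<in> poly_over (range const)" unfolding f_def using q(1) by (intro poly_over_smult ring_closed_consts) auto
    show "lead_coeff f = 1" using coeff_f deg by simp
    show "degree f > 0" using deg q by simp
    show "poly f \<theta> \<in> M" unfolding f_def poly_smult using q(2) by (intro ideal_in_mult[OF MI]) auto
  qed
qed

section \<open>Exponent bounds and algebraic independence along chains of primes\<close>

definition exponents_le :: "nat \<Rightarrow> ('v, 'k::field) mpoly \<Rightarrow> bool" where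
  "exponents_le L p \<longleftrightarrow> (\<forall>m\<in>Poly_Mapping.keys p. \<forall>v. Poly_Mapping.lookup m v \<le> L)"

lemma exponents_le_mult: "exponents_le L p \<Longrightarrow> exponents_le L' q \<Longrightarrow> exponents_le (L + L') (p * q)"
  unfolding exponents_le_def
proof (intro ballI allI)
  fix m v assume *: "\<forall>m\<in>Poly_Mapping.keys p. \<forall>v. Poly_Mapping.lookup m v \<le> L"
    "\<forall>m\<in>Poly_Mapping.keys q. \<forall>v. Poly_Mapping.lookup m v \<le> L'" and "m \<in> Poly_Mapping.keys (p * q)"
  then obtain a b where "m = a + b" "a \<in> Poly_Mapping.keys p" "b \<in> Poly_Mapping.keys q"
    using keys_mult[of p q] by blast
  then show "Poly_Mapping.lookup m v \<le> L + L'" using * by (simp add: lookup_add add_mono)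
qed

lemma exponents_le_one: "exponents_le 0 1"
  by (simp add: exponents_le_def)

lemma exponents_le_power: "exponents_le L p \<Longrightarrow> exponents_le (n * L) (p ^ n)"
  by (induction n) (auto intro: exponents_le_mult exponents_le_one)

lemma exponents_le_prod: "(\<And>i. i \<in> A \<Longrightarrow> exponents_le (L i) (f i)) \<Longrightarrow> exponents_le (sum L A) (prod f A)"
  by (induction A rule: infinite_finite_induct) (auto intro: exponents_le_mult exponents_le_one)

lemma exponents_le_mono: "exponents_le L p \<Longrightarrow> L \<le> L' \<Longrightarrow> exponents_le L' p"
  unfolding exponents_le_def by (meson order.trans)

lemma exponents_le_ex: "\<exists>L. exponents_le L p"
proof -
  let ?T = "insert 0 (\<Union>m\<in>Poly_Mapping.keys p. Poly_Mapping.lookup m ` Poly_Mapping.keys m)"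
  have fin: "finite ?T" by auto
  have "exponents_le (Max ?T) p" unfolding exponents_le_def
  proof (intro ballI allI)
    fix m v assume m: "m \<in> Poly_Mapping.keys p"
    have "Poly_Mapping.lookup m v \<in> ?T"
    proof (cases "v \<in> Poly_Mapping.keys m")
      case False
      then show ?thesis by (simp add: in_keys_iff)
    qed (use m in blast)
    then show "Poly_Mapping.lookup m v \<le> Max ?T" using fin by (intro Max_ge)
  qed
  then show ?thesis by blast
qed

lemma card_bounded_monoms:
  assumes A: "finite (A :: 'v set)"
  shows "finite {m. Poly_Mapping.keys m \<subseteq> A \<and> (\<forall>v. Poly_Mapping.lookup m v \<le> L)}"
    and "card {m. Poly_Mapping.keys m \<subseteq> A \<and> (\<forall>v. Poly_Mapping.lookup m v \<le> L)} \<le> (L + 1) ^ card A"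
proof -
  let ?B = "{m. Poly_Mapping.keys m \<subseteq> A \<and> (\<forall>v. Poly_Mapping.lookup m v \<le> L)}"
  let ?h = "\<lambda>m. restrict (Poly_Mapping.lookup m) A"
  have inj: "inj_on ?h ?B"
  proof (rule inj_onI)
    fix m n assume *: "m \<in> ?B" "n \<in> ?B" "?h m = ?h n"
    show "m = n"
    proof (rule poly_mapping_eqI)
      fix v show "Poly_Mapping.lookup m v = Poly_Mapping.lookup n v"
      proof (cases "v \<in> A")
        case True
        then show ?thesis using fun_cong[OF *(3), of v] by simp
      next
        case False
        then have "v \<notin> Poly_Mapping.keys m" "v \<notin> Poly_Mapping.keys n" using * by auto
        then show ?thesis by (simp add: in_keys_iff)
      qed
    qed
  qed
  have img: "?h ` ?B \<subseteq> A \<rightarrow>\<^sub>E {..L}" by auto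
  have fin: "finite (A \<rightarrow>\<^sub>E {..L})" using A by (intro finite_PiE) auto
  show "finite ?B" using inj_on_finite[OF inj img fin] .
  have "card ?B \<le> card (A \<rightarrow>\<^sub>E {..L})" using card_inj_on_le[OF inj img fin] .
  also have "\<dots> = (L + 1) ^ card A" using A by (simp add: card_PiE)
  finally show "card ?B \<le> (L + 1) ^ card A" .
qed

text \<open>Elements chosen from the successive gaps of a chain of primes are algebraically
  independent modulo the smallest prime. In a relation lying in \<open>p j\<close>, the lowest power
  of \<open>a j\<close> is cancelled, as \<open>a j\<close> is outside \<open>p j\<close>; passing
  to \<open>p (Suc j)\<close>, which contains \<open>a j\<close>, leaves a nonempty relation without
  \<open>a j\<close>. At the end a nonzero constant would lie in \<open>p r\<close>.\<close>

lemma transcendental_chain: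
  fixes a :: "nat \<Rightarrow> ('v, 'k::field) mpoly" and c :: "(nat \<Rightarrow> nat) \<Rightarrow> 'k"
  assumes p: "\<And>i. i \<le> r \<Longrightarrow> prime_in (mpolys X) (p i)" "\<And>i. i < r \<Longrightarrow> p i \<subseteq> p (Suc i)"
    and a: "\<And>i. i < r \<Longrightarrow> a i \<in> p (Suc i) - p i"
    and F: "finite F" "F \<subseteq> extensional {..<r}" "\<exists>\<epsilon>\<in>F. c \<epsilon> \<noteq> 0"
  shows "(\<Sum>\<epsilon>\<in>F. const (c \<epsilon>) * (\<Prod>i<r. a i ^ \<epsilon> i)) \<notin> p 0"
proof
  assume rel: "(\<Sum>\<epsilon>\<in>F. const (c \<epsilon>) * (\<Prod>i<r. a i ^ \<epsilon> i)) \<in> p 0"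
  note S = ring_closed_mpolys[of X]
  have aS: "a i \<in> mpolys X" if "i < r" for i
    using a[OF that] p(1)[of "Suc i"] that by (auto intro: ideal_in_subset[OF prime_in_ideal])
  \<comment> \<open>\<open>G\<close> collects the surviving exponent vectors; they agree in the
    positions below j, whose factors have been cancelled.\<close>
  have "\<exists>G\<subseteq>F. G \<noteq> {} \<and> (\<forall>\<epsilon>\<in>G. c \<epsilon> \<noteq> 0) \<and> (\<forall>\<epsilon>\<in>G. \<forall>\<delta>\<in>G. \<forall>i<j. \<epsilon> i = \<delta> i) \<and>
      (\<Sum>\<epsilon>\<in>G. const (c \<epsilon>) * (\<Prod>i\<in>{j..<r}. a i ^ \<epsilon> i)) \<in> p j" if "j \<le> r" for j
    using that
  proof (induction j)
    case 0
    have "(\<Sum>\<epsilon>\<in>F. const (c \<epsilon>) * (\<Prod>i<r. a i ^ \<epsilon> i)) =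
        (\<Sum>\<epsilon>\<in>{\<epsilon>\<in>F. c \<epsilon> \<noteq> 0}. const (c \<epsilon>) * (\<Prod>i\<in>{0..<r}. a i ^ \<epsilon> i))"
      using F(1) by (intro sum.mono_neutral_cong_right) (auto simp: atLeast0LessThan)
    then show ?case using F rel by (intro exI[of _ "{\<epsilon>\<in>F. c \<epsilon> \<noteq> 0}"]) auto
  next
    case (Suc j)
    then obtain G where G: "G \<subseteq> F" "G \<noteq> {}" "\<forall>\<epsilon>\<in>G. c \<epsilon> \<noteq> 0" "\<forall>\<epsilon>\<in>G. \<forall>\<delta>\<in>G. \<forall>i<j. \<epsilon> i = \<delta> i"
      "(\<Sum>\<epsilon>\<in>G. const (c \<epsilon>) * (\<Prod>i\<in>{j..<r}. a i ^ \<epsilon> i)) \<in> p j" by auto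
    have finG: "finite G" using G(1) F(1) by (rule finite_subset)
    have j: "j < r" using Suc.prems by simp
    define e where "e = Min ((\<lambda>\<epsilon>. \<epsilon> j) ` G)"
    have e_le: "e \<le> \<epsilon> j" if "\<epsilon> \<in> G" for \<epsilon> using that finG by (simp add: e_def)
    have "e \<in> (\<lambda>\<epsilon>. \<epsilon> j) ` G" unfolding e_def using finG G by (intro Min_in) auto
    then obtain \<epsilon>0 where \<epsilon>0: "\<epsilon>0 \<in> G" "\<epsilon>0 j = e" by auto
    define t where "t \<epsilon> = const (c \<epsilon>) * (\<Prod>i\<in>{Suc j..<r}. a i ^ \<epsilon> i)" for \<epsilon>
    have tS: "t \<epsilon> \<in> mpolys X" for \<epsilon>
      unfolding t_def by (intro ring_closed_mult[OF S] ring_closed_prod[OF S] ring_closed_power[OF S] aS) auto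
    have split: "const (c \<epsilon>) * (\<Prod>i\<in>{j..<r}. a i ^ \<epsilon> i) = a j ^ e * (a j ^ (\<epsilon> j - e) * t \<epsilon>)" if "\<epsilon> \<in> G" for \<epsilon>
    proof -
      have "a j ^ \<epsilon> j = a j ^ e * a j ^ (\<epsilon> j - e)" using e_le[OF that] by (simp flip: power_add)
      then show ?thesis using j by (simp add: prod.atLeast_Suc_lessThan t_def ac_simps)
    qed
    have "a j ^ e * (\<Sum>\<epsilon>\<in>G. a j ^ (\<epsilon> j - e) * t \<epsilon>) \<in> p j"
      using G(5) by (simp add: split sum_distrib_left)
    moreover have sumS: "(\<Sum>\<epsilon>\<in>G. a j ^ (\<epsilon> j - e) * t \<epsilon>) \<in> mpolys X"
      by (intro ring_closed_sum[OF S] ring_closed_mult[OF S] ring_closed_power[OF S] aS[OF j] tS)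
    moreover have "a j ^ e \<notin> p j"
      using prime_in_power[OF p(1) S aS[OF j]] a[OF j] j by auto
    ultimately have "(\<Sum>\<epsilon>\<in>G. a j ^ (\<epsilon> j - e) * t \<epsilon>) \<in> p j"
      using prime_inD[OF p(1)[of j]] ring_closed_power[OF S aS[OF j]] j by auto
    then have 1: "(\<Sum>\<epsilon>\<in>G. a j ^ (\<epsilon> j - e) * t \<epsilon>) \<in> p (Suc j)" using p(2)[OF j] by auto
    have I: "ideal_in (mpolys X) (p (Suc j))" using p(1)[of "Suc j"] Suc.prems by (intro prime_in_ideal) auto
    \<comment> \<open>Terms with a larger exponent keep a factor \<open>a j\<close> and so lie in
      \<open>p (Suc j)\<close>.\<close>
    define G' where "G' = {\<epsilon>\<in>G. \<epsilon> j = e}"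
    have 2: "(\<Sum>\<epsilon>\<in>G - G'. a j ^ (\<epsilon> j - e) * t \<epsilon>) \<in> p (Suc j)"
    proof (intro ideal_in_sum[OF I])
      fix \<epsilon> assume "\<epsilon> \<in> G - G'"
      then have "\<epsilon> j - e > 0" using e_le[of \<epsilon>] by (force simp: G'_def)
      then have "a j ^ (\<epsilon> j - e) * t \<epsilon> = (a j ^ (\<epsilon> j - e - 1) * t \<epsilon>) * a j"
        by (simp add: ac_simps power_eq_if)
      also have "\<dots> \<in> p (Suc j)"
        using a[OF j] by (intro ideal_in_mult[OF I] ring_closed_mult[OF S] ring_closed_power[OF S] aS[OF j] tS) auto
      finally show "a j ^ (\<epsilon> j - e) * t \<epsilon> \<in> p (Suc j)" .
    qed
    have "(\<Sum>\<epsilon>\<in>G. a j ^ (\<epsilon> j - e) * t \<epsilon>) = (\<Sum>\<epsilon>\<in>G - G'. a j ^ (\<epsilon> j - e) * t \<epsilon>) + (\<Sum>\<epsilon>\<in>G'. a j ^ (\<epsilon> j - e) * t \<epsilon>)"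
      using finG by (intro sum.subset_diff) (auto simp: G'_def)
    moreover have "(\<Sum>\<epsilon>\<in>G'. a j ^ (\<epsilon> j - e) * t \<epsilon>) = (\<Sum>\<epsilon>\<in>G'. t \<epsilon>)"
      by (intro sum.cong) (auto simp: G'_def)
    ultimately have "(\<Sum>\<epsilon>\<in>G'. t \<epsilon>) \<in> p (Suc j)" using ideal_in_diff[OF S I 1 2] by simp
    moreover have "\<forall>\<epsilon>\<in>G'. \<forall>\<delta>\<in>G'. \<forall>i<Suc j. \<epsilon> i = \<delta> i" using G(4) by (auto simp: G'_def less_Suc_eq)
    ultimately show ?case using G \<epsilon>0 unfolding t_def
      by (intro exI[of _ G']) (auto simp: G'_def)
  qed
  from this[of r] obtain G where G: "G \<subseteq> F" "G \<noteq> {}" "\<forall>\<epsilon>\<in>G. c \<epsilon> \<noteq> 0" "\<forall>\<epsilon>\<in>G. \<forall>\<delta>\<in>G. \<forall>i<r. \<epsilon> i = \<delta> i"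
      "(\<Sum>\<epsilon>\<in>G. const (c \<epsilon>) * (\<Prod>i\<in>{r..<r}. a i ^ \<epsilon> i)) \<in> p r" by auto
  obtain \<epsilon> where \<epsilon>: "\<epsilon> \<in> G" using G by auto
  \<comment> \<open>Vectors of \<open>F\<close> are extensional, so agreement in all positions below
    r makes them equal and a single term is left.\<close>
  have "G = {\<epsilon>}"
  proof -
    have "\<delta> = \<epsilon>" if "\<delta> \<in> G" for \<delta>
      using that \<epsilon> G(1,4) F(2) by (intro extensionalityI[of \<delta> "{..<r}" \<epsilon>]) auto
    then show ?thesis using \<epsilon> by blast
  qed
  then have "const (c \<epsilon>) \<in> p r" using G(5) by simp
  then have "const (1 / c \<epsilon>) * const (c \<epsilon>) \<in> p r"
    using p(1)[of r] by (intro ideal_in_mult[OF prime_in_ideal]) auto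
  then have "1 \<in> p r" using G(3) \<epsilon> by (simp add: mult_single)
  then show False using prime_in_one[OF p(1)[of r]] by simp
qed

section \<open>Dimension and depth for whiskered clutters\<close>

context whiskered
begin

text \<open>A monomial divisible by no fibre monomial misses a vertex in every fibre. A choice
  \<open>g\<close> of missed vertices is injective, fibres being disjoint, and leaves
  \<open>card (X - V)\<close> variables. The factor \<open>G\<close>, the number of choices, does
  not depend on \<open>L\<close>.\<close>

lemma card_standard_monoms:
  shows "\<exists>G. \<forall>L. card {m. Poly_Mapping.keys m \<subseteq> X \<and> (\<forall>v. Poly_Mapping.lookup m v \<le> L) \<and>
      (\<forall>i\<in>V. \<exists>v\<in>fibre i. Poly_Mapping.lookup m v = (0::nat))} \<le> G * (L + 1) ^ card (X - V)"
proof (intro exI allI)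
  fix L :: nat
  let ?B = "{m. Poly_Mapping.keys m \<subseteq> X \<and> (\<forall>v. Poly_Mapping.lookup m v \<le> L) \<and>
      (\<forall>i\<in>V. \<exists>v\<in>fibre i. Poly_Mapping.lookup m v = (0::nat))}"
  let ?C = "\<lambda>A. {m. Poly_Mapping.keys m \<subseteq> A \<and> (\<forall>v. Poly_Mapping.lookup m v \<le> L)}"
  let ?H = "\<lambda>g. X - g ` V"
  have finV: "finite V" using V_subset finite_X finite_subset by auto
  have finG: "finite (PiE V fibre)" using finV fibre by (intro finite_PiE) auto
  have "?B \<subseteq> (\<Union>g\<in>PiE V fibre. ?C (?H g))"
  proof
    fix m assume m: "m \<in> ?B"
    then have "\<forall>i\<in>V. \<exists>v. v \<in> fibre i \<and> Poly_Mapping.lookup m v = 0" by auto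
    then obtain g where g: "\<And>i. i \<in> V \<Longrightarrow> g i \<in> fibre i \<and> Poly_Mapping.lookup m (g i) = 0" by metis
    have "restrict g V \<in> PiE V fibre" using g by auto
    moreover have "m \<in> ?C (?H (restrict g V))" using m g by (auto simp: in_keys_iff)
    ultimately show "m \<in> (\<Union>g\<in>PiE V fibre. ?C (?H g))" by blast
  qed
  then have "card ?B \<le> card (\<Union>g\<in>PiE V fibre. ?C (?H g))"
    using finG finite_X by (intro card_mono finite_UN_I card_bounded_monoms(1)) auto
  also have "\<dots> \<le> (\<Sum>g\<in>PiE V fibre. card (?C (?H g)))" by (rule card_UN_le[OF finG])
  also have "\<dots> \<le> (\<Sum>g\<in>PiE V fibre. (L + 1) ^ card (X - V))"
  proof (rule sum_mono)
    fix g assume g: "g \<in> PiE V fibre"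
    have "inj_on g V"
    proof (rule inj_onI)
      fix i j assume "i \<in> V" "j \<in> V" "g i = g j"
      moreover from this have "g i \<in> fibre i" "g j \<in> fibre j" using PiE_mem[OF g] by blast+
      ultimately show "i = j" by (auto simp: fibre_def)
    qed
    moreover have "g ` V \<subseteq> X" using g fibre(1) by fastforce
    ultimately have "card (?H g) = card (X - V)"
      using V_subset finV by (simp add: card_Diff_subset card_image)
    then show "card (?C (?H g)) \<le> (L + 1) ^ card (X - V)"
      using card_bounded_monoms(2)[of "?H g" L] finite_X by simp
  qed
  finally show "card ?B \<le> card (PiE V fibre) * (L + 1) ^ card (X - V)" by simp
qed

text \<open>Given one element more than there are new vertices, the monomials in these elements with
  exponents up to k grow in number like a higher power of k than the standard monomials that can
  occur in them. For suitable k some nontrivial combination has no standard monomial left, so it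
  lies in \<open>p 0\<close>, against \<open>transcendental_chain\<close>.\<close>

lemma dimension_bound:
  assumes p: "\<And>i. i \<le> n \<Longrightarrow> prime_in (mpolys X) (p i)" "\<And>i. i < n \<Longrightarrow> p i \<subset> p (Suc i)"
    and fib: "\<And>i. i \<in> V \<Longrightarrow> (\<Prod>v\<in>fibre i. pvar v) \<in> (p 0 :: ('v, 'k) mpoly set)"
  shows "n \<le> card (X - V)"
proof (rule ccontr)
  assume n: "\<not> n \<le> card (X - V)"
  define N where "N = card (X - V)"
  define r where "r = Suc N"
  have r: "r \<le> n" using n by (simp add: r_def N_def)
  have "\<forall>i. \<exists>x. i < r \<longrightarrow> x \<in> p (Suc i) - p i" using p(2) r by (metis less_le_trans psubset_imp_ex_mem)
  then obtain a where a: "\<And>i. i < r \<Longrightarrow> a i \<in> p (Suc i) - p i" by metis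
  have aS: "a i \<in> mpolys X" if "i < r" for i
    using a[OF that] p(1)[of "Suc i"] that r by (auto intro: ideal_in_subset[OF prime_in_ideal])
  note S = ring_closed_mpolys[of X]
  have "\<forall>i. \<exists>d. exponents_le d (a i)" using exponents_le_ex by blast
  then obtain d' where d': "\<And>i. exponents_le (d' i) (a i)" by metis
  define d where "d = (\<Sum>i<r. d' i)"
  have d: "exponents_le d (a i)" if "i < r" for i
    using that member_le_sum[of i "{..<r}" d'] by (intro exponents_le_mono[OF d']) (auto simp: d_def)
  obtain G where G: "\<And>L. card {m. Poly_Mapping.keys m \<subseteq> X \<and> (\<forall>v. Poly_Mapping.lookup m v \<le> L) \<and>
      (\<forall>i\<in>V. \<exists>v\<in>fibre i. Poly_Mapping.lookup m v = (0::nat))} \<le> G * (L + 1) ^ N"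
    using card_standard_monoms unfolding N_def by blast
  \<comment> \<open>\<open>L\<close> bounds the exponents of the products, and L + 1 is at most (r d
    + 1) (k + 1). Hence \<open>card B\<close> is at most G (r d + 1)^N (k + 1)^N; taking for k the
    constant in front makes this k (k + 1)^N, which is below (k + 1)^(N + 1), the size of
    \<open>F\<close>.\<close>
  define k where "k = G * (r * d + 1) ^ N"
  define L where "L = r * (k * d)"
  define B where "B = {m. Poly_Mapping.keys m \<subseteq> X \<and> (\<forall>v. Poly_Mapping.lookup m v \<le> L) \<and>
      (\<forall>i\<in>V. \<exists>v\<in>fibre i. Poly_Mapping.lookup m v = (0::nat))}"
  define F where "F = {..<r} \<rightarrow>\<^sub>E {..k}"
  have finF: "finite F" unfolding F_def by (intro finite_PiE) auto
  have finB: "finite B" unfolding B_def by (rule finite_subset[OF _ card_bounded_monoms(1)[OF finite_X, of L]]) auto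
  have "card B \<le> G * (L + 1) ^ N" unfolding B_def by (rule G)
  also have "\<dots> \<le> G * ((r * d + 1) * (k + 1)) ^ N"
    by (intro mult_left_mono power_mono) (simp_all add: L_def algebra_simps)
  also have "\<dots> = k * (k + 1) ^ N" by (simp only: power_mult_distrib k_def mult.assoc)
  also have "\<dots> < (k + 1) ^ r" by (simp add: r_def)
  also have "\<dots> = card F" by (simp add: F_def card_PiE)
  finally have card: "card B < card F" .
  define q where "q \<epsilon> = (\<Prod>i<r. a i ^ \<epsilon> i)" for \<epsilon> :: "nat \<Rightarrow> nat"
  have qS: "q \<epsilon> \<in> mpolys X" for \<epsilon>
    unfolding q_def by (intro ring_closed_prod[OF S] ring_closed_power[OF S] aS) auto
  have q_exp: "exponents_le L (q \<epsilon>)" if "\<epsilon> \<in> F" for \<epsilon>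
  proof -
    have "exponents_le (\<Sum>i<r. \<epsilon> i * d) (q \<epsilon>)"
      unfolding q_def by (intro exponents_le_prod exponents_le_power d) auto
    moreover have "(\<Sum>i<r. \<epsilon> i * d) \<le> (\<Sum>i<r. k * d)"
      using that by (intro sum_mono mult_right_mono) (auto simp: F_def PiE_iff)
    moreover have "(\<Sum>i<r. k * d) = L" by (simp add: L_def)
    ultimately show ?thesis using exponents_le_mono by metis
  qed
  \<comment> \<open>The zero ideal of the coefficient field turns \<open>linear_dependence\<close>
    into linear algebra: the unknowns are indexed by \<open>F\<close>, the equations by the standard
    monomials in \<open>B\<close>.\<close>
  have prime0: "prime_in UNIV {0::'k}"
    by (auto simp: prime_in_def ideal_in_def)
  have "ring_closed (UNIV :: 'k set)" by (simp add: ring_closed_def)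
  from linear_dependence[OF this prime0 this subset_UNIV finB finF card, of "\<lambda>\<epsilon> m. Poly_Mapping.lookup (q \<epsilon>) m"]
  obtain c where c: "\<exists>\<epsilon>\<in>F. c \<epsilon> \<noteq> 0" "\<And>m. m \<in> B \<Longrightarrow> (\<Sum>\<epsilon>\<in>F. c \<epsilon> * Poly_Mapping.lookup (q \<epsilon>) m) = 0"
    by auto
  define Q where "Q = (\<Sum>\<epsilon>\<in>F. const (c \<epsilon>) * q \<epsilon>)"
  have lookup_Q: "Poly_Mapping.lookup Q m = (\<Sum>\<epsilon>\<in>F. c \<epsilon> * Poly_Mapping.lookup (q \<epsilon>) m)" for m
    unfolding Q_def lookup_sum
    by (intro sum.cong) (simp_all add: mult_map_scale_conv_mult[symmetric] Poly_Mapping.map.rep_eq when_def)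
  have I: "ideal_in (mpolys X) (p 0)" using p(1)[of 0] by (intro prime_in_ideal) auto
  have "Poly_Mapping.single m (Poly_Mapping.lookup Q m) \<in> p 0" if m: "m \<in> Poly_Mapping.keys Q" for m
  proof -
    have "m \<notin> B" using m c(2)[of m] by (auto simp: in_keys_iff lookup_Q)
    obtain \<epsilon> where \<epsilon>: "\<epsilon> \<in> F" "m \<in> Poly_Mapping.keys (q \<epsilon>)"
      using m unfolding in_keys_iff lookup_Q by (metis (no_types, lifting) mult_zero_right sum.neutral)
    have mX: "Poly_Mapping.keys m \<subseteq> X" using \<epsilon>(2) qS[of \<epsilon>] by (auto simp: mpolys_def)
    have "\<forall>v. Poly_Mapping.lookup m v \<le> L" using q_exp[OF \<epsilon>(1)] \<epsilon>(2) by (auto simp: exponents_le_def)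
    then have "\<not> (\<forall>i\<in>V. \<exists>v\<in>fibre i. Poly_Mapping.lookup m v = 0)"
      using \<open>m \<notin> B\<close> mX unfolding B_def mem_Collect_eq by simp
    then obtain i where i: "i \<in> V" "\<forall>v\<in>fibre i. Poly_Mapping.lookup m v \<noteq> 0" by auto
    have eq: "m = squarefree_monom (fibre i) + (m - squarefree_monom (fibre i))"
      using i(2) by (intro poly_mapping_eqI) (auto simp: lookup_add lookup_minus lookup_squarefree_monom fibre(2) Suc_leI)
    have "Poly_Mapping.keys (m - squarefree_monom (fibre i)) \<subseteq> X"
      using mX by (auto simp: in_keys_iff lookup_minus)
    then have "(\<Prod>v\<in>fibre i. pvar v) * Poly_Mapping.single (m - squarefree_monom (fibre i)) (Poly_Mapping.lookup Q m) \<in> p 0"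
      by (intro ideal_in_mult_right[OF I] fib i single_in_mpolys)
    also have "(\<Prod>v\<in>fibre i. pvar v) * Poly_Mapping.single (m - squarefree_monom (fibre i)) (Poly_Mapping.lookup Q m) =
        Poly_Mapping.single m (Poly_Mapping.lookup Q m)"
      using eq by (simp add: prod_pvar fibre(2) mult_single)
    finally show ?thesis .
  qed
  then have "(\<Sum>m\<in>Poly_Mapping.keys Q. Poly_Mapping.single m (Poly_Mapping.lookup Q m)) \<in> p 0"
    by (intro ideal_in_sum[OF I])
  then have "Q \<in> p 0" by (subst mpoly_sum_monoms)
  moreover have "Q \<notin> p 0"
  proof -
    have 1: "F \<subseteq> extensional {..<r}" unfolding F_def PiE_def by blast
    have 2: "prime_in (mpolys X) (p i)" if "i \<le> r" for i
      using that r by (intro p(1)) (rule order_trans)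
    have 3: "p i \<subseteq> p (Suc i)" if "i < r" for i
      by (rule psubset_imp_subset[OF p(2)[OF less_le_trans[OF that r]]])
    from transcendental_chain[of r X p a F c, OF 2 3 a finF 1 c(1)] show ?thesis
      unfolding Q_def q_def by blast
  qed
  ultimately show False by simp
qed

theorem cohen_macaulay_whiskered:
  assumes E: "E \<subseteq> Pow V"
  shows "cohen_macaulay_clutter K X (E \<union> fibre ` V)"
  unfolding cohen_macaulay_clutter_def
proof -
  let ?R = "class_ring (mpolys X) :: ('v, 'k) mpoly ring"
  note S = ring_closed_mpolys[of X]
  interpret cring ?R by (rule class_ring_cring[OF S])
  define J :: "('v, 'k) mpoly set" where "J = edge_ideal X (E \<union> fibre ` V)"
  have gens: "edge_generators (E \<union> fibre ` V) \<subseteq> carrier ?R"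
    using E V_subset fibre(1)
    by (auto simp: edge_generators_def intro!: ring_closed_prod[OF S] pvar_in_mpolys)
  have J: "ideal J ?R" unfolding J_def edge_ideal_def poly_ring_class_ring by (rule genideal_ideal[OF gens])
  have fib: "(\<Prod>v\<in>fibre i. pvar v) \<in> J" if "i \<in> V" for i
    using genideal_self[OF gens] that unfolding J_def edge_ideal_def poly_ring_class_ring
    by (auto simp: edge_generators_def)
  have finV: "finite (X - V)" using finite_X by simp
  have "cohen_macaulay_ring (?R Quot J)"
  proof (rule cohen_macaulay_quotient[OF J, where N = "card (X - V)"])
    show "noetherian_ring ?R" by (rule class_ring_noetherian[OF S acc_mpolys[OF finite_X]])
  next
    fix m assume m: "maximalideal m ?R" "J \<subseteq> m"
    have prime: "prime_in (mpolys X) m" by (rule class_ring_prime[OF S maximalideal_prime[OF m(1)]])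
    have max: "\<exists>b\<in>mpolys X. a * b - 1 \<in> m" if "a \<in> mpolys X - m" for a
      by (rule class_ring_maximal[OF S m(1) that])
    have "\<exists>f. f \<in> poly_over (range const) \<and> lead_coeff f = 1 \<and> degree f > 0 \<and> poly f (pvar v - pvar (r v)) \<in> m"
      if "v \<in> X - V" for v
    proof -
      have \<theta>: "pvar v - pvar (r v) \<in> mpolys X"
        using that r_in V_subset by (intro ring_closed_diff[OF S] pvar_in_mpolys) auto
      obtain g where "g \<in> poly_over (range const)" "lead_coeff g = 1" "degree g > 0"
        "poly g (pvar v - pvar (r v)) \<in> m" by (rule nullstellensatz[OF finite_X prime max \<theta>])
      then show ?thesis by (intro exI[of _ g] conjI)
    qed
    then obtain f where f: "\<And>v. v \<in> X - V \<Longrightarrow> f v \<in> poly_over (range const) \<and> lead_coeff (f v) = 1 \<and>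
        degree (f v) > 0 \<and> poly (f v) (pvar v - pvar (r v)) \<in> m" by metis
    \<comment> \<open>The basis is set up anew for each maximal ideal, as the polynomials f v depend
      on it; the length of the regular sequence does not.\<close>
    interpret W: whiskered_system X V r K E f
      using E f by unfold_locales auto
    obtain ys where ys: "set ys = X - V" "distinct ys" using finite_distinct_list[OF finV] by auto
    show "\<exists>xs. set xs \<subseteq> m \<and> length xs = card (X - V) \<and>
         (\<forall>i<length xs. \<forall>a\<in>carrier ?R.
            xs ! i \<otimes>\<^bsub>?R\<^esub> a \<in> Idl\<^bsub>?R\<^esub> (J \<union> set (take i xs)) \<longrightarrow> a \<in> Idl\<^bsub>?R\<^esub> (J \<union> set (take i xs)))"
    proof (intro exI conjI allI impI ballI)
      show "set (map W.gen ys) \<subseteq> m" using ys f by (auto simp: W.gen_def W.coord_def)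
      show "length (map W.gen ys) = card (X - V)" using ys distinct_card by fastforce
      fix i a assume "i < length (map W.gen ys)" "a \<in> carrier ?R"
        "map W.gen ys ! i \<otimes>\<^bsub>?R\<^esub> a \<in> Idl\<^bsub>?R\<^esub> (J \<union> set (take i (map W.gen ys)))"
      then show "a \<in> Idl\<^bsub>?R\<^esub> (J \<union> set (take i (map W.gen ys)))"
        using W.colon_edge_ideal[OF ys(2,1), of i a] unfolding J_def poly_ring_class_ring by simp
    qed
  next
    fix n and p :: "nat \<Rightarrow> ('v, 'k) mpoly set"
    assume p: "\<And>i. i \<le> n \<Longrightarrow> primeideal (p i) ?R \<and> J \<subseteq> p i" "\<And>i. i < n \<Longrightarrow> p i \<subset> p (Suc i)"
    show "n \<le> card (X - V)"
    proof (rule dimension_bound[of n p])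
      show "prime_in (mpolys X) (p i)" if "i \<le> n" for i
        using p(1)[OF that] by (intro class_ring_prime[OF S]) (rule conjunct1)
      show "(\<Prod>v\<in>fibre i. pvar v) \<in> p 0" if "i \<in> V" for i using fib[OF that] p(1)[of 0] by blast
    qed (rule p(2))
  qed
  then show "cohen_macaulay_ring ((poly_ring X :: ('v, 'k) mpoly ring) Quot edge_ideal X (E \<union> fibre ` V))"
    by (simp add: J_def poly_ring_class_ring)
qed

end

section \<open>Minors and the packing property\<close>

text \<open>The supports of the nonzero generators after setting \<open>Z\<close> to 0 and
  \<open>U\<close> to 1. They need not form an antichain; passing to minimal members is postponed by
  comparing families through \<open>refined_by\<close> in both directions.\<close>

definition minor_family :: "'v set set \<Rightarrow> 'v set \<Rightarrow> 'v set \<Rightarrow> 'v set set" where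
  "minor_family E Z U = (\<lambda>e. e - U) ` {e \<in> E. e \<inter> Z = {}}"

definition refined_by :: "'v set set \<Rightarrow> 'v set set \<Rightarrow> bool" where
  "refined_by H H' \<longleftrightarrow> (\<forall>h\<in>H. \<exists>h'\<in>H'. h' \<subseteq> h)"

lemma edge_generators_closed:
  "H \<subseteq> Pow V \<Longrightarrow> edge_generators H \<subseteq> (mpolys V :: ('v, 'k::field) mpoly set)"
  by (auto simp: edge_generators_def intro!: ring_closed_prod[OF ring_closed_mpolys] pvar_in_mpolys)

lemma edge_ideal_ideal_in:
  assumes "H \<subseteq> Pow V" shows "ideal_in (mpolys V) (edge_ideal V H :: ('v, 'k::field) mpoly set)"
proof -
  interpret cring "class_ring (mpolys V) :: ('v, 'k) mpoly ring" by (rule class_ring_cring[OF ring_closed_mpolys])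
  show ?thesis unfolding edge_ideal_def poly_ring_class_ring
    using genideal_ideal edge_generators_closed[OF assms] class_ring_ideal_iff[OF ring_closed_mpolys] by auto
qed

lemma edge_ideal_gen:
  assumes "H \<subseteq> Pow V" "h \<in> H" shows "(\<Prod>v\<in>h. pvar v) \<in> (edge_ideal V H :: ('v, 'k::field) mpoly set)"
proof -
  interpret cring "class_ring (mpolys V) :: ('v, 'k) mpoly ring" by (rule class_ring_cring[OF ring_closed_mpolys])
  show ?thesis unfolding edge_ideal_def poly_ring_class_ring
    using genideal_self[of "edge_generators H"] edge_generators_closed[OF assms(1)] assms(2)
    by (auto simp: edge_generators_def)
qed

lemma edge_ideal_least:
  assumes "ideal_in (mpolys V) I" "\<And>h. h \<in> H \<Longrightarrow> (\<Prod>v\<in>h. pvar v) \<in> I"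
  shows "edge_ideal V H \<subseteq> (I :: ('v, 'k::field) mpoly set)"
proof -
  interpret cring "class_ring (mpolys V) :: ('v, 'k) mpoly ring" by (rule class_ring_cring[OF ring_closed_mpolys])
  show ?thesis unfolding edge_ideal_def poly_ring_class_ring
    using assms class_ring_ideal_iff[OF ring_closed_mpolys]
    by (intro genideal_minimal) (auto simp: edge_generators_def)
qed

text \<open>The polynomials each of whose monomials has support containing a member of
  \<open>H\<close> form an ideal with all the generators; so a square-free monomial in the edge
  ideal is a multiple of a generator.\<close>

lemma edge_ideal_monom_iff:
  assumes V: "finite V" and H: "H \<subseteq> Pow V" and f: "f \<subseteq> V"
  shows "(\<Prod>v\<in>f. pvar v) \<in> (edge_ideal V H :: ('v, 'k::field) mpoly set) \<longleftrightarrow> (\<exists>h\<in>H. h \<subseteq> f)"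
proof
  let ?I = "{p \<in> mpolys V. \<forall>m\<in>Poly_Mapping.keys p. \<exists>h\<in>H. h \<subseteq> Poly_Mapping.keys m} :: ('v, 'k) mpoly set"
  have "ideal_in (mpolys V) ?I"
    unfolding ideal_in_def
  proof (intro conjI ballI)
    show "0 \<in> ?I" by (auto intro: ring_closed_zero[OF ring_closed_mpolys])
  next
    fix p q :: "('v, 'k) mpoly" assume "p \<in> ?I" "q \<in> ?I"
    then show "p + q \<in> ?I" using keys_add[of p q] by (blast intro: ring_closed_add[OF ring_closed_mpolys])
  next
    fix a p :: "('v, 'k) mpoly" assume a: "a \<in> mpolys V" and p: "p \<in> ?I"
    have "\<exists>h\<in>H. h \<subseteq> Poly_Mapping.keys m" if m: "m \<in> Poly_Mapping.keys (a * p)" for m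
    proof -
      obtain b n where n: "m = b + n" "n \<in> Poly_Mapping.keys p" using m keys_mult[of a p] by blast
      then obtain h where "h \<in> H" "h \<subseteq> Poly_Mapping.keys n" using p by auto
      moreover have "Poly_Mapping.keys n \<subseteq> Poly_Mapping.keys m" by (auto simp: n(1) in_keys_iff lookup_add)
      ultimately show ?thesis by blast
    qed
    then show "a * p \<in> ?I" using a p ring_closed_mult[OF ring_closed_mpolys] by auto
  qed auto
  moreover have fin: "finite h" if "h \<subseteq> V" for h using that V finite_subset by auto
  have "(\<Prod>v\<in>h. pvar v) \<in> ?I" if "h \<in> H" for h
  proof -
    have "(\<Prod>v\<in>h. pvar v) \<in> mpolys V" using that H by (auto intro!: ring_closed_prod[OF ring_closed_mpolys] pvar_in_mpolys)
    moreover have "finite h" using that H by (intro fin) auto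
    then have "Poly_Mapping.keys (\<Prod>v\<in>h. pvar v :: ('v, 'k) mpoly) = {squarefree_monom h}" by (simp add: prod_pvar)
    ultimately show ?thesis using that \<open>finite h\<close> by (auto simp: keys_squarefree_monom)
  qed
  ultimately have "edge_ideal V H \<subseteq> ?I" by (rule edge_ideal_least)
  moreover assume "(\<Prod>v\<in>f. pvar v) \<in> (edge_ideal V H :: ('v, 'k) mpoly set)"
  ultimately have "(\<Prod>v\<in>f. pvar v) \<in> ?I" by blast
  then show "\<exists>h\<in>H. h \<subseteq> f" using fin[OF f] by (auto simp: prod_pvar keys_squarefree_monom)
next
  assume "\<exists>h\<in>H. h \<subseteq> f"
  then obtain h where h: "h \<in> H" "h \<subseteq> f" by auto
  have "finite f" using f V finite_subset by auto
  then have "(\<Prod>v\<in>f. pvar v) = (\<Prod>v\<in>f - h. pvar v) * (\<Prod>v\<in>h. pvar v)" using h by (intro prod.subset_diff)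
  also have "(\<Prod>v\<in>f - h. pvar v) * (\<Prod>v\<in>h. pvar v) \<in> (edge_ideal V H :: ('v, 'k) mpoly set)"
    using f by (intro ideal_in_mult[OF edge_ideal_ideal_in[OF H]] edge_ideal_gen[OF H h(1)]
      ring_closed_prod[OF ring_closed_mpolys] pvar_in_mpolys) auto
  finally show "(\<Prod>v\<in>f. pvar v) \<in> (edge_ideal V H :: ('v, 'k) mpoly set)" .
qed

lemma edge_ideal_subset_iff:
  assumes V: "finite V" and H: "H \<subseteq> Pow V" "H' \<subseteq> Pow V"
  shows "(edge_ideal V H :: ('v, 'k::field) mpoly set) \<subseteq> edge_ideal V H' \<longleftrightarrow> refined_by H H'"
proof
  assume sub: "(edge_ideal V H :: ('v, 'k) mpoly set) \<subseteq> edge_ideal V H'"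
  show "refined_by H H'" unfolding refined_by_def
  proof
    fix h assume h: "h \<in> H"
    then have "(\<Prod>v\<in>h. pvar v) \<in> (edge_ideal V H' :: ('v, 'k) mpoly set)" using sub edge_ideal_gen[OF H(1)] by auto
    then show "\<exists>h'\<in>H'. h' \<subseteq> h" using edge_ideal_monom_iff[OF V H(2), of h] h H(1) by auto
  qed
next
  assume "refined_by H H'"
  then show "(edge_ideal V H :: ('v, 'k) mpoly set) \<subseteq> edge_ideal V H'"
  proof (intro edge_ideal_least edge_ideal_ideal_in H)
    fix h assume "h \<in> H"
    then show "(\<Prod>v\<in>h. pvar v) \<in> (edge_ideal V H' :: ('v, 'k) mpoly set)"
      using \<open>refined_by H H'\<close> H(1) edge_ideal_monom_iff[OF V H(2), of h] unfolding refined_by_def by blast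
  qed
qed

lemma edge_ideal_eq_iff:
  assumes "finite V" "H \<subseteq> Pow V" "H' \<subseteq> Pow V"
  shows "(edge_ideal V H :: ('v, 'k::field) mpoly set) = edge_ideal V H' \<longleftrightarrow> refined_by H H' \<and> refined_by H' H"
  using edge_ideal_subset_iff[OF assms, where 'k='k] edge_ideal_subset_iff[OF assms(1,3,2), where 'k='k] by blast

lemma edge_ideal_proper_iff:
  assumes "finite V" "H \<subseteq> Pow V"
  shows "(edge_ideal V H :: ('v, 'k::field) mpoly set) \<noteq> carrier (poly_ring V) \<longleftrightarrow> {} \<notin> H"
proof -
  have I: "ideal_in (mpolys V) (edge_ideal V H :: ('v, 'k) mpoly set)" by (rule edge_ideal_ideal_in[OF assms(2)])
  have "(edge_ideal V H :: ('v, 'k) mpoly set) = mpolys V \<longleftrightarrow> (1 :: ('v, 'k) mpoly) \<in> edge_ideal V H"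
  proof
    assume "(edge_ideal V H :: ('v, 'k) mpoly set) = mpolys V"
    then show "(1 :: ('v, 'k) mpoly) \<in> edge_ideal V H" using ring_closed_one[OF ring_closed_mpolys] by simp
  next
    assume 1: "(1 :: ('v, 'k) mpoly) \<in> edge_ideal V H"
    have "x \<in> edge_ideal V H" if "x \<in> mpolys V" for x :: "('v, 'k) mpoly"
      using ideal_in_mult[OF I that 1] by simp
    then show "(edge_ideal V H :: ('v, 'k) mpoly set) = mpolys V" using I by (auto simp: ideal_in_def)
  qed
  moreover have "(1 :: ('v, 'k) mpoly) \<in> edge_ideal V H \<longleftrightarrow> {} \<in> H"
    using edge_ideal_monom_iff[OF assms, of "{}", where 'k='k] by auto
  ultimately show ?thesis by (simp add: poly_ring_class_ring)
qed

lemma minor_family_Pow: "E \<subseteq> Pow V \<Longrightarrow> minor_family E Z U \<subseteq> Pow (V - (Z \<union> U))"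
  by (auto simp: minor_family_def)

text \<open>An edge meeting \<open>Z\<close> is sent to 0, so the two generating sets differ at most
  by 0.\<close>

lemma minor_ideal_eq:
  assumes V: "finite V" and E: "E \<subseteq> Pow V"
  shows "(minor_ideal V E Z U :: ('v, 'k::field) mpoly set) = edge_ideal (V - (Z \<union> U)) (minor_family E Z U)"
proof -
  let ?\<sigma> = "\<lambda>v. if v \<in> Z then 0 else if v \<in> U then 1 else pvar v :: ('v, 'k) mpoly"
  let ?V = "V - (Z \<union> U)"
  let ?A = "substitute ?\<sigma> ` edge_generators E :: ('v, 'k) mpoly set"
  let ?B = "edge_generators (minor_family E Z U) :: ('v, 'k) mpoly set"
  have fin: "finite e" if "e \<in> E" for e using that E V by (meson PowD finite_subset subsetD)
  have subst: "substitute ?\<sigma> (\<Prod>v\<in>e. pvar v) = (if e \<inter> Z = {} then (\<Prod>v\<in>e - U. pvar v) else 0)"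
    if e: "e \<in> E" for e
  proof (cases "e \<inter> Z = {}")
    case True
    have "(\<Prod>v\<in>e. ?\<sigma> v) = (\<Prod>v\<in>e - U. pvar v)"
      using True fin[OF e] by (intro prod.mono_neutral_cong_right) auto
    then show ?thesis using True by (simp add: substitute_prod substitute_pvar)
  next
    case False
    then show ?thesis using fin[OF e] by (auto simp: substitute_prod substitute_pvar intro!: prod_zero)
  qed
  interpret cring "class_ring (mpolys ?V) :: ('v, 'k) mpoly ring" by (rule class_ring_cring[OF ring_closed_mpolys])
  have B: "?B \<subseteq> carrier (class_ring (mpolys ?V))" using edge_generators_closed[OF minor_family_Pow[OF E]] by simp
  have zero: "0 \<in> mpolys ?V" by (rule ring_closed_zero[OF ring_closed_mpolys])
  have "?B \<subseteq> ?A"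
    unfolding edge_generators_def minor_family_def using subst by (force simp: image_image)
  moreover have A0: "?A \<subseteq> insert 0 ?B"
    unfolding edge_generators_def minor_family_def using subst by (auto simp: image_image)
  moreover have A: "?A \<subseteq> carrier (class_ring (mpolys ?V))" using A0 B zero by auto
  ultimately have "Idl\<^bsub>class_ring (mpolys ?V)\<^esub> ?B \<subseteq> Idl\<^bsub>class_ring (mpolys ?V)\<^esub> ?A"
    by (intro subset_Idl_subset)
  moreover have "Idl\<^bsub>class_ring (mpolys ?V)\<^esub> ?A \<subseteq> Idl\<^bsub>class_ring (mpolys ?V)\<^esub> ?B"
  proof (rule genideal_minimal[OF genideal_ideal[OF B]])
    have "0 \<in> Idl\<^bsub>class_ring (mpolys ?V)\<^esub> ?B"
      using additive_subgroup.zero_closed[OF ideal.axioms(1)[OF genideal_ideal[OF B]]] by simp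
    then have "insert 0 ?B \<subseteq> Idl\<^bsub>class_ring (mpolys ?V)\<^esub> ?B"
      unfolding insert_subset using genideal_self[OF B] by (rule conjI)
    then show "?A \<subseteq> Idl\<^bsub>class_ring (mpolys ?V)\<^esub> ?B" by (rule order_trans[OF A0])
  qed
  ultimately show ?thesis unfolding minor_ideal_def edge_ideal_def poly_ring_class_ring
    by (intro equalityI)
qed

text \<open>Ideals of square-free monomials are compared through their generators, so being a minor
  becomes a condition on set families in which the field no longer occurs.\<close>

lemma is_minor_iff:
  assumes V: "finite V" and E: "E \<subseteq> Pow V"
  shows "is_minor (K :: 'k::field itself) V' E' V E \<longleftrightarrow> clutter V' E' \<and>
    (\<exists>Z U. Z \<subseteq> V \<and> U \<subseteq> V \<and> Z \<inter> U = {} \<and> V' = V - (Z \<union> U) \<and> {} \<notin> minor_family E Z U \<and>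
       refined_by E' (minor_family E Z U) \<and> refined_by (minor_family E Z U) E')"
proof -
  have *: "((minor_ideal V E Z U :: ('a, 'k) mpoly set) \<noteq> carrier (poly_ring V') \<and>
        (edge_ideal V' E' :: ('a, 'k) mpoly set) = minor_ideal V E Z U) \<longleftrightarrow>
     ({} \<notin> minor_family E Z U \<and> refined_by E' (minor_family E Z U) \<and> refined_by (minor_family E Z U) E')"
    if "V' = V - (Z \<union> U)" "clutter V' E'" for Z U
  proof -
    have fin: "finite V'" using that V by auto
    have H: "minor_family E Z U \<subseteq> Pow V'" using minor_family_Pow[OF E] that by auto
    have E': "E' \<subseteq> Pow V'" using that by (simp add: clutter_def)
    show ?thesis
      unfolding minor_ideal_eq[OF V E] that(1)[symmetric]
      using edge_ideal_proper_iff[OF fin H, where 'k='k] edge_ideal_eq_iff[OF fin E' H, where 'k='k] by simp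
  qed
  show ?thesis unfolding is_minor_def
    by (rule conj_cong[OF refl], rule iff_exI, rule iff_exI, rule conj_cong[OF refl], rule conj_cong[OF refl],
        rule conj_cong[OF refl], rule conj_cong[OF refl], rule *)
qed

text \<open>The Koenig property in the form of witnesses, the reverse inequality being weak duality.
  This form passes between families that refine one another (\<open>packs_refined_by\<close>), so
  minors need not be reduced to antichains.\<close>

definition packs :: "'v set \<Rightarrow> 'v set set \<Rightarrow> bool" where
  "packs V H \<longleftrightarrow> (\<exists>S M. vertex_cover V H S \<and> M \<subseteq> H \<and> pairwise disjnt M \<and> card S \<le> card M)"

lemma card_matching_le_cover:
  assumes "finite S" "\<And>e. e \<in> M \<Longrightarrow> S \<inter> e \<noteq> {}" "pairwise disjnt M"
  shows "card M \<le> card S"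
proof -
  have "\<forall>e. \<exists>v. e \<in> M \<longrightarrow> v \<in> S \<inter> e" using assms(2) by blast
  then obtain g where g: "\<And>e. e \<in> M \<Longrightarrow> g e \<in> S \<inter> e" by metis
  have "inj_on g M"
  proof (rule inj_onI, rule ccontr)
    fix e f assume "e \<in> M" "f \<in> M" "g e = g f" "e \<noteq> f"
    then have "disjnt e f" using assms(3) by (auto simp: pairwise_def)
    then show False using g[of e] g[of f] \<open>e \<in> M\<close> \<open>f \<in> M\<close> \<open>g e = g f\<close> by (auto simp: disjnt_def)
  qed
  moreover have "g ` M \<subseteq> S" using g by auto
  ultimately show ?thesis using assms(1) card_inj_on_le by blast
qed

text \<open>As no member is empty, \<open>V\<close> is itself a cover, so the minimum defining
  \<open>covering_number\<close> is taken over a nonempty set; \<open>card_matching_le_cover\<close>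
  supplies the other inequality.\<close>

lemma koenig_iff_packs:
  assumes V: "finite V" and H: "H \<subseteq> Pow V" "{} \<notin> H"
  shows "koenig_property V H \<longleftrightarrow> packs V H"
proof -
  let ?C = "{S. vertex_cover V H S}" and ?M = "{M. M \<subseteq> H \<and> pairwise disjnt M}"
  have finH: "finite H" using H V by (meson finite_Pow_iff finite_subset)
  have finC: "finite (card ` ?C)" using V by (intro finite_imageI) (auto simp: vertex_cover_def intro: finite_subset[of _ "Pow V"])
  have finM: "finite (card ` ?M)" using finH by (intro finite_imageI) (auto intro: finite_subset[of _ "Pow H"])
  have "V \<inter> e \<noteq> {}" if "e \<in> H" for e
  proof -
    have "e \<subseteq> V" "e \<noteq> {}" using that H by auto
    then show ?thesis by blast
  qed
  then have "vertex_cover V H V" by (simp add: vertex_cover_def)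
  then have neC: "card ` ?C \<noteq> {}" by auto
  have neM: "card ` ?M \<noteq> {}" by (auto intro!: exI[of _ "{}"] simp: pairwise_def)
  obtain S where S: "vertex_cover V H S" "covering_number V H = card S"
    using Min_in[OF finC neC] by (auto simp: covering_number_def)
  obtain M where M: "M \<subseteq> H" "pairwise disjnt M" "matching_number H = card M"
    using Max_in[OF finM neM] by (auto simp: matching_number_def)
  have weak: "card M' \<le> card S'" if "vertex_cover V H S'" "M' \<subseteq> H" "pairwise disjnt M'" for S' M'
    using that V by (intro card_matching_le_cover) (auto simp: vertex_cover_def intro: finite_subset)
  show ?thesis
  proof
    assume "koenig_property V H"
    then show "packs V H" using S M unfolding packs_def koenig_property_def by (metis order_refl)
  next
    assume "packs V H"
    then obtain S' M' where *: "vertex_cover V H S'" "M' \<subseteq> H" "pairwise disjnt M'" "card S' \<le> card M'"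
      by (auto simp: packs_def)
    have "covering_number V H \<le> card S'" unfolding covering_number_def using * finC by (intro Min_le) auto
    moreover have "card M' \<le> matching_number H" unfolding matching_number_def using * finM by (intro Max_ge) auto
    moreover have "matching_number H \<le> covering_number V H" using weak[OF S(1) M(1,2)] S M by simp
    ultimately show "koenig_property V H" using * unfolding koenig_property_def by simp
  qed
qed

text \<open>Each matching edge is replaced by a member of \<open>H'\<close> inside it; these stay
  disjoint and, being nonempty, distinct. A cover of \<open>H\<close> covers \<open>H'\<close>,
  since every member of \<open>H'\<close> contains one of \<open>H\<close>.\<close>

lemma packs_refined_by:
  assumes "refined_by H H'" "refined_by H' H" and ne: "{} \<notin> H" and p: "packs V H"
  shows "packs V H'"
proof -
  obtain S M where S: "vertex_cover V H S" and M: "M \<subseteq> H" "pairwise disjnt M" "card S \<le> card M"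
    using p by (auto simp: packs_def)
  have ne': "{} \<notin> H'" using assms(2) ne by (auto simp: refined_by_def)
  have "\<forall>e\<in>M. \<exists>e'. e' \<in> H' \<and> e' \<subseteq> e" using assms(1) M(1) unfolding refined_by_def by blast
  then obtain g where g: "\<And>e. e \<in> M \<Longrightarrow> g e \<in> H' \<and> g e \<subseteq> e" by metis
  have disj: "disjnt (g e) (g f)" if "e \<in> M" "f \<in> M" "e \<noteq> f" for e f
    using g[OF that(1)] g[OF that(2)] M(2) that by (fastforce simp: pairwise_def disjnt_def)
  have "inj_on g M"
  proof (rule inj_onI, rule ccontr)
    fix e f assume *: "e \<in> M" "f \<in> M" "g e = g f" "e \<noteq> f"
    then have "g e = {}" using disj[of e f] by (simp add: disjnt_def)
    then show False using g[OF *(1)] ne' by auto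
  qed
  then have "card (g ` M) = card M" by (rule card_image)
  moreover have "pairwise disjnt (g ` M)" using disj by (auto simp: pairwise_def)
  moreover have "vertex_cover V H' S" unfolding vertex_cover_def
  proof (intro conjI ballI)
    show "S \<subseteq> V" using S by (simp add: vertex_cover_def)
    fix h' assume "h' \<in> H'"
    then obtain h where "h \<in> H" "h \<subseteq> h'" using assms(2) by (auto simp: refined_by_def)
    then show "S \<inter> h' \<noteq> {}" using S unfolding vertex_cover_def by blast
  qed
  moreover have "g ` M \<subseteq> H'" using g by auto
  ultimately show ?thesis using M(3) unfolding packs_def by (intro exI[of _ S] exI[of _ "g ` M"]) auto
qed

lemma minimal_subfamily:
  assumes V: "finite V" and H: "H \<subseteq> Pow V"
  obtains H' where "clutter V H'" "refined_by H H'" "refined_by H' H"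
proof -
  define H' where "H' = {h \<in> H. \<forall>g\<in>H. g \<subseteq> h \<longrightarrow> g = h}"
  have "refined_by H H'" unfolding refined_by_def
  proof
    fix h assume h: "h \<in> H"
    have "finite H" using V H by (meson finite_Pow_iff finite_subset)
    from finite_has_minimal2[OF this h] obtain h' where h': "h' \<in> H" "h' \<subseteq> h" "\<forall>b\<in>H. b \<subseteq> h' \<longrightarrow> h' = b"
      by blast
    then have "h' \<in> H'" unfolding H'_def by blast
    then show "\<exists>h'\<in>H'. h' \<subseteq> h" using h'(2) by blast
  qed
  moreover have "refined_by H' H" by (auto simp: refined_by_def H'_def)
  moreover have "clutter V H'" using V H by (auto simp: clutter_def H'_def)
  ultimately show thesis using that by blast
qed

lemma packing_property_iff:
  assumes V: "finite V" and E: "E \<subseteq> Pow V"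
  shows "packing_property (K :: 'k::field itself) V E \<longleftrightarrow>
    (\<forall>Z U. Z \<subseteq> V \<longrightarrow> U \<subseteq> V \<longrightarrow> Z \<inter> U = {} \<longrightarrow> {} \<notin> minor_family E Z U \<longrightarrow>
       packs (V - (Z \<union> U)) (minor_family E Z U))"
proof
  assume P: "packing_property K V E"
  show "\<forall>Z U. Z \<subseteq> V \<longrightarrow> U \<subseteq> V \<longrightarrow> Z \<inter> U = {} \<longrightarrow> {} \<notin> minor_family E Z U \<longrightarrow>
       packs (V - (Z \<union> U)) (minor_family E Z U)"
  proof (intro allI impI)
    fix Z U assume *: "Z \<subseteq> V" "U \<subseteq> V" "Z \<inter> U = {}" "{} \<notin> minor_family E Z U"
    let ?V = "V - (Z \<union> U)"
    have fin: "finite ?V" using V by simp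
    obtain H where H: "clutter ?V H" "refined_by (minor_family E Z U) H" "refined_by H (minor_family E Z U)"
      using minimal_subfamily[OF fin minor_family_Pow[OF E]] by blast
    have "is_minor K ?V H V E" unfolding is_minor_iff[OF V E] using H * by blast
    then have "koenig_property ?V H" using P by (simp add: packing_property_def)
    moreover have ne: "{} \<notin> H" using H(3) *(4) by (auto simp: refined_by_def)
    ultimately have "packs ?V H" using koenig_iff_packs[OF fin, of H] H(1) by (simp add: clutter_def)
    then show "packs ?V (minor_family E Z U)" by (rule packs_refined_by[OF H(3,2) ne])
  qed
next
  assume R: "\<forall>Z U. Z \<subseteq> V \<longrightarrow> U \<subseteq> V \<longrightarrow> Z \<inter> U = {} \<longrightarrow> {} \<notin> minor_family E Z U \<longrightarrow>
       packs (V - (Z \<union> U)) (minor_family E Z U)"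
  show "packing_property K V E" unfolding packing_property_def
  proof (intro allI impI)
    fix V' E' assume "is_minor K V' E' V E"
    then obtain Z U where *: "clutter V' E'" "Z \<subseteq> V" "U \<subseteq> V" "Z \<inter> U = {}" "V' = V - (Z \<union> U)"
      "{} \<notin> minor_family E Z U" "refined_by E' (minor_family E Z U)" "refined_by (minor_family E Z U) E'"
      unfolding is_minor_iff[OF V E] by blast
    then have "packs V' (minor_family E Z U)" using R by blast
    then have "packs V' E'" using packs_refined_by[OF *(8,7,6)] by blast
    moreover have "{} \<notin> E'" using *(6,7) by (auto simp: refined_by_def)
    ultimately show "koenig_property V' E'" using koenig_iff_packs[of V' E'] *(1) by (simp add: clutter_def)
  qed
qed

section \<open>Packing in minors of whiskered clutters\<close>

context whiskered
begin

lemma fibre_Int: "i \<in> V \<Longrightarrow> fibre i \<inter> V = {i}"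
  using V_subset r_id by (auto simp: fibre_def)

lemma fibre_disjoint: "i \<noteq> j \<Longrightarrow> fibre i \<inter> fibre j = {}"
  by (auto simp: fibre_def)

lemma finite_V: "finite V"
  using V_subset finite_X by (rule finite_subset)

text \<open>\<open>T\<close> lists the vertices whose fibre survives the deletion, \<open>D\<close>
  those among them that are still present. The minor of the original clutter to be used deletes
  \<open>D\<close> in addition: its edges avoid the traces \<open>G i\<close>, so the matchings
  combine, and the edges lost pass through a vertex of \<open>D\<close>, which the covering vertex
  of its trace hits as well.\<close>

lemma packs_whiskered:
  assumes E: "E \<subseteq> Pow V"
    and packs: "\<And>Z U. Z \<subseteq> V \<Longrightarrow> U \<subseteq> V \<Longrightarrow> Z \<inter> U = {} \<Longrightarrow> {} \<notin> minor_family E Z U \<Longrightarrow>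
       packs (V - (Z \<union> U)) (minor_family E Z U)"
    and Z: "Z \<subseteq> X" "U \<subseteq> X" "Z \<inter> U = {}" and ne: "{} \<notin> minor_family (E \<union> fibre ` V) Z U"
  shows "packs (X - (Z \<union> U)) (minor_family (E \<union> fibre ` V) Z U)"
proof -
  define T where "T = {i \<in> V. fibre i \<inter> Z = {}}"
  define D where "D = T - U"
  define G where "G i = fibre i - U" for i
  have finT: "finite T" using finite_V by (simp add: T_def)
  have G_in: "G i \<in> minor_family (E \<union> fibre ` V) Z U" if "i \<in> T" for i
    using that by (auto simp: G_def T_def minor_family_def)
  have G_ne: "G i \<noteq> {}" if "i \<in> T" for i using G_in[OF that] ne by auto
  \<comment> \<open>For i in \<open>D\<close> the vertex chosen in the trace is i itself, so that it
    also covers the original edges through i; if i is contracted, any vertex of the trace will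
    do.\<close>
  define g where "g i = (if i \<in> D then i else SOME v. v \<in> G i)" for i
  have g: "g i \<in> G i" if i: "i \<in> T" for i
  proof (cases "i \<in> D")
    case True
    then show ?thesis using self_in_fibre[of i] by (simp add: g_def G_def D_def T_def)
  next
    case False
    then show ?thesis using G_ne[OF i] by (simp add: g_def some_in_eq)
  qed
  let ?Z = "(Z \<inter> V) \<union> D" and ?U = "U \<inter> V"
  let ?H = "minor_family E ?Z ?U"
  have "{} \<notin> ?H"
  proof
    assume "{} \<in> ?H"
    then obtain e where e: "e \<in> E" "e \<inter> ?Z = {}" "e - ?U = {}" by (auto simp: minor_family_def)
    then have "e \<inter> Z = {}" "e - U = {}" using E by auto
    then have "{} \<in> minor_family (E \<union> fibre ` V) Z U" using e(1) by (force simp: minor_family_def)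
    then show False using ne by simp
  qed
  moreover have "?Z \<subseteq> V" "?U \<subseteq> V" "?Z \<inter> ?U = {}" using Z by (auto simp: D_def T_def)
  ultimately have "packs (V - (?Z \<union> ?U)) ?H" by (intro packs)
  then obtain S M where S: "vertex_cover (V - (?Z \<union> ?U)) ?H S" and M: "M \<subseteq> ?H" "pairwise disjnt M" "card S \<le> card M"
    by (auto simp: packs_def)
  have S_sub: "S \<subseteq> V - (?Z \<union> ?U)" using S by (simp add: vertex_cover_def)
  have M_sub: "m \<subseteq> V - (?Z \<union> ?U)" if "m \<in> M" for m using minor_family_Pow[OF E, of ?Z ?U] M that by auto
  have G_disj: "G i \<inter> G j = {}" if "i \<noteq> j" for i j using fibre_disjoint[OF that] by (auto simp: G_def)
  \<comment> \<open>A trace meets \<open>V\<close> at most in i, and this only if i is in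
    \<open>D\<close>, which the edges in \<open>M\<close> avoid.\<close>
  have MG_disj: "m \<inter> G i = {}" if "m \<in> M" "i \<in> T" for m i
  proof -
    have "m \<inter> G i \<subseteq> {i} - U" using M_sub[OF that(1)] fibre_Int[of i] that(2) by (auto simp: G_def T_def)
    moreover have "i \<in> m \<Longrightarrow> i \<in> U" using M_sub[OF that(1)] that(2) by (auto simp: D_def)
    ultimately show ?thesis by auto
  qed
  have inj: "inj_on G T" using G_disj G_ne by (fastforce intro: inj_onI)
  have "finite (Pow V)" using finite_V by simp
  then have finM: "finite M" by (rule finite_subset[rotated]) (use M_sub in auto)
  have "card (S \<union> g ` T) \<le> card S + card T"
    using card_Un_le[of S "g ` T"] card_image_le[OF finT, of g] by linarith
  moreover have "card (M \<union> G ` T) = card M + card T"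
  proof -
    have "M \<inter> G ` T = {}" using MG_disj G_ne by fastforce
    then have "card (M \<union> G ` T) = card M + card (G ` T)" using finM finT by (intro card_Un_disjoint) auto
    then show ?thesis using card_image[OF inj] by simp
  qed
  ultimately have "card (S \<union> g ` T) \<le> card (M \<union> G ` T)" using M(3) by linarith
  moreover have "pairwise disjnt (M \<union> G ` T)"
    unfolding pairwise_def
  proof (intro ballI impI)
    fix a b assume "a \<in> M \<union> G ` T" "b \<in> M \<union> G ` T" "a \<noteq> b"
    then consider "a \<in> M" "b \<in> M" | i where "a \<in> M" "i \<in> T" "b = G i" | i where "b \<in> M" "i \<in> T" "a = G i"
      | i j where "a = G i" "b = G j" "i \<noteq> j" by auto
    then show "disjnt a b"
    proof cases
      case 1
      then show ?thesis using M(2) \<open>a \<noteq> b\<close> by (auto simp: pairwise_def)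
    qed (use MG_disj G_disj in \<open>auto simp: disjnt_def Int_commute\<close>)
  qed
  moreover have "M \<union> G ` T \<subseteq> minor_family (E \<union> fibre ` V) Z U"
  proof
    fix m assume "m \<in> M \<union> G ` T"
    then consider "m \<in> M" | i where "i \<in> T" "m = G i" by auto
    then show "m \<in> minor_family (E \<union> fibre ` V) Z U"
    proof cases
      case 1
      then obtain e where e: "e \<in> E" "e \<inter> ?Z = {}" "m = e - ?U" using M by (auto simp: minor_family_def)
      then have "e \<inter> Z = {}" "m = e - U" using E by auto
      then show ?thesis using e(1) by (auto simp: minor_family_def)
    qed (use G_in in auto)
  qed
  moreover have "vertex_cover (X - (Z \<union> U)) (minor_family (E \<union> fibre ` V) Z U) (S \<union> g ` T)"
    unfolding vertex_cover_def
  proof (intro conjI ballI)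
    have "g i \<in> X - (Z \<union> U)" if "i \<in> T" for i
      using g[OF that] that fibre(1)[of i] by (auto simp: G_def T_def)
    then show "S \<union> g ` T \<subseteq> X - (Z \<union> U)" using S_sub V_subset by auto
    fix h assume "h \<in> minor_family (E \<union> fibre ` V) Z U"
    then consider e where "e \<in> E" "e \<inter> Z = {}" "h = e - U" | i where "i \<in> T" "h = G i"
      by (auto simp: minor_family_def T_def G_def)
    then show "(S \<union> g ` T) \<inter> h \<noteq> {}"
    proof cases
      case 1
      show ?thesis
      proof (cases "e \<inter> D = {}")
        case True
        then have "e - ?U \<in> ?H" using 1 by (auto simp: minor_family_def)
        moreover have "e - ?U = h" using 1 E by auto
        ultimately show ?thesis using S unfolding vertex_cover_def by blast
      next
        case False
        then obtain i where i: "i \<in> e" "i \<in> D" by auto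
        then have "i \<in> g ` T" by (auto simp: g_def D_def image_iff intro!: bexI[of _ i])
        then show ?thesis using i 1 by (auto simp: D_def)
      qed
    next
      case 2
      then show ?thesis using g by auto
    qed
  qed
  ultimately show ?thesis unfolding packs_def by blast
qed

lemma packing_property_whiskered:
  assumes "E \<subseteq> Pow V" "packing_property K V E"
  shows "packing_property K X (E \<union> fibre ` V)"
proof -
  have E1: "E \<union> fibre ` V \<subseteq> Pow X" using assms(1) V_subset fibre(1) by auto
  show ?thesis
    unfolding packing_property_iff[OF finite_X E1]
    using packs_whiskered[OF assms(1)] assms(2)[unfolded packing_property_iff[OF finite_V assms(1)]] by blast
qed

end

section \<open>The max-flow min-cut property\<close>

lemma incidence_sum_vertices:
  assumes "finite V" "e \<subseteq> V"
  shows "(\<Sum>v\<in>V. x v * incidence v e) = sum x e"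
proof -
  have "(\<Sum>v\<in>V. x v * incidence v e) = (\<Sum>v\<in>V. if v \<in> e then x v else 0)"
    by (intro sum.cong) (auto simp: incidence_def)
  also have "\<dots> = sum x e" using assms by (simp add: sum.If_cases Int_absorb1)
  finally show ?thesis .
qed

text \<open>Scaling the weights at one vertex at a time costs at most the excess there.\<close>

lemma reduce_load:
  fixes y :: "'v set \<Rightarrow> real"
  assumes V: "finite V" and E: "finite E" and y: "\<And>e. e \<in> E \<Longrightarrow> 0 \<le> y e"
    and b: "\<And>v. v \<in> V \<Longrightarrow> 0 \<le> b v" "\<And>v. v \<in> V \<Longrightarrow> 0 \<le> \<delta> v"
    and load: "\<And>v. v \<in> V \<Longrightarrow> (\<Sum>e\<in>E. incidence v e * y e) \<le> b v + \<delta> v"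
  shows "\<exists>z. (\<forall>e\<in>E. 0 \<le> z e \<and> z e \<le> y e) \<and> (\<forall>v\<in>V. (\<Sum>e\<in>E. incidence v e * z e) \<le> b v) \<and>
    sum y E - sum \<delta> V \<le> sum z E"
  using V b load
proof (induction V rule: finite_induct)
  case empty
  then show ?case using y by (intro exI[of _ y]) auto
next
  case (insert i V)
  have "\<exists>z. (\<forall>e\<in>E. 0 \<le> z e \<and> z e \<le> y e) \<and> (\<forall>v\<in>V. (\<Sum>e\<in>E. incidence v e * z e) \<le> b v) \<and>
      sum y E - sum \<delta> V \<le> sum z E"
    by (rule insert.IH) (rule insert.prems; simp)+
  then obtain z where z: "\<And>e. e \<in> E \<Longrightarrow> 0 \<le> z e" "\<And>e. e \<in> E \<Longrightarrow> z e \<le> y e"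
    "\<And>v. v \<in> V \<Longrightarrow> (\<Sum>e\<in>E. incidence v e * z e) \<le> b v" "sum y E - sum \<delta> V \<le> sum z E" by blast
  define l where "l = (\<Sum>e\<in>E. incidence i e * z e)"
  have "l \<le> (\<Sum>e\<in>E. incidence i e * y e)"
    unfolding l_def using z by (intro sum_mono mult_left_mono) (auto simp: incidence_def)
  then have l: "l \<le> b i + \<delta> i" using insert.prems(3)[of i] by simp
  have bi: "0 \<le> b i" "0 \<le> \<delta> i" using insert.prems by auto
  show ?case
  proof (cases "l \<le> b i")
    case True
    then show ?thesis using z bi insert.hyps by (intro exI[of _ z]) (auto simp: l_def)
  next
    case False
    \<comment> \<open>Here l > b i \<ge> 0, so the factor lies between 0 and 1. It scales the
      weights of exactly the sets containing i and brings their total down to b i.\<close>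
    define s where "s = b i / l"
    have s: "0 \<le> s" "s \<le> 1" "s * l = b i" using False bi by (auto simp: s_def field_simps)
    define z' where "z' e = z e - incidence i e * z e * (1 - s)" for e
    have z': "0 \<le> z' e" "z' e \<le> z e" if "e \<in> E" for e
      using z(1)[OF that] s by (auto simp: z'_def incidence_def mult_left_le_one_le algebra_simps)
    have inc: "incidence i e * incidence i e = incidence i e" for e by (simp add: incidence_def)
    have "(\<Sum>e\<in>E. incidence v e * z' e) \<le> b v" if v: "v \<in> insert i V" for v
    proof (cases "v = i")
      case True
      have "(\<Sum>e\<in>E. incidence i e * z' e) = (\<Sum>e\<in>E. s * (incidence i e * z e))"
      proof (intro sum.cong refl)
        fix e
        have "incidence i e * z' e = incidence i e * z e - (incidence i e * incidence i e) * z e * (1 - s)"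
          by (simp add: z'_def algebra_simps)
        then show "incidence i e * z' e = s * (incidence i e * z e)" by (simp add: inc algebra_simps)
      qed
      also have "\<dots> = b i" using s(3) by (simp add: l_def sum_distrib_left)
      finally show ?thesis using True by simp
    next
      case False
      have "(\<Sum>e\<in>E. incidence v e * z' e) \<le> (\<Sum>e\<in>E. incidence v e * z e)"
        using z' by (intro sum_mono mult_left_mono) (auto simp: incidence_def)
      then show ?thesis using z(3)[of v] v False by simp
    qed
    moreover have "sum z' E = sum z E - (l - b i)"
    proof -
      have "sum z' E = sum z E - (\<Sum>e\<in>E. incidence i e * z e) * (1 - s)"
        by (simp add: z'_def sum_subtractf sum_distrib_right)
      then show ?thesis using s(3) by (simp add: l_def algebra_simps)
    qed
    then have "sum y E - sum \<delta> (insert i V) \<le> sum z' E" using z(4) l insert.hyps by simp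
    moreover have "0 \<le> z' e \<and> z' e \<le> y e" if "e \<in> E" for e using z' z(2) that by (meson order_trans)
    ultimately show ?thesis by blast
  qed
qed

section \<open>Integral optima for whiskered clutters\<close>

context whiskered
begin

lemma sum_X: "sum h X = (\<Sum>i\<in>V. sum h (fibre i))"
proof -
  have "X = (\<Union>i\<in>V. fibre i)" using r_in by (auto simp: fibre_def)
  then show ?thesis
    using sum.UNION_disjoint[OF finite_V, of fibre h] fibre(2) fibre_disjoint by metis
qed

lemma inj_fibre: "inj_on fibre V"
proof (rule inj_onI)
  fix i j assume ij: "i \<in> V" "j \<in> V" "fibre i = fibre j"
  then have "i \<in> fibre j" using self_in_fibre by blast
  then show "i = j" using ij(1) r_id by (simp add: fibre_def)
qed

text \<open>Both optima for \<open>w\<close> exceed those for the reduced weights \<open>w'\<close>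
  on \<open>V\<close> by the sum of the minima of \<open>w\<close> over the fibres. The minimum and
  the maximum are treated separately, each by extending an integral optimum for \<open>w'\<close>
  and bounding its competitors. Disjointness of old and new edges lets the sums over edges
  split.\<close>

theorem mfmc_property_whiskered:
  assumes E: "E \<subseteq> Pow V" and disj: "E \<inter> fibre ` V = {}" and mfmc: "mfmc_property V E"
  shows "mfmc_property X (E \<union> fibre ` V)"
  unfolding mfmc_property_def
proof (intro allI)
  fix w :: "'v \<Rightarrow> nat"
  let ?E = "E \<union> fibre ` V"
  have finE: "finite E" using E finite_V by (meson finite_Pow_iff finite_subset)
  have fib_ne: "w ` fibre i \<noteq> {}" "finite (w ` fibre i)" if "i \<in> V" for i
    using self_in_fibre[OF that] fibre(2) by auto
  define \<omega> where "\<omega> e = Min (w ` e)" for e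
  have \<omega>_le: "\<omega> (fibre i) \<le> w v" if "i \<in> V" "v \<in> fibre i" for i v
    using fib_ne[OF that(1)] that(2) by (auto simp: \<omega>_def)
  have "\<exists>a. a \<in> fibre i \<and> w a = \<omega> (fibre i)" if "i \<in> V" for i
    using Min_in[OF fib_ne(2)[OF that] fib_ne(1)[OF that]] unfolding \<omega>_def by auto
  then obtain a where a: "\<And>i. i \<in> V \<Longrightarrow> a i \<in> fibre i \<and> w (a i) = \<omega> (fibre i)" by metis
  \<comment> \<open>What remains at an old vertex after its fibre edge has been used to capacity.
    The subtraction of natural numbers is exact on \<open>V\<close>, since there v belongs to
    \<open>fibre v\<close>.\<close>
  define w' where "w' v = w v - \<omega> (fibre v)" for v
  have w': "real (w v) = real (w' v) + real (\<omega> (fibre v))" if "v \<in> V" for v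
    using \<omega>_le[OF that self_in_fibre[OF that]] by (simp add: w'_def)
  let ?cost = "\<lambda>w V x. \<Sum>v\<in>V. real (w v) * (x v :: real)"
  let ?\<Omega> = "\<Sum>i\<in>V. real (\<omega> (fibre i))"
  obtain x0 where x0: "is_arg_min (?cost w' V) (primal_feasible V E) x0" "\<forall>v\<in>V. x0 v \<in> \<int>"
    using mfmc unfolding mfmc_property_def by blast
  obtain y0 where y0: "is_arg_max (\<lambda>y. \<Sum>e\<in>E. y e) (dual_feasible V E w') y0" "\<forall>e\<in>E. y0 e \<in> \<int>"
    using mfmc unfolding mfmc_property_def by blast
  have fib_X: "fibre i \<subseteq> X" for i by (rule fibre(1))
  have primal_V: "primal_feasible V E x \<longleftrightarrow> (\<forall>v\<in>V. 0 \<le> x v) \<and> (\<forall>e\<in>E. 1 \<le> sum x e)" for x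
  proof -
    have "(\<Sum>v\<in>V. x v * incidence v e) = sum x e" if "e \<in> E" for e
      using that E by (intro incidence_sum_vertices[OF finite_V]) auto
    then show ?thesis unfolding primal_feasible_def by auto
  qed
  have primal_X: "primal_feasible X ?E x \<longleftrightarrow>
      (\<forall>v\<in>X. 0 \<le> x v) \<and> (\<forall>e\<in>E. 1 \<le> sum x e) \<and> (\<forall>i\<in>V. 1 \<le> sum x (fibre i))" for x
  proof -
    have "(\<Sum>v\<in>X. x v * incidence v e) = sum x e" if "e \<in> ?E" for e
      using that E V_subset fib_X by (intro incidence_sum_vertices[OF finite_X]) auto
    then show ?thesis unfolding primal_feasible_def by auto
  qed
  have x0_opt: "?cost w' V x0 \<le> ?cost w' V x" if "primal_feasible V E x" for x
    using x0(1) that unfolding is_arg_min_def by (meson not_le)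
  have x0_feas: "\<And>v. v \<in> V \<Longrightarrow> 0 \<le> x0 v" "\<And>e. e \<in> E \<Longrightarrow> 1 \<le> sum x0 e"
    using x0(1) primal_V unfolding is_arg_min_def by auto
  have y0_opt: "sum y E \<le> sum y0 E" if "dual_feasible V E w' y" for y
    using y0(1) that unfolding is_arg_max_def by (meson not_le)
  have y0_feas: "\<And>e. e \<in> E \<Longrightarrow> 0 \<le> y0 e" "\<And>v. v \<in> V \<Longrightarrow> (\<Sum>e\<in>E. incidence v e * y0 e) \<le> real (w' v)"
    using y0(1) unfolding is_arg_max_def dual_feasible_def by auto
  show "(\<exists>x. is_arg_min (?cost w X) (primal_feasible X ?E) x \<and> (\<forall>v\<in>X. x v \<in> \<int>)) \<and>
        (\<exists>y. is_arg_max (\<lambda>y. \<Sum>e\<in>?E. y e) (dual_feasible X ?E w) y \<and> (\<forall>e\<in>?E. y e \<in> \<int>))"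
  proof
    \<comment> \<open>The optimum on \<open>X\<close> puts weight \<open>1\<close> on one vertex of each fibre: on \<open>i\<close> itself if the
      optimum for \<open>w'\<close> covers \<open>i\<close>, and on a cheapest vertex otherwise.\<close>
    define c where "c i = (if 1 \<le> x0 i then i else a i)" for i
    define x where "x v = (if v = c (r v) then 1 else 0 :: real)" for v
    have c_fibre: "c i \<in> fibre i" if "i \<in> V" for i using a[OF that] self_in_fibre[OF that] by (simp add: c_def)
    have sum_fibre: "(\<Sum>v\<in>fibre i. g v * x v) = g (c i)" if i: "i \<in> V" for i and g :: "'v \<Rightarrow> real"
    proof -
      have "(\<Sum>v\<in>fibre i. g v * x v) = (\<Sum>v\<in>fibre i. if v = c i then g v else 0)"
        by (intro sum.cong) (auto simp: x_def fibre_def)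
      then show ?thesis using c_fibre[OF i] fibre(2) by simp
    qed
    have feas: "primal_feasible X ?E x"
      unfolding primal_X
    proof (intro conjI ballI)
      show "0 \<le> x v" for v by (simp add: x_def)
      show "1 \<le> sum x (fibre i)" if "i \<in> V" for i using sum_fibre[OF that, of "\<lambda>_. 1"] by simp
      fix e assume e: "e \<in> E"
      have fin: "finite e" using e E finite_V by (meson PowD finite_subset subsetD)
      \<comment> \<open>Integrality enters here: nonnegative integers below 1 are 0, so an edge
        whose values were all below 1 would have sum 0.\<close>
      have "\<exists>v\<in>e. 1 \<le> x0 v"
      proof (rule ccontr)
        assume no: "\<not> (\<exists>v\<in>e. 1 \<le> x0 v)"
        have "x0 v = 0" if v: "v \<in> e" for v
        proof -
          have vV: "v \<in> V" using v e E by auto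
          obtain k where k: "x0 v = of_int k" using x0(2) vV by (auto elim: Ints_cases)
          have "0 \<le> x0 v" "x0 v < 1" using x0_feas(1)[OF vV] no v by auto
          then show ?thesis using k by simp
        qed
        then have "sum x0 e = 0" by simp
        then show False using x0_feas(2)[OF e] by simp
      qed
      then obtain v where v: "v \<in> e" "1 \<le> x0 v" by auto
      have "v \<in> V" using v(1) e E by auto
      then have "x v = 1" using v(2) r_id[of v] by (simp add: x_def c_def)
      then show "1 \<le> sum x e" using member_le_sum[OF v(1), of x] fin by (simp add: x_def split: if_splits)
    qed
    have cost: "?cost w X x \<le> ?\<Omega> + ?cost w' V x0"
    proof -
      have "?cost w X x = (\<Sum>i\<in>V. real (w (c i)))" unfolding sum_X using sum_fibre by (intro sum.cong) auto
      also have "\<dots> \<le> (\<Sum>i\<in>V. real (\<omega> (fibre i)) + real (w' i) * x0 i)"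
      proof (intro sum_mono)
        fix i assume i: "i \<in> V"
        show "real (w (c i)) \<le> real (\<omega> (fibre i)) + real (w' i) * x0 i"
        proof (cases "1 \<le> x0 i")
          case True
          then have "real (w' i) * 1 \<le> real (w' i) * x0 i" by (intro mult_left_mono) auto
          then show ?thesis using True w'[OF i] by (simp add: c_def)
        next
          case False
          then show ?thesis using a[OF i] x0_feas(1)[OF i] by (simp add: c_def)
        qed
      qed
      finally show ?thesis by (simp add: sum.distrib)
    qed
    \<comment> \<open>In each fibre the minimum is paid for by the constraint that x' sums to at
      least 1 there; the remaining weights \<open>w'\<close> are handled by the optimality of
      x0.\<close>
    have lower: "?\<Omega> + ?cost w' V x0 \<le> ?cost w X x'" if x': "primal_feasible X ?E x'" for x'
    proof -
      have x'_pos: "0 \<le> x' v" if "v \<in> X" for v using x' that by (simp add: primal_X)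
      have "primal_feasible V E x'" using x' V_subset unfolding primal_X primal_V by auto
      then have "?\<Omega> + ?cost w' V x0 \<le> ?\<Omega> + ?cost w' V x'" using x0_opt by simp
      also have "\<dots> = (\<Sum>i\<in>V. real (\<omega> (fibre i)) + real (w' i) * x' i)" by (simp add: sum.distrib)
      also have "\<dots> \<le> (\<Sum>i\<in>V. \<Sum>v\<in>fibre i. real (w v) * x' v)"
      proof (intro sum_mono)
        fix i assume i: "i \<in> V"
        have iX: "i \<in> fibre i" by (rule self_in_fibre[OF i])
        have rest: "(\<Sum>v\<in>fibre i - {i}. real (\<omega> (fibre i)) * x' v) \<le> (\<Sum>v\<in>fibre i - {i}. real (w v) * x' v)"
          using \<omega>_le[OF i] x'_pos fib_X[of i] by (intro sum_mono mult_right_mono) auto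
        have "real (\<omega> (fibre i)) * 1 \<le> real (\<omega> (fibre i)) * sum x' (fibre i)"
          using x' i by (intro mult_left_mono) (auto simp: primal_X)
        also have "\<dots> = real (\<omega> (fibre i)) * x' i + (\<Sum>v\<in>fibre i - {i}. real (\<omega> (fibre i)) * x' v)"
          using iX fibre(2) by (simp add: sum.remove[of _ i] sum_distrib_left distrib_left)
        finally have "real (\<omega> (fibre i)) + real (w' i) * x' i \<le>
            (real (w' i) + real (\<omega> (fibre i))) * x' i + (\<Sum>v\<in>fibre i - {i}. real (w v) * x' v)"
          using rest by (simp add: distrib_right)
        also have "\<dots> = (\<Sum>v\<in>fibre i. real (w v) * x' v)"
          using iX fibre(2) w'[OF i] by (simp add: sum.remove[of "fibre i" i])
        finally show "real (\<omega> (fibre i)) + real (w' i) * x' i \<le> (\<Sum>v\<in>fibre i. real (w v) * x' v)" .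
      qed
      also have "\<dots> = ?cost w X x'" by (rule sum_X[symmetric])
      finally show ?thesis .
    qed
    have "is_arg_min (?cost w X) (primal_feasible X ?E) x"
      unfolding is_arg_min_def
    proof (intro conjI feas notI)
      assume "\<exists>x'. primal_feasible X ?E x' \<and> ?cost w X x' < ?cost w X x"
      then obtain x' where "primal_feasible X ?E x'" "?cost w X x' < ?cost w X x" by blast
      then show False using lower[of x'] cost by linarith
    qed
    moreover have "\<forall>v\<in>X. x v \<in> \<int>" by (simp add: x_def)
    ultimately show "\<exists>x. is_arg_min (?cost w X) (primal_feasible X ?E) x \<and> (\<forall>v\<in>X. x v \<in> \<int>)" by blast
  next
    define y where "y e = (if e \<in> fibre ` V then real (\<omega> e) else y0 e)" for e
    have finF: "finite (fibre ` V)" using finite_V by simp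
    have split: "(\<Sum>e\<in>?E. h e) = (\<Sum>e\<in>E. h e) + (\<Sum>i\<in>V. h (fibre i))" for h :: "'v set \<Rightarrow> real"
      using sum.union_disjoint[OF finE finF disj, of h] sum.reindex[OF inj_fibre, of h] by simp
    have y_E: "y e = y0 e" if "e \<in> E" for e using that disj by (auto simp: y_def)
    have y_fibre: "y (fibre i) = real (\<omega> (fibre i))" if "i \<in> V" for i using that by (simp add: y_def)
    have load_fibre: "(\<Sum>i\<in>V. incidence v (fibre i) * h (fibre i)) = h (fibre (r v))"
      if v: "v \<in> X" for v and h :: "'v set \<Rightarrow> real"
    proof -
      have "(\<Sum>i\<in>V. incidence v (fibre i) * h (fibre i)) = (\<Sum>i\<in>V. if i = r v then h (fibre i) else 0)"
        using v by (intro sum.cong) (auto simp: incidence_def fibre_def)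
      then show ?thesis using r_in[OF v] finite_V by simp
    qed
    have feas: "dual_feasible X ?E w y"
      unfolding dual_feasible_def
    proof (intro conjI ballI)
      show "0 \<le> y e" if "e \<in> ?E" for e using that y0_feas(1) by (auto simp: y_def)
      fix v assume v: "v \<in> X"
      have load: "(\<Sum>e\<in>?E. incidence v e * y e) = (\<Sum>e\<in>E. incidence v e * y0 e) + real (\<omega> (fibre (r v)))"
        unfolding split load_fibre[OF v] using r_in[OF v] by (simp add: y_E y_fibre)
      show "(\<Sum>e\<in>?E. incidence v e * y e) \<le> real (w v)"
      proof (cases "v \<in> V")
        case True
        then show ?thesis using load y0_feas(2)[OF True] w'[OF True] r_id[OF True] by simp
      next
        case False
        then have "incidence v e = 0" if "e \<in> E" for e using that E by (auto simp: incidence_def)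
        moreover have "\<omega> (fibre (r v)) \<le> w v" using \<omega>_le[OF r_in[OF v]] v by (simp add: fibre_def)
        ultimately show ?thesis using load by simp
      qed
    qed
    have upper: "(\<Sum>e\<in>?E. y' e) \<le> (\<Sum>e\<in>?E. y e)" if y': "dual_feasible X ?E w y'" for y'
    proof -
      have pos: "0 \<le> y' e" if "e \<in> ?E" for e using y' that by (simp add: dual_feasible_def)
      have load: "(\<Sum>e\<in>E. incidence v e * y' e) + y' (fibre (r v)) \<le> real (w v)" if v: "v \<in> X" for v
        using y' v load_fibre[OF v, of y'] unfolding dual_feasible_def split by auto
      \<comment> \<open>The deficit of y' on the edge \<open>fibre i\<close> against its capacity.
        The original edges may exceed the load \<open>w'\<close> at i by this much;
        \<open>reduce_load\<close> removes the excess at a cost of at most the total deficit, which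
        is what y gains on the fibres.\<close>
      define \<delta> where "\<delta> i = real (\<omega> (fibre i)) - y' (fibre i)" for i
      \<comment> \<open>The constraint at a cheapest vertex of the fibre bounds y' on the fibre edge
        by its capacity.\<close>
      have \<delta>: "0 \<le> \<delta> i" if i: "i \<in> V" for i
      proof -
        have "a i \<in> X" "r (a i) = i" using a[OF i] by (auto simp: fibre_def)
        moreover have "0 \<le> (\<Sum>e\<in>E. incidence (a i) e * y' e)"
          using pos by (intro sum_nonneg mult_nonneg_nonneg) (auto simp: incidence_def)
        ultimately show ?thesis using load[of "a i"] a[OF i] by (simp add: \<delta>_def)
      qed
      have "(\<Sum>e\<in>E. incidence v e * y' e) \<le> real (w' v) + \<delta> v" if v: "v \<in> V" for v
        using load[of v] v V_subset r_id[OF v] w'[OF v] by (auto simp: \<delta>_def)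
      then obtain z where z: "\<forall>e\<in>E. 0 \<le> z e \<and> z e \<le> y' e"
        "\<forall>v\<in>V. (\<Sum>e\<in>E. incidence v e * z e) \<le> real (w' v)" "sum y' E - sum \<delta> V \<le> sum z E"
        using reduce_load[OF finite_V finE, of y' "\<lambda>v. real (w' v)" \<delta>] pos \<delta> by auto
      have "sum z E \<le> sum y0 E" using z by (intro y0_opt) (auto simp: dual_feasible_def)
      moreover have "sum \<delta> V = ?\<Omega> - (\<Sum>i\<in>V. y' (fibre i))" by (simp add: \<delta>_def sum_subtractf)
      ultimately show ?thesis unfolding split using z(3) by (simp add: y_E y_fibre)
    qed
    have "is_arg_max (\<lambda>y. \<Sum>e\<in>?E. y e) (dual_feasible X ?E w) y"
      unfolding is_arg_max_def using feas upper by (meson not_le)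
    moreover have "\<forall>e\<in>?E. y e \<in> \<int>" using y0(2) by (auto simp: y_def)
    ultimately show "\<exists>y. is_arg_max (\<lambda>y. \<Sum>e\<in>?E. y e) (dual_feasible X ?E w) y \<and> (\<forall>e\<in>?E. y e \<in> \<int>)" by blast
  qed
qed

end

text \<open>The fresh vertices are put in bijection with V \<times> {1..<d}, which gives d - 1 of
  them over each vertex and d together with the vertex itself. The infinite vertex type provides
  room for them.\<close>

lemma equal_fibres_retraction:
  fixes V :: "'v::infinite set"
  assumes V: "finite V" and d: "d \<ge> 1"
  obtains X r where "finite X" "V \<subseteq> X" "\<And>v. v \<in> X \<Longrightarrow> r v \<in> V" "\<And>v. v \<in> V \<Longrightarrow> r v = v"
    "\<And>i. i \<in> V \<Longrightarrow> card {v \<in> X. r v = i} = d"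
proof -
  have "infinite (- V)" using V infinite_UNIV by (metis finite_compl)
  then obtain Y where Y: "finite Y" "card Y = card (V \<times> {1..<d})" "Y \<subseteq> - V"
    using infinite_arbitrarily_large by blast
  have "finite (V \<times> {1..<d})" using V by simp
  from finite_same_card_bij[OF Y(1) this Y(2)] obtain h where h: "bij_betw h Y (V \<times> {1..<d})" by blast
  define r where "r v = (if v \<in> V then v else fst (h v))" for v
  show thesis
  proof (rule that[of "V \<union> Y" r])
    show "finite (V \<union> Y)" using V Y by simp
    show "r v \<in> V" if "v \<in> V \<union> Y" for v using that bij_betwE[OF h] by (auto simp: r_def)
    fix i assume i: "i \<in> V"
    have "bij_betw h {v \<in> Y. fst (h v) = i} ({i} \<times> {1..<d})"
      unfolding bij_betw_def
    proof
      show "inj_on h {v \<in> Y. fst (h v) = i}" using h by (auto simp: bij_betw_def intro: inj_on_subset)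
      show "h ` {v \<in> Y. fst (h v) = i} = {i} \<times> {1..<d}"
      proof
        show "h ` {v \<in> Y. fst (h v) = i} \<subseteq> {i} \<times> {1..<d}" using bij_betwE[OF h] by force
        show "{i} \<times> {1..<d} \<subseteq> h ` {v \<in> Y. fst (h v) = i}"
        proof
          fix p assume p: "p \<in> {i} \<times> {1..<d}"
          then have "p \<in> h ` Y" using h i by (auto simp: bij_betw_def)
          then obtain v where "v \<in> Y" "h v = p" by auto
          then show "p \<in> h ` {v \<in> Y. fst (h v) = i}" using p by (intro image_eqI[of _ _ v]) auto
        qed
      qed
    qed
    then have "card {v \<in> Y. fst (h v) = i} = d - 1" using bij_betw_same_card by fastforce
    moreover have "{v \<in> V \<union> Y. r v = i} = insert i {v \<in> Y. fst (h v) = i}"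
      using i Y(3) by (auto simp: r_def)
    moreover have "i \<notin> {v \<in> Y. fst (h v) = i}" using i Y(3) by auto
    ultimately show "card {v \<in> V \<union> Y. r v = i} = d" using Y(1) d by simp
  qed (auto simp: r_def)
qed

theorem corollary3p4:
  fixes K :: "'k::field itself"
    and V :: "'v::infinite set" and E :: "'v set set"
  assumes "covered_clutter V E" and "uniform E"
  shows "(packing_property K V E \<longrightarrow>
            (\<exists>V\<^sub>1 E\<^sub>1. covered_clutter V\<^sub>1 E\<^sub>1 \<and> uniform E\<^sub>1 \<and> cohen_macaulay_clutter K V\<^sub>1 E\<^sub>1 \<and>
               packing_property K V\<^sub>1 E\<^sub>1 \<and> is_minor K V E V\<^sub>1 E\<^sub>1)) \<and>
         (mfmc_property V E \<longrightarrow>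
            (\<exists>V\<^sub>1 E\<^sub>1. covered_clutter V\<^sub>1 E\<^sub>1 \<and> uniform E\<^sub>1 \<and> cohen_macaulay_clutter K V\<^sub>1 E\<^sub>1 \<and>
               mfmc_property V\<^sub>1 E\<^sub>1 \<and> is_minor K V E V\<^sub>1 E\<^sub>1))"
proof -
  have V: "finite V" "V \<noteq> {}" and E: "E \<subseteq> Pow V" and cover: "\<And>v. v \<in> V \<Longrightarrow> \<exists>e\<in>E. v \<in> e"
    using assms(1) by (auto simp: covered_clutter_def clutter_def)
  obtain d where d: "\<And>e. e \<in> E \<Longrightarrow> card e = d" using assms(2) by (auto simp: uniform_def)
  have finE: "finite e" if "e \<in> E" for e using that E V(1) by (meson PowD finite_subset subsetD)
  have "d \<ge> 1"
  proof -
    obtain v e where "v \<in> e" "e \<in> E" using V(2) cover by blast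
    then have "card e > 0" using finE[of e] by (auto simp: card_gt_0_iff)
    then show ?thesis using d[OF \<open>e \<in> E\<close>] by simp
  qed
  then obtain X r where X: "finite X" "V \<subseteq> X" "\<And>v. v \<in> X \<Longrightarrow> r v \<in> V" "\<And>v. v \<in> V \<Longrightarrow> r v = v"
    and card: "\<And>i. i \<in> V \<Longrightarrow> card {v \<in> X. r v = i} = d"
    by (rule equal_fibres_retraction[OF V(1)]) blast
  interpret whiskered X V r K by unfold_locales (fact X)+
  define E1 where "E1 = E \<union> fibre ` V"
  have card1: "card e = d" if "e \<in> E1" for e using that d card by (auto simp: E1_def fibre_def)
  have E1: "E1 \<subseteq> Pow X" using E V_subset fibre(1) by (auto simp: E1_def)
  have uniform1: "uniform E1" using card1 by (auto simp: uniform_def)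
  \<comment> \<open>A subset of the same finite cardinality is equal, so uniformity alone yields the
    antichain condition.\<close>
  have "clutter X E1" unfolding clutter_def
  proof (intro conjI ballI impI finite_X E1)
    fix e f assume "e \<in> E1" "f \<in> E1" "e \<subseteq> f"
    moreover from this have "finite f" using E1 finite_X by (meson PowD finite_subset subsetD)
    ultimately show "e = f" using card1 by (intro card_subset_eq) auto
  qed
  moreover have "\<exists>e\<in>E1. v \<in> e" if "v \<in> X" for v
    using that r_in[OF that] by (intro bexI[of _ "fibre (r v)"]) (auto simp: E1_def fibre_def)
  ultimately have covered1: "covered_clutter X E1"
    unfolding covered_clutter_def using V(2) V_subset by blast
  have cm: "cohen_macaulay_clutter K X E1" unfolding E1_def by (rule cohen_macaulay_whiskered[OF E])
  have minor: "is_minor K V E X E1"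
    unfolding is_minor_iff[OF finite_X E1]
  proof (rule conjI)
    show "clutter V E" using assms(1) by (simp add: covered_clutter_def)
  next
    let ?P = "\<lambda>Z U. Z \<subseteq> X \<and> U \<subseteq> X \<and> Z \<inter> U = {} \<and> V = X - (Z \<union> U) \<and> {} \<notin> minor_family E1 Z U \<and>
       refined_by E (minor_family E1 Z U) \<and> refined_by (minor_family E1 Z U) E"
    \<comment> \<open>Deleting the new vertices leaves the members of \<open>E1\<close> inside
      \<open>V\<close>. A fibre among them is a single vertex, which forces d = 1; then the edge of
      \<open>E\<close> through that vertex is the same singleton.\<close>
    have "?P (X - V) {}"
    proof (intro conjI)
      show "V = X - (X - V \<union> {})" using V_subset by auto
      let ?H = "minor_family E1 (X - V) {}"
      have H: "?H = {e \<in> E1. e \<subseteq> V}" using E1 by (auto simp: minor_family_def)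
      show "{} \<notin> ?H" using card1[of "{}"] \<open>d \<ge> 1\<close> by (auto simp: H)
      have "E \<subseteq> ?H" unfolding H using E by (auto simp: E1_def)
      then show "refined_by E ?H" unfolding refined_by_def by blast
      show "refined_by ?H E" unfolding refined_by_def
      proof
        fix h assume h: "h \<in> ?H"
        show "\<exists>e\<in>E. e \<subseteq> h"
        proof (cases "h \<in> E")
          case False
          then obtain i where i: "i \<in> V" "h = fibre i" "h \<subseteq> V" using h unfolding H by (auto simp: E1_def)
          then have "h = {i}" using fibre_Int[OF i(1)] by auto
          then have "d = 1" using card1[of h] h by (auto simp: H)
          obtain e where e: "e \<in> E" "i \<in> e" using cover[OF i(1)] by auto
          then have "e = {i}" using d[of e] \<open>d = 1\<close> by (auto simp: card_1_singleton_iff)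
          then show ?thesis using e \<open>h = {i}\<close> by auto
        qed auto
      qed
    qed auto
    then show "\<exists>Z U. ?P Z U" by blast
  qed
  \<comment> \<open>An edge can be a fibre only if d = 1. Then no vertices were added and all fibres
    are edges already, so \<open>E1\<close> is \<open>E\<close>.\<close>
  have "mfmc_property X E1" if mfmc: "mfmc_property V E"
  proof (cases "E \<inter> fibre ` V = {}")
    case True
    then show ?thesis unfolding E1_def by (intro mfmc_property_whiskered E mfmc)
  next
    case False
    then obtain i where i: "i \<in> V" "fibre i \<in> E" by auto
    then have "fibre i = {i}" using fibre_Int[OF i(1)] E by auto
    then have "d = 1" using d[OF i(2)] by simp
    have single: "fibre j = {j}" if "j \<in> V" for j
    proof -
      have "card (fibre j) = 1" using card[OF that] \<open>d = 1\<close> by (simp add: fibre_def)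
      then obtain x where "fibre j = {x}" by (rule card_1_singletonE)
      then show ?thesis using self_in_fibre[OF that] by simp
    qed
    have "v \<in> V" if v: "v \<in> X" for v
    proof -
      have "v \<in> fibre (r v)" using v by (simp add: fibre_def)
      then show ?thesis using single[OF r_in[OF v]] r_in[OF v] by simp
    qed
    then have "X = V" using V_subset by blast
    moreover have "fibre ` V \<subseteq> E"
    proof clarify
      fix j assume j: "j \<in> V"
      then obtain e where e: "e \<in> E" "j \<in> e" using cover by auto
      then have "e = {j}" using d[of e] \<open>d = 1\<close> by (auto simp: card_1_singleton_iff)
      then show "fibre j \<in> E" using e single[OF j] by simp
    qed
    ultimately show ?thesis using mfmc by (simp add: E1_def Un_absorb2)
  qed
  moreover have "packing_property K X E1" if "packing_property K V E"
    unfolding E1_def by (rule packing_property_whiskered[OF E that])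
  ultimately show ?thesis using covered1 uniform1 cm minor by blast
qed

end
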